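(* Let $S$ be a nonzero Noetherian ring, let $1\le t\le n$, let $X$ be a generic symmetric $n\times n$ matrix over $S$, and let $I=I_t(X)\subseteq S[X]$. Then $I$ satisfies $G_\infty$ if and only if $t=1$, $t=n$, or $t=n-1$. Otherwise, the maximal $s$ for which $I$ satisfies $G_s$ is $s=\binom{n-t+3}{2}$.
   Context: A generic symmetric matrix over $S$ is a symmetric matrix whose entries on and above the diagonal are distinct indeterminates over $S$; $S[X]$ is the polynomial ring over $S$ in these entries. $I_t(X)$ is the ideal generated by the $t\times t$ minors. An ideal $I$ of a Noetherian ring $R$ satisfies $G_s$ if $\mu_{R_{\mathfrak p}}(I_{\mathfrak p})\le\dim R_{\mathfrak p}$ for every prime $\mathfrak p\in V(I)$ with $\dim R_{\mathfrak p}\le s-1$, where $\mu$ is the minimal number of generators; $I$ satisfies $G_\infty$ if it satisfies $G_s$ for every $s$. *)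

theory Defs
  imports "HOL-Algebra.Indexed_Polynomials" "HOL-Algebra.Ring_Divisibility"
    "HOL-Combinatorics.Permutations" "HOL-Library.Extended_Nat"
begin

section \<open>Polynomial rings in a set of indeterminates\<close>

text \<open>
  The library provides the set of polynomials over \<open>R\<close> in the indeterminates indexed by \<open>I\<close>
  (functions from monomials, i.e. multisets of indices, to coefficients) together with its
  addition, constants and indeterminates, but not its multiplication. A monomial that
  divides \<open>m\<close> is a submultiset \<open>a\<close> of \<open>m\<close>, with cofactor \<open>m - a\<close>.
\<close>

definition indexed_mult ::
  "('a, 'b) ring_scheme \<Rightarrow> ('c multiset \<Rightarrow> 'a) \<Rightarrow> ('c multiset \<Rightarrow> 'a) \<Rightarrow> ('c multiset \<Rightarrow> 'a)"
  where "indexed_mult R P Q = (\<lambda>m. \<Oplus>\<^bsub>R\<^esub>a\<in>{a. a \<subseteq># m}. P a \<otimes>\<^bsub>R\<^esub> Q (m - a))"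

definition indexed_poly_ring ::
  "('a, 'b) ring_scheme \<Rightarrow> 'c set \<Rightarrow> ('c multiset \<Rightarrow> 'a) ring"
  where "indexed_poly_ring R I =
    \<lparr>carrier = ring.indexed_pset R I (carrier R),
     monoid.mult = indexed_mult R,
     one = ring.indexed_const R \<one>\<^bsub>R\<^esub>,
     zero = ring.indexed_const R \<zero>\<^bsub>R\<^esub>,
     add = ring.indexed_padd R\<rparr>"


section \<open>Minors of the generic symmetric matrix\<close>

text \<open>Matrices are functions of two indices, of which only those below the size matter.\<close>

definition mat_det :: "('a, 'b) ring_scheme \<Rightarrow> nat \<Rightarrow> (nat \<Rightarrow> nat \<Rightarrow> 'a) \<Rightarrow> 'a"
  where "mat_det R t A =
    (\<Oplus>\<^bsub>R\<^esub>\<sigma>\<in>{\<sigma>. \<sigma> permutes {..<t}}.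
       [sign \<sigma>] \<cdot>\<^bsub>R\<^esub> (\<Otimes>\<^bsub>R\<^esub>i\<in>{..<t}. A i (\<sigma> i)))"

text \<open>A choice of \<open>t\<close> rows (or columns) out of \<open>n\<close>, as an increasing enumeration.\<close>

definition selections :: "nat \<Rightarrow> nat \<Rightarrow> (nat \<Rightarrow> nat) set"
  where "selections t n = {r. strict_mono_on {..<t} r \<and> r ` {..<t} \<subseteq> {..<n}}"

definition minors ::
  "('a, 'b) ring_scheme \<Rightarrow> nat \<Rightarrow> nat \<Rightarrow> (nat \<Rightarrow> nat \<Rightarrow> 'a) \<Rightarrow> 'a set"
  where "minors R n t A =
    {mat_det R t (\<lambda>i j. A (r i) (c j)) | r c. r \<in> selections t n \<and> c \<in> selections t n}"

definition minor_ideal ::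
  "('a, 'b) ring_scheme \<Rightarrow> nat \<Rightarrow> nat \<Rightarrow> (nat \<Rightarrow> nat \<Rightarrow> 'a) \<Rightarrow> 'a set"
  where "minor_ideal R n t A = Idl\<^bsub>R\<^esub> (minors R n t A)"

definition sym_indices :: "nat \<Rightarrow> (nat \<times> nat) set"
  where "sym_indices n = {(i, j). i \<le> j \<and> j < n}"

definition sym_poly_ring :: "('a, 'b) ring_scheme \<Rightarrow> nat \<Rightarrow> ((nat \<times> nat) multiset \<Rightarrow> 'a) ring"
  where "sym_poly_ring S n = indexed_poly_ring S (sym_indices n)"

definition generic_sym_matrix ::
  "('a, 'b) ring_scheme \<Rightarrow> nat \<Rightarrow> nat \<Rightarrow> ((nat \<times> nat) multiset \<Rightarrow> 'a)"
  where "generic_sym_matrix S i j = ring.indexed_var S (min i j, max i j)"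


section \<open>Localization\<close>

text \<open>Fractions with denominators in \<open>M\<close>, as classes of pairs (numerator, denominator).\<close>

definition loc_frac :: "('a, 'b) ring_scheme \<Rightarrow> 'a set \<Rightarrow> 'a \<Rightarrow> 'a \<Rightarrow> ('a \<times> 'a) set"
  where "loc_frac R M a s =
    {(b, t). b \<in> carrier R \<and> t \<in> M \<and>
       (\<exists>u\<in>M. u \<otimes>\<^bsub>R\<^esub> (a \<otimes>\<^bsub>R\<^esub> t) = u \<otimes>\<^bsub>R\<^esub> (b \<otimes>\<^bsub>R\<^esub> s))}"

definition localization :: "('a, 'b) ring_scheme \<Rightarrow> 'a set \<Rightarrow> ('a \<times> 'a) set ring"
  where "localization R M =
    \<lparr>carrier = {loc_frac R M a s | a s. a \<in> carrier R \<and> s \<in> M},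
     monoid.mult = (\<lambda>x y. \<Union>(a, s)\<in>x. \<Union>(b, t)\<in>y. loc_frac R M (a \<otimes>\<^bsub>R\<^esub> b) (s \<otimes>\<^bsub>R\<^esub> t)),
     one = loc_frac R M \<one>\<^bsub>R\<^esub> \<one>\<^bsub>R\<^esub>,
     zero = loc_frac R M \<zero>\<^bsub>R\<^esub> \<one>\<^bsub>R\<^esub>,
     add = (\<lambda>x y. \<Union>(a, s)\<in>x. \<Union>(b, t)\<in>y.
              loc_frac R M ((a \<otimes>\<^bsub>R\<^esub> t) \<oplus>\<^bsub>R\<^esub> (b \<otimes>\<^bsub>R\<^esub> s)) (s \<otimes>\<^bsub>R\<^esub> t))\<rparr>"

definition loc_at :: "('a, 'b) ring_scheme \<Rightarrow> 'a set \<Rightarrow> ('a \<times> 'a) set ring"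
  where "loc_at R p = localization R (carrier R - p)"

definition ideal_at :: "('a, 'b) ring_scheme \<Rightarrow> 'a set \<Rightarrow> 'a set \<Rightarrow> ('a \<times> 'a) set set"
  where "ideal_at R p I =
    Idl\<^bsub>loc_at R p\<^esub> ((\<lambda>a. loc_frac R (carrier R - p) a \<one>\<^bsub>R\<^esub>) ` I)"


section \<open>Dimension, number of generators, and the condition G\<close>

definition krull_dim :: "('a, 'b) ring_scheme \<Rightarrow> enat"
  where "krull_dim R = Sup {enat d | d. \<exists>P :: nat \<Rightarrow> 'a set.
    (\<forall>i\<le>d. primeideal (P i) R) \<and> (\<forall>i<d. P i \<subset> P (Suc i))}"

text \<open>The value is \<open>\<infinity>\<close> if the ideal is not finitely generated.\<close>

definition min_gens :: "('a, 'b) ring_scheme \<Rightarrow> 'a set \<Rightarrow> enat"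
  where "min_gens R I = Inf {enat (card A) | A. finite A \<and> A \<subseteq> carrier R \<and> Idl\<^bsub>R\<^esub> A = I}"

text \<open>The condition \<open>dim R\<^sub>p \<le> s - 1\<close> is written without subtraction.\<close>

definition satisfies_G :: "('a, 'b) ring_scheme \<Rightarrow> 'a set \<Rightarrow> nat \<Rightarrow> bool"
  where "satisfies_G R I s \<longleftrightarrow>
    (\<forall>p. primeideal p R \<and> I \<subseteq> p \<and> krull_dim (loc_at R p) + 1 \<le> enat s \<longrightarrow>
         min_gens (loc_at R p) (ideal_at R p I) \<le> krull_dim (loc_at R p))"

definition satisfies_G_infinity :: "('a, 'b) ring_scheme \<Rightarrow> 'a set \<Rightarrow> bool"
  where "satisfies_G_infinity R I \<longleftrightarrow> (\<forall>s. satisfies_G R I s)"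

end

theory Submission
  imports Defs "Jordan_Normal_Form.Determinant" "HOL-Library.Poly_Mapping"
begin

definition class_ideal :: "'z::comm_ring_1 set \<Rightarrow> bool"
  where "class_ideal \<pp> \<longleftrightarrow> 0 \<in> \<pp> \<and> (\<forall>a\<in>\<pp>. \<forall>b\<in>\<pp>. a + b \<in> \<pp>) \<and> (\<forall>a\<in>\<pp>. \<forall>c. c * a \<in> \<pp>)"

definition class_subring :: "'z::comm_ring_1 set \<Rightarrow> bool"
  where "class_subring T \<longleftrightarrow>
    1 \<in> T \<and> (\<forall>a\<in>T. \<forall>b\<in>T. a + b \<in> T \<and> a * b \<in> T) \<and> (\<forall>a\<in>T. - a \<in> T)"

lemma class_ideal_sum:
  assumes "class_ideal \<pp>" "\<And>x. x \<in> A \<Longrightarrow> f x \<in> \<pp>"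
  shows "sum f A \<in> \<pp>"
  using assms(2) by (induct A rule: infinite_finite_induct)
    (use assms(1) in \<open>auto simp: class_ideal_def\<close>)

lemma class_ideal_mult_left: "class_ideal \<pp> \<Longrightarrow> a \<in> \<pp> \<Longrightarrow> c * a \<in> \<pp>"
  by (simp add: class_ideal_def)

lemma class_ideal_mult_right: "class_ideal \<pp> \<Longrightarrow> a \<in> \<pp> \<Longrightarrow> a * c \<in> \<pp>"
  by (simp add: class_ideal_def mult.commute)

lemma class_ideal_add: "class_ideal \<pp> \<Longrightarrow> a \<in> \<pp> \<Longrightarrow> b \<in> \<pp> \<Longrightarrow> a + b \<in> \<pp>"
  by (simp add: class_ideal_def)

lemma class_ideal_uminus: "class_ideal \<pp> \<Longrightarrow> a \<in> \<pp> \<Longrightarrow> - a \<in> \<pp>"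
  using class_ideal_mult_left[of \<pp> a "-1"] by simp

lemma class_ideal_diff: "class_ideal \<pp> \<Longrightarrow> a \<in> \<pp> \<Longrightarrow> b \<in> \<pp> \<Longrightarrow> a - b \<in> \<pp>"
  using class_ideal_add[of \<pp> a "-b"] class_ideal_uminus by auto

lemma class_subring_sum:
  assumes "class_subring T" "\<And>x. x \<in> A \<Longrightarrow> f x \<in> T"
  shows "sum f A \<in> T"
proof -
  have "1 + - 1 \<in> T" using assms(1) unfolding class_subring_def by blast
  then have "0 \<in> T" by simp
  then show ?thesis using assms(2) by (induct A rule: infinite_finite_induct)
    (use assms(1) in \<open>auto simp: class_subring_def\<close>)
qed

lemma class_subring_prod:
  assumes "class_subring T" "\<And>x. x \<in> A \<Longrightarrow> f x \<in> T"
  shows "prod f A \<in> T"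
  using assms(2) by (induct A rule: infinite_finite_induct)
    (use assms(1) in \<open>auto simp: class_subring_def\<close>)

lemma class_subring_sign: "class_subring T \<Longrightarrow> (- 1) ^ k \<in> T"
  by (induct k) (auto simp: class_subring_def)

definition fdet :: "nat \<Rightarrow> (nat \<Rightarrow> nat \<Rightarrow> 'z::comm_ring_1) \<Rightarrow> 'z"
  where "fdet t A = det (mat t t (\<lambda>(i, j). A i j))"

definition sub_det :: "(nat \<Rightarrow> nat \<Rightarrow> 'z::comm_ring_1) \<Rightarrow> nat \<Rightarrow> (nat \<Rightarrow> nat) \<Rightarrow> (nat \<Rightarrow> nat) \<Rightarrow> 'z"
  where "sub_det Y t f g = fdet t (\<lambda>a b. Y (f a) (g b))"

lemma fdet_leibniz:
  "fdet t A = (\<Sum>p | p permutes {..<t}. of_int (sign p) * (\<Prod>i<t. A i (p i)))"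
proof -
  have "fdet t A = (\<Sum>p | p permutes {0..<t}. signof p * (\<Prod>i = 0..<t. mat t t (\<lambda>(i, j). A i j) $$ (i, p i)))"
    unfolding fdet_def by (rule det_def') simp
  also have "\<dots> = (\<Sum>p | p permutes {0..<t}. of_int (sign p) * (\<Prod>i = 0..<t. A i (p i)))"
  proof (rule sum.cong)
    fix p assume "p \<in> {p. p permutes {0..<t}}"
    then have p: "p permutes {0..<t}" by simp
    have "(\<Prod>i = 0..<t. mat t t (\<lambda>(i, j). A i j) $$ (i, p i)) = (\<Prod>i = 0..<t. A i (p i))"
      by (rule prod.cong) (use permutes_in_image[OF p] in auto)
    then show "signof p * (\<Prod>i = 0..<t. mat t t (\<lambda>(i, j). A i j) $$ (i, p i))
        = of_int (sign p) * (\<Prod>i = 0..<t. A i (p i))" by (simp add: sign_def)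
  qed simp
  finally show ?thesis by (simp add: lessThan_atLeast0)
qed

lemma fdet_cong:
  assumes "\<And>i j. i < t \<Longrightarrow> j < t \<Longrightarrow> A i j = B i j"
  shows "fdet t A = fdet t B"
proof -
  have "mat t t (\<lambda>(i, j). A i j) = mat t t (\<lambda>(i, j). B i j)" by (rule eq_matI) (use assms in auto)
  then show ?thesis by (simp add: fdet_def)
qed

lemma sub_det_cong:
  assumes "\<And>i. i < t \<Longrightarrow> f i = f' i" "\<And>i. i < t \<Longrightarrow> g i = g' i"
  shows "sub_det Y t f g = sub_det Y t f' g'"
  unfolding sub_det_def by (rule fdet_cong) (simp add: assms)

lemma fdet_transpose: "fdet t (\<lambda>i j. A j i) = fdet t A"
proof -
  have "mat t t (\<lambda>(i, j). A j i) = transpose_mat (mat t t (\<lambda>(i, j). A i j))"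
    by (rule eq_matI) auto
  then show ?thesis unfolding fdet_def by (simp add: det_transpose[of _ t])
qed

lemma sub_det_commute:
  assumes "\<And>i j. Y i j = Y j i"
  shows "sub_det Y t f g = sub_det Y t g f"
proof -
  have "sub_det Y t f g = fdet t (\<lambda>a b. Y (g b) (f a))" unfolding sub_det_def by (rule fdet_cong) (rule assms)
  also have "\<dots> = sub_det Y t g f" unfolding sub_det_def by (rule fdet_transpose)
  finally show ?thesis .
qed

lemma fdet_smult: "fdet t (\<lambda>i j. c * A i j) = c ^ t * fdet t A"
proof -
  have "mat t t (\<lambda>(i, j). c * A i j) = c \<cdot>\<^sub>m mat t t (\<lambda>(i, j). A i j)" by (rule eq_matI) auto
  then show ?thesis by (simp add: fdet_def)
qed

lemma sub_det_noninj_zero: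
  assumes "\<not> inj_on f {..<t} \<or> \<not> inj_on g {..<t}"
  shows "sub_det Y t f g = 0"
proof -
  have *: "sub_det Y t f g = 0" if "\<not> inj_on f {..<t}" for Y :: "nat \<Rightarrow> nat \<Rightarrow> 'a" and f g
  proof -
    obtain i j where ij: "i < t" "j < t" "i \<noteq> j" "f i = f j" using \<open>\<not> inj_on f {..<t}\<close> by (auto simp: inj_on_def)
    show ?thesis unfolding sub_det_def fdet_def
      by (rule det_identical_rows[of _ t i j]) (use ij in auto)
  qed
  show ?thesis
  proof (cases "inj_on f {..<t}")
    case False then show ?thesis by (rule *)
  next
    case True
    then have "sub_det (\<lambda>i j. Y j i) t g f = 0" using assms by (intro *) auto
    then show ?thesis unfolding sub_det_def using fdet_transpose[of t "\<lambda>a b. Y (f a) (g b)"] by simp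
  qed
qed

lemma fdet_mem_subring:
  assumes "class_subring T" "\<And>i j. i < t \<Longrightarrow> j < t \<Longrightarrow> A i j \<in> T"
  shows "fdet t A \<in> T"
  unfolding fdet_leibniz
proof (rule class_subring_sum[OF assms(1)])
  fix p assume "p \<in> {p. p permutes {..<t}}"
  then have p: "p permutes {..<t}" by simp
  have "(\<Prod>i<t. A i (p i)) \<in> T"
    by (rule class_subring_prod[OF assms(1)]) (use permutes_in_image[OF p] assms(2) in auto)
  then show "of_int (sign p) * (\<Prod>i<t. A i (p i)) \<in> T"
    using assms(1) by (auto simp: sign_def class_subring_def)
qed

lemma sub_det_last_row:
  assumes T: "class_subring T"
    and "\<And>a b. a < r \<Longrightarrow> b < r \<Longrightarrow> Y (f a) (g b) \<in> T"
    and "\<And>a. a < r \<Longrightarrow> Y (f a) j \<in> T" and "\<And>b. b < r \<Longrightarrow> Y i (g b) \<in> T"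
  shows "\<exists>c\<in>T. sub_det Y (Suc r) (f(r := i)) (g(r := j)) = sub_det Y r f g * Y i j + c"
proof -
  define M where "M = mat (Suc r) (Suc r) (\<lambda>(a, b). Y ((f(r := i)) a) ((g(r := j)) b))"
  have M: "M \<in> carrier_mat (Suc r) (Suc r)" by (simp add: M_def)
  define c where "c = (\<Sum>b<r. M $$ (r, b) * cofactor M r b)"
  have "det M = (\<Sum>b<Suc r. M $$ (r, b) * cofactor M r b)"
    by (rule laplace_expansion_row[OF M]) simp
  moreover have "mat_delete M r r = mat r r (\<lambda>(a, b). Y (f a) (g b))"
    by (rule eq_matI) (auto simp: mat_delete_def M_def)
  then have "cofactor M r r = sub_det Y r f g"
    by (simp add: cofactor_def sub_det_def fdet_def)
  moreover have "M $$ (r, r) = Y i j" by (simp add: M_def)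
  ultimately have "det M = sub_det Y r f g * Y i j + c" by (simp add: c_def mult.commute)
  moreover have "c \<in> T" unfolding c_def
  proof (rule class_subring_sum[OF T])
    fix b assume b: "b \<in> {..<r}"
    have "mat_delete M r b = mat r r (\<lambda>(i', j'). mat_delete M r b $$ (i', j'))"
      by (rule eq_matI) (auto simp: mat_delete_def M_def)
    then have "det (mat_delete M r b) = fdet r (\<lambda>i' j'. mat_delete M r b $$ (i', j'))"
      by (simp add: fdet_def)
    also have "\<dots> \<in> T"
      by (rule fdet_mem_subring[OF T]) (use b assms in \<open>auto simp: mat_delete_def M_def\<close>)
    finally have "cofactor M r b \<in> T"
      unfolding cofactor_def using class_subring_sign[OF T] T by (auto simp: class_subring_def)
    moreover have "M $$ (r, b) \<in> T" using b assms(4) by (auto simp: M_def)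
    ultimately show "M $$ (r, b) * cofactor M r b \<in> T" using T by (auto simp: class_subring_def)
  qed
  ultimately show ?thesis unfolding sub_det_def fdet_def M_def by auto
qed

text \<open>The Schur complement of the submatrix with rows \<open>f\<close> and columns \<open>g\<close>, cleared of denominators.\<close>

definition schur :: "(nat \<Rightarrow> nat \<Rightarrow> 'z::comm_ring_1) \<Rightarrow> nat \<Rightarrow> (nat \<Rightarrow> nat) \<Rightarrow> (nat \<Rightarrow> nat) \<Rightarrow> nat \<Rightarrow> nat \<Rightarrow> 'z"
  where "schur Y r f g i j = sub_det Y r f g * Y i j
     - (\<Sum>p<r. Y i (g p) * (\<Sum>q<r. adj_mat (mat r r (\<lambda>(a, b). Y (f a) (g b))) $$ (p, q) * Y (f q) j))"

lemma schur_cong: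
  assumes "\<And>i. i < r \<Longrightarrow> f i = f' i" "\<And>i. i < r \<Longrightarrow> g i = g' i"
  shows "schur Y r f g = schur Y r f' g'"
proof -
  have "mat r r (\<lambda>(a, b). Y (f a) (g b)) = mat r r (\<lambda>(a, b). Y (f' a) (g' b))"
    by (rule eq_matI) (auto simp: assms)
  then show ?thesis unfolding schur_def using sub_det_cong[of r f f' g g' Y] assms by auto
qed

lemma mult_mat_entry:
  assumes "A \<in> carrier_mat n m" "B \<in> carrier_mat m k" "i < n" "j < k"
  shows "(A * B) $$ (i, j) = (\<Sum>l<m. A $$ (i, l) * B $$ (l, j))"
  using assms by (auto simp: scalar_prod_def lessThan_atLeast0 intro!: sum.cong)

lemma sub_det_schur:
  fixes Y :: "nat \<Rightarrow> nat \<Rightarrow> 'z::idom"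
  shows "sub_det Y r f g ^ t * sub_det Y (r + t) f g
    = sub_det Y r f g * fdet t (\<lambda>a b. schur Y r f g (f (r + a)) (g (r + b)))"
proof -
  define \<Delta> where "\<Delta> = sub_det Y r f g"
  define A where "A = mat r r (\<lambda>(a, b). Y (f a) (g b))"
  define B where "B = mat r t (\<lambda>(a, b). Y (f a) (g (r + b)))"
  define C where "C = mat t r (\<lambda>(a, b). Y (f (r + a)) (g b))"
  define D where "D = mat t t (\<lambda>(a, b). Y (f (r + a)) (g (r + b)))"
  define N where "N = C * ((- 1) \<cdot>\<^sub>m (adj_mat A * B)) + D * (\<Delta> \<cdot>\<^sub>m 1\<^sub>m t)"
  have carr [simp]: "A \<in> carrier_mat r r" "B \<in> carrier_mat r t" "C \<in> carrier_mat t r" "D \<in> carrier_mat t t"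
    by (auto simp: A_def B_def C_def D_def)
  have adj: "adj_mat A \<in> carrier_mat r r" "A * adj_mat A = det A \<cdot>\<^sub>m 1\<^sub>m r"
    using adj_mat[of A r] by auto
  have \<Delta>: "det A = \<Delta>" by (simp add: \<Delta>_def A_def sub_det_def fdet_def)
  have adjB [simp]: "adj_mat A * B \<in> carrier_mat r t" by (rule mult_carrier_mat[OF adj(1) carr(2)])
  have N: "N \<in> carrier_mat t t" unfolding N_def
    by (intro add_carrier_mat mult_carrier_mat[of D t t] smult_carrier_mat one_carrier_mat carr)
  let ?M = "four_block_mat A B C D"
  let ?U = "four_block_mat (1\<^sub>m r) ((- 1) \<cdot>\<^sub>m (adj_mat A * B)) (0\<^sub>m t r) (\<Delta> \<cdot>\<^sub>m 1\<^sub>m t)"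
  have M: "?M = mat (r + t) (r + t) (\<lambda>(a, b). Y (f a) (g b))"
    by (rule eq_matI) (auto simp: A_def B_def C_def D_def)
  have AB: "A * ((- 1) \<cdot>\<^sub>m (adj_mat A * B)) = (- \<Delta>) \<cdot>\<^sub>m B"
  proof -
    have "A * (adj_mat A * B) = (A * adj_mat A) * B" by (rule assoc_mult_mat[symmetric, OF carr(1) adj(1) carr(2)])
    also have "\<dots> = \<Delta> \<cdot>\<^sub>m B"
      unfolding adj(2) \<Delta> mult_smult_assoc_mat[OF one_carrier_mat carr(2)]
      by (simp add: left_mult_one_mat[OF carr(2)])
    finally have "A * (adj_mat A * B) = \<Delta> \<cdot>\<^sub>m B" .
    then show ?thesis unfolding mult_smult_distrib[OF carr(1) adjB] by (auto intro!: eq_matI)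
  qed
  have "?M * ?U = four_block_mat (A * 1\<^sub>m r + B * 0\<^sub>m t r) (A * ((- 1) \<cdot>\<^sub>m (adj_mat A * B)) + B * (\<Delta> \<cdot>\<^sub>m 1\<^sub>m t))
     (C * 1\<^sub>m r + D * 0\<^sub>m t r) N"
    unfolding N_def by (rule mult_four_block_mat[of _ r r _ t _ t])
      (auto simp del: carrier_matD intro!: smult_carrier_mat)
  also have "A * ((- 1) \<cdot>\<^sub>m (adj_mat A * B)) + B * (\<Delta> \<cdot>\<^sub>m 1\<^sub>m t) = 0\<^sub>m r t"
    unfolding AB mult_smult_distrib[OF carr(2) one_carrier_mat] right_mult_one_mat[OF carr(2)]
    by (rule eq_matI) (simp_all add: carrier_matD[OF carr(2)])
  also have "A * 1\<^sub>m r + B * 0\<^sub>m t r = A"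
    unfolding right_mult_one_mat[OF carr(1)] right_mult_zero_mat[OF carr(2)] by (rule right_add_zero_mat[OF carr(1)])
  also have "C * 1\<^sub>m r + D * 0\<^sub>m t r = C"
    unfolding right_mult_one_mat[OF carr(3)] right_mult_zero_mat[OF carr(4)] by (rule right_add_zero_mat[OF carr(3)])
  finally have "?M * ?U = four_block_mat A (0\<^sub>m r t) C N" .
  then have "det (?M * ?U) = det A * det N"
    using det_four_block_mat_upper_right_zero[of A r "0\<^sub>m r t" t C N] N by simp
  moreover have "det (?M * ?U) = det ?M * det ?U"
    by (rule det_mult[of _ "r + t"]) (auto simp del: carrier_matD intro!: four_block_carrier_mat smult_carrier_mat)
  moreover have "det ?U = \<Delta> ^ t"
    using det_four_block_mat_lower_left_zero[of "1\<^sub>m r" r "(- 1) \<cdot>\<^sub>m (adj_mat A * B)" t "0\<^sub>m t r" "\<Delta> \<cdot>\<^sub>m 1\<^sub>m t"] adj by simp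
  moreover have "det ?M = sub_det Y (r + t) f g" by (simp add: M sub_det_def fdet_def)
  moreover have "N = mat t t (\<lambda>(a, b). schur Y r f g (f (r + a)) (g (r + b)))"
  proof (rule eq_matI)
    fix a b assume "a < dim_row (mat t t (\<lambda>(a, b). schur Y r f g (f (r + a)) (g (r + b))))"
      and "b < dim_col (mat t t (\<lambda>(a, b). schur Y r f g (f (r + a)) (g (r + b))))"
    then have ab: "a < t" "b < t" by auto
    have "N $$ (a, b) = - ((C * (adj_mat A * B)) $$ (a, b)) + \<Delta> * D $$ (a, b)"
      unfolding N_def mult_smult_distrib[OF carr(4) one_carrier_mat] mult_smult_distrib[OF carr(3) adjB]
        right_mult_one_mat[OF carr(4)]
      using ab by (simp add: carrier_matD[OF carr(4)] carrier_matD[OF carr(3)] carrier_matD[OF carr(2)])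
    also have "(C * (adj_mat A * B)) $$ (a, b) = (\<Sum>p<r. C $$ (a, p) * (adj_mat A * B) $$ (p, b))"
      by (rule mult_mat_entry[OF carr(3) adjB ab])
    also have "\<dots> = (\<Sum>p<r. Y (f (r + a)) (g p) * (\<Sum>q<r. adj_mat A $$ (p, q) * Y (f q) (g (r + b))))"
    proof (rule sum.cong)
      fix p assume p: "p \<in> {..<r}"
      have "(\<Sum>q<r. adj_mat A $$ (p, q) * B $$ (q, b)) = (\<Sum>q<r. adj_mat A $$ (p, q) * Y (f q) (g (r + b)))"
        by (rule sum.cong) (use ab in \<open>auto simp: B_def\<close>)
      moreover have "C $$ (a, p) = Y (f (r + a)) (g p)" using ab p by (simp add: C_def)
      ultimately show "C $$ (a, p) * (adj_mat A * B) $$ (p, b)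
          = Y (f (r + a)) (g p) * (\<Sum>q<r. adj_mat A $$ (p, q) * Y (f q) (g (r + b)))"
        using mult_mat_entry[OF adj(1) carr(2), of p b] p ab by simp
    qed simp
    finally have "N $$ (a, b) = - (\<Sum>p<r. Y (f (r + a)) (g p) * (\<Sum>q<r. adj_mat A $$ (p, q) * Y (f q) (g (r + b))))
      + D $$ (a, b) * \<Delta>" by (simp add: mult.commute)
    then show "N $$ (a, b) = mat t t (\<lambda>(a, b). schur Y r f g (f (r + a)) (g (r + b))) $$ (a, b)"
      using ab by (simp add: schur_def A_def[symmetric] \<Delta>_def[symmetric] D_def mult.commute)
  qed (use N in auto)
  ultimately show ?thesis by (simp add: \<Delta> fdet_def \<Delta>_def[symmetric] mult.commute)
qed

lemma bordered_schur:
  fixes Y :: "nat \<Rightarrow> nat \<Rightarrow> 'z::idom"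
  shows "sub_det Y r f g * sub_det Y (Suc r) (f(r := i)) (g(r := j)) = sub_det Y r f g * schur Y r f g i j"
proof -
  have 1: "sub_det Y r (f(r := i)) (g(r := j)) = sub_det Y r f g" by (rule sub_det_cong) auto
  have 2: "schur Y r (f(r := i)) (g(r := j)) = schur Y r f g" by (rule schur_cong) auto
  have "fdet 1 (\<lambda>a b. schur Y r f g ((f(r := i)) (r + a)) ((g(r := j)) (r + b))) = schur Y r f g i j"
    unfolding fdet_def by (subst det_single) auto
  then show ?thesis using sub_det_schur[of Y r "f(r := i)" "g(r := j)" 1] unfolding 1 2 by simp
qed

lemma fdet_2: "fdet 2 A = A 0 0 * A 1 1 - A 0 1 * A 1 0"
proof -
  define M where "M = mat 2 2 (\<lambda>(i, j). A i j)"
  have M: "M \<in> carrier_mat 2 2" by (simp add: M_def)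
  have "det (mat_delete M 0 0) = A 1 1" "det (mat_delete M 0 1) = A 1 0"
    by (subst det_single; simp add: mat_delete_def M_def)+
  then show ?thesis
    using laplace_expansion_row[OF M, of 0] unfolding fdet_def M_def[symmetric]
    by (simp add: cofactor_def numeral_2_eq_2) (simp add: M_def)
qed

lemma fdet_add_mult:
  fixes E P Q :: "nat \<Rightarrow> nat \<Rightarrow> 'z::idom"
  shows "fdet t (\<lambda>a b. E a b + (\<Sum>p<r. P a p * Q p b))
    = fdet (r + t) (\<lambda>i j. if i < r then (if j < r then (if i = j then 1 else 0) else - Q i (j - r))
        else if j < r then P (i - r) j else E (i - r) (j - r))" (is "?l = fdet _ ?F")
proof -
  define E' where "E' = mat t t (\<lambda>(a, b). E a b)"
  define P' where "P' = mat t r (\<lambda>(a, b). P a b)"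
  define Q' where "Q' = mat r t (\<lambda>(a, b). Q a b)"
  define Q'' where "Q'' = mat r t (\<lambda>(a, b). - Q a b)"
  have c: "E' \<in> carrier_mat t t" "P' \<in> carrier_mat t r" "Q' \<in> carrier_mat r t" "Q'' \<in> carrier_mat r t"
    by (auto simp: E'_def P'_def Q'_def Q''_def)
  let ?M = "four_block_mat (1\<^sub>m r) Q'' P' E'"
  let ?U = "four_block_mat (1\<^sub>m r) Q' (0\<^sub>m t r) (1\<^sub>m t)"
  have PQ: "P' * Q' + E' \<in> carrier_mat t t" using c by auto
  have "?M * ?U = four_block_mat (1\<^sub>m r * 1\<^sub>m r + Q'' * 0\<^sub>m t r) (1\<^sub>m r * Q' + Q'' * 1\<^sub>m t)
     (P' * 1\<^sub>m r + E' * 0\<^sub>m t r) (P' * Q' + E' * 1\<^sub>m t)"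
    by (rule mult_four_block_mat) (use c in auto)
  also have "1\<^sub>m r * 1\<^sub>m r + Q'' * 0\<^sub>m t r = 1\<^sub>m r" using c by simp
  also have "1\<^sub>m r * Q' + Q'' * 1\<^sub>m t = 0\<^sub>m r t"
    unfolding left_mult_one_mat[OF c(3)] right_mult_one_mat[OF c(4)]
    by (rule eq_matI) (auto simp: Q'_def Q''_def)
  also have "P' * 1\<^sub>m r + E' * 0\<^sub>m t r = P'" using c by simp
  also have "P' * Q' + E' * 1\<^sub>m t = P' * Q' + E'" using c by simp
  finally have "det (?M * ?U) = det (1\<^sub>m r :: 'z mat) * det (P' * Q' + E')"
    using det_four_block_mat_upper_right_zero[of "1\<^sub>m r" r "0\<^sub>m r t" t P' "P' * Q' + E'"] c PQ by simp
  moreover have "det (?M * ?U) = det ?M * det ?U"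
    by (rule det_mult[of _ "r + t"]) (use c in auto)
  moreover have "det ?U = 1"
    using det_four_block_mat_lower_left_zero[of "1\<^sub>m r" r Q' t "0\<^sub>m t r" "1\<^sub>m t"] c by simp
  moreover have "P' * Q' + E' = mat t t (\<lambda>(a, b). E a b + (\<Sum>p<r. P a p * Q p b))"
    by (rule eq_matI) (auto simp: E'_def P'_def Q'_def scalar_prod_def lessThan_atLeast0)
  moreover have "?M = mat (r + t) (r + t) (\<lambda>(i, j). ?F i j)"
    by (rule eq_matI) (auto simp: E'_def P'_def Q''_def)
  ultimately show ?thesis by (simp add: fdet_def)
qed

lemma permutes_card_block:
  assumes "p permutes {..<r + t}"
  shows "t \<le> r + card {i \<in> {r..<r + t}. r \<le> p i}"
proof -
  let ?A = "{i \<in> {r..<r + t}. r \<le> p i}" and ?B = "{i \<in> {r..<r + t}. p i < r}"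
  have "card ?B \<le> card {..<r}"
    by (rule card_inj_on_le[of p]) (use permutes_inj_on[OF assms] in \<open>auto intro: inj_on_subset\<close>)
  moreover have "card {r..<r + t} \<le> card ?A + card ?B"
    by (rule order_trans[OF card_mono card_Un_le]) auto
  ultimately show ?thesis by simp
qed

lemma fdet_low_rank_mem:
  fixes E P Q :: "nat \<Rightarrow> nat \<Rightarrow> 'z::idom"
  assumes I: "class_ideal \<pp>" and "r < t"
    and "\<And>a b. a < t \<Longrightarrow> b < t \<Longrightarrow> E a b \<in> \<pp>"
  shows "fdet t (\<lambda>a b. E a b + (\<Sum>p<r. P a p * Q p b)) \<in> \<pp>"
proof (subst fdet_add_mult, subst fdet_leibniz, rule class_ideal_sum[OF I], rule class_ideal_mult_left[OF I])
  fix p assume "p \<in> {p. p permutes {..<r + t}}"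
  then have p: "p permutes {..<r + t}" by simp
  from permutes_card_block[OF p] \<open>r < t\<close> have "card {i \<in> {r..<r + t}. r \<le> p i} \<noteq> 0" by linarith
  then have "{i \<in> {r..<r + t}. r \<le> p i} \<noteq> {}" by (metis card.empty)
  then obtain i where i: "i \<in> {r..<r + t}" "r \<le> p i" by auto
  then have pi: "p i < r + t" using permutes_in_image[OF p, of i] by auto
  let ?F = "\<lambda>i j. if i < r then (if j < r then (if i = j then 1 else 0) else - Q i (j - r))
        else if j < r then P (i - r) j else E (i - r) (j - r)"
  have "(\<Prod>i<r + t. ?F i (p i)) = ?F i (p i) * (\<Prod>i\<in>{..<r + t} - {i}. ?F i (p i))"
    by (rule prod.remove) (use i in auto)
  also have "\<dots> \<in> \<pp>"
    by (rule class_ideal_mult_right[OF I]) (use i pi assms(3) in auto)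
  finally show "(\<Prod>i<r + t. ?F i (p i)) \<in> \<pp>" .
qed

lemma fdet_low_rank_mem_square:
  fixes E P Q :: "nat \<Rightarrow> nat \<Rightarrow> 'z::idom"
  assumes I: "class_ideal \<pp>" and "Suc r < t"
    and E: "\<And>a b c d. a < t \<Longrightarrow> b < t \<Longrightarrow> c < t \<Longrightarrow> d < t \<Longrightarrow> E a b * E c d \<in> \<pp>"
  shows "fdet t (\<lambda>a b. E a b + (\<Sum>p<r. P a p * Q p b)) \<in> \<pp>"
proof (subst fdet_add_mult, subst fdet_leibniz, rule class_ideal_sum[OF I], rule class_ideal_mult_left[OF I])
  fix p assume "p \<in> {p. p permutes {..<r + t}}"
  then have p: "p permutes {..<r + t}" by simp
  let ?A = "{i \<in> {r..<r + t}. r \<le> p i}"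
  from permutes_card_block[OF p] \<open>Suc r < t\<close> have "\<not> card ?A \<le> Suc 0" by linarith
  moreover have "finite ?A" by simp
  ultimately obtain i k where ik: "i \<in> ?A" "k \<in> ?A" "i \<noteq> k"
    using card_le_Suc0_iff_eq[of ?A] by blast
  then have pi: "p i < r + t" "p k < r + t" using permutes_in_image[OF p] by auto
  let ?F = "\<lambda>i j. if i < r then (if j < r then (if i = j then 1 else 0) else - Q i (j - r))
        else if j < r then P (i - r) j else E (i - r) (j - r)"
  have "(\<Prod>i<r + t. ?F i (p i)) = ?F i (p i) * (\<Prod>i\<in>{..<r + t} - {i}. ?F i (p i))"
    by (rule prod.remove) (use ik in auto)
  also have "(\<Prod>i\<in>{..<r + t} - {i}. ?F i (p i)) = ?F k (p k) * (\<Prod>i\<in>{..<r + t} - {i} - {k}. ?F i (p i))"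
    by (rule prod.remove) (use ik in auto)
  also have "?F i (p i) * (?F k (p k) * (\<Prod>i\<in>{..<r + t} - {i} - {k}. ?F i (p i)))
     = (?F i (p i) * ?F k (p k)) * (\<Prod>i\<in>{..<r + t} - {i} - {k}. ?F i (p i))"
    by (rule mult.assoc[symmetric])
  also have "\<dots> \<in> \<pp>"
    by (rule class_ideal_mult_right[OF I]) (use ik pi E in auto)
  finally show "(\<Prod>i<r + t. ?F i (p i)) \<in> \<pp>" .
qed

lemma scaled_sub_det:
  fixes Y :: "nat \<Rightarrow> nat \<Rightarrow> 'z::idom"
  obtains P Q :: "nat \<Rightarrow> nat \<Rightarrow> 'z" where
    "(sub_det Y r f g)\<^sup>2 ^ t * sub_det Y t f' g'
     = fdet t (\<lambda>a b. sub_det Y r f g * sub_det Y (Suc r) (f(r := f' a)) (g(r := g' b)) + (\<Sum>p<r. P a p * Q p b))"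
proof -
  define d where "d = sub_det Y r f g"
  define P where "P = (\<lambda>a p. Y (f' a) (g p))"
  define Q where "Q = (\<lambda>p b. d * (\<Sum>q<r. adj_mat (mat r r (\<lambda>(a, b). Y (f a) (g b))) $$ (p, q) * Y (f q) (g' b)))"
  have "d\<^sup>2 * Y (f' a) (g' b) = d * sub_det Y (Suc r) (f(r := f' a)) (g(r := g' b)) + (\<Sum>p<r. P a p * Q p b)" for a b
  proof -
    define S where "S = (\<Sum>p<r. Y (f' a) (g p) * (\<Sum>q<r. adj_mat (mat r r (\<lambda>(a, b). Y (f a) (g b))) $$ (p, q) * Y (f q) (g' b)))"
    have "(\<Sum>p<r. P a p * Q p b) = d * S"
      unfolding S_def P_def Q_def by (simp only: sum_distrib_left mult.left_commute[of _ d])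
    moreover have "d * sub_det Y (Suc r) (f(r := f' a)) (g(r := g' b)) = d * (d * Y (f' a) (g' b) - S)"
      unfolding d_def bordered_schur by (simp only: schur_def S_def)
    ultimately show ?thesis by (simp only: algebra_simps power2_eq_square)
  qed
  then have "(d\<^sup>2) ^ t * sub_det Y t f' g' = fdet t (\<lambda>a b. d * sub_det Y (Suc r) (f(r := f' a)) (g(r := g' b)) + (\<Sum>p<r. P a p * Q p b))"
    unfolding sub_det_def[of Y t] fdet_smult[symmetric] by (intro fdet_cong)
  then show ?thesis using that[of P Q] unfolding d_def by blast
qed

lemma sub_det_mem_of_bordered:
  fixes Y :: "nat \<Rightarrow> nat \<Rightarrow> 'z::idom"
  assumes "class_ideal \<pp>" "r < t"
    and "\<And>a b. a < t \<Longrightarrow> b < t \<Longrightarrow> sub_det Y (Suc r) (f(r := f' a)) (g(r := g' b)) \<in> \<pp>"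
  shows "(sub_det Y r f g)\<^sup>2 ^ t * sub_det Y t f' g' \<in> \<pp>"
proof -
  obtain P Q where PQ: "(sub_det Y r f g)\<^sup>2 ^ t * sub_det Y t f' g'
     = fdet t (\<lambda>a b. sub_det Y r f g * sub_det Y (Suc r) (f(r := f' a)) (g(r := g' b)) + (\<Sum>p<r. P a p * Q p b))"
    by (rule scaled_sub_det)
  show ?thesis unfolding PQ
    by (rule fdet_low_rank_mem[OF assms(1,2)], rule class_ideal_mult_left[OF assms(1) assms(3)])
qed

lemma sub_det_mem_of_bordered_square:
  fixes Y :: "nat \<Rightarrow> nat \<Rightarrow> 'z::idom"
  assumes I: "class_ideal \<pp>" and "Suc r < t"
    and *: "\<And>a b c d. a < t \<Longrightarrow> b < t \<Longrightarrow> c < t \<Longrightarrow> d < t \<Longrightarrow>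
      sub_det Y (Suc r) (f(r := f' a)) (g(r := g' b)) * sub_det Y (Suc r) (f(r := f' c)) (g(r := g' d)) \<in> \<pp>"
  shows "(sub_det Y r f g)\<^sup>2 ^ t * sub_det Y t f' g' \<in> \<pp>"
proof -
  obtain P Q where PQ: "(sub_det Y r f g)\<^sup>2 ^ t * sub_det Y t f' g'
     = fdet t (\<lambda>a b. sub_det Y r f g * sub_det Y (Suc r) (f(r := f' a)) (g(r := g' b)) + (\<Sum>p<r. P a p * Q p b))"
    by (rule scaled_sub_det)
  show ?thesis unfolding PQ
  proof (rule fdet_low_rank_mem_square[OF I \<open>Suc r < t\<close>])
    fix a b c d assume "a < t" "b < t" "c < t" "d < t"
    from class_ideal_mult_left[OF I *[OF this], of "(sub_det Y r f g)\<^sup>2"]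
    show "sub_det Y r f g * sub_det Y (Suc r) (f(r := f' a)) (g(r := g' b)) *
       (sub_det Y r f g * sub_det Y (Suc r) (f(r := f' c)) (g(r := g' d))) \<in> \<pp>"
      by (simp add: power2_eq_square mult_ac)
  qed
qed

lemma bordered_mem_of_principal:
  fixes Y :: "nat \<Rightarrow> nat \<Rightarrow> 'z::idom"
  assumes I: "class_ideal \<pp>" and prime: "\<And>a b. a * b \<in> \<pp> \<Longrightarrow> a \<in> \<pp> \<or> b \<in> \<pp>"
    and sym: "\<And>i j. Y i j = Y j i" and \<Delta>: "sub_det Y r f f \<notin> \<pp>"
    and i: "sub_det Y (Suc r) (f(r := i)) (f(r := i)) \<in> \<pp>"
    and ij: "sub_det Y (Suc (Suc r)) (f(r := i, Suc r := j)) (f(r := i, Suc r := j)) \<in> \<pp>"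
  shows "sub_det Y (Suc r) (f(r := i)) (f(r := j)) \<in> \<pp>"
proof -
  define d where "d = sub_det Y r f f"
  let ?s = "schur Y r f f" and ?g = "f(r := i, Suc r := j)"
  have s: "d * ?s i j = d * sub_det Y (Suc r) (f(r := i)) (f(r := j))" for i j
    unfolding d_def by (rule bordered_schur[symmetric])
  have cancel: "a \<in> \<pp>" if "d * a \<in> \<pp>" for a using prime[OF that] \<Delta> by (auto simp: d_def)
  have "sub_det Y (Suc r) (f(r := i)) (f(r := j)) = sub_det Y (Suc r) (f(r := j)) (f(r := i))"
    by (rule sub_det_commute) (rule sym)
  then have "d * ?s i j = d * ?s j i" unfolding s by (rule arg_cong)
  then have ss: "?s i j * d = ?s j i * d" unfolding mult.commute[of _ d] .
  have "d * ?s i i \<in> \<pp>" unfolding s by (rule class_ideal_mult_left[OF I i])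
  then have ii: "?s i i \<in> \<pp>" by (rule cancel)
  have 1: "sub_det Y r ?g ?g = d" unfolding d_def by (rule sub_det_cong) auto
  have 2: "schur Y r ?g ?g = ?s" by (rule schur_cong) auto
  have 3: "?g (r + 0) = i" "?g (r + 1) = j" by simp_all
  have 4: "r + 2 = Suc (Suc r)" by simp
  have "d\<^sup>2 * sub_det Y (Suc (Suc r)) ?g ?g = d * (?s i i * ?s j j - ?s i j * ?s j i)"
    using sub_det_schur[of Y r ?g ?g 2] unfolding 1 2 fdet_2 3 4 .
  moreover have "d\<^sup>2 * sub_det Y (Suc (Suc r)) ?g ?g \<in> \<pp>" by (rule class_ideal_mult_left[OF I ij])
  ultimately have "d * (?s i i * ?s j j - ?s i j * ?s j i) \<in> \<pp>" by (simp only:)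
  then have "?s i i * ?s j j - ?s i j * ?s j i \<in> \<pp>" by (rule cancel)
  from class_ideal_diff[OF I class_ideal_mult_right[OF I ii, of "?s j j"] this]
  have "?s i j * ?s j i \<in> \<pp>" by simp
  from class_ideal_mult_right[OF I this, of d] have "?s i j * (?s j i * d) \<in> \<pp>" by (simp only: mult.assoc)
  then have "d * (?s i j * ?s i j) \<in> \<pp>" unfolding ss[symmetric] by (simp only: mult_ac)
  from prime[OF cancel[OF this]] have "?s i j \<in> \<pp>" by simp
  then have "d * sub_det Y (Suc r) (f(r := i)) (f(r := j)) \<in> \<pp>"
    unfolding s[of i j, symmetric] by (rule class_ideal_mult_left[OF I])
  then show ?thesis by (rule cancel)
qed


lemma sub_det_adj_mult:
  fixes Y :: "nat \<Rightarrow> nat \<Rightarrow> 'z::comm_ring_1"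
  assumes I: "class_ideal \<pp>" and c: "c < r"
    and y: "\<And>b. b < r \<Longrightarrow> (\<Sum>a<r. y a * Y (f a) (g b)) \<in> \<pp>"
  shows "sub_det Y r f g * y c \<in> \<pp>"
proof -
  define A where "A = mat r r (\<lambda>(a, b). Y (f a) (g b))"
  have A: "A \<in> carrier_mat r r" by (simp add: A_def)
  note J = adj_mat[OF A]
  have "(\<Sum>b<r. (\<Sum>a<r. y a * Y (f a) (g b)) * adj_mat A $$ (b, c)) \<in> \<pp>"
    by (rule class_ideal_sum[OF I]) (use y class_ideal_mult_right[OF I] in auto)
  also have "(\<Sum>b<r. (\<Sum>a<r. y a * Y (f a) (g b)) * adj_mat A $$ (b, c))
    = (\<Sum>a<r. y a * (\<Sum>b<r. A $$ (a, b) * adj_mat A $$ (b, c)))"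
    by (simp add: sum_distrib_left sum_distrib_right A_def mult.assoc) (rule sum.swap)
  also have "\<dots> = (\<Sum>a<r. if a = c then y a * det A else 0)"
  proof (rule sum.cong)
    fix a assume "a \<in> {..<r}"
    then have "(\<Sum>b<r. A $$ (a, b) * adj_mat A $$ (b, c)) = (det A \<cdot>\<^sub>m 1\<^sub>m r) $$ (a, c)"
      using mult_mat_entry[OF A J(1), of a c] c J(2) by simp
    then show "y a * (\<Sum>b<r. A $$ (a, b) * adj_mat A $$ (b, c)) = (if a = c then y a * det A else 0)"
      using c \<open>a \<in> {..<r}\<close> by simp
  qed simp
  also have "\<dots> = y c * det A" using c by simp
  finally show ?thesis by (simp add: A_def sub_det_def fdet_def mult.commute)
qed

lemma cofactor_eq_sub_det:
  assumes "0 < n"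
  shows "cofactor (mat n n (\<lambda>(i, j). Y i j)) i j
    = (- 1) ^ (i + j) * sub_det Y (n - 1) (insert_index i) (insert_index j)"
proof -
  have "mat_delete (mat n n (\<lambda>(i, j). Y i j)) i j
    = mat (n - 1) (n - 1) (\<lambda>(a, b). Y (insert_index i a) (insert_index j b))"
    by (rule eq_matI) (auto simp: mat_delete_def insert_index_def)
  then show ?thesis by (simp add: cofactor_def sub_det_def fdet_def)
qed

lemma maximal_minors_mem:
  fixes Y :: "nat \<Rightarrow> nat \<Rightarrow> 'z::comm_ring_1"
  defines "M \<equiv> \<lambda>n i j. sub_det Y (n - 1) (insert_index i) (insert_index j)"
  assumes I: "class_ideal \<pp>" and sym: "\<And>i j. Y i j = Y j i"
    and f: "inj_on f {..<r}" "f ` {..<r} \<subseteq> {..<n}" "r < n"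
    and M: "\<And>i j. i \<in> {..<n} - f ` {..<r} \<Longrightarrow> j \<in> {..<n} - f ` {..<r} \<Longrightarrow> M n i j \<in> \<pp>"
    and ij: "i < n" "j < n"
  shows "(sub_det Y r f f)\<^sup>2 * M n i j \<in> \<pp>"
proof -
  define \<Delta> where "\<Delta> = sub_det Y r f f"
  let ?I = "f ` {..<r}"
  define A where "A = mat n n (\<lambda>(i, j). Y i j)"
  define C where "C = (\<lambda>i j. (- 1) ^ (i + j) * M n i j)"
  have A: "A \<in> carrier_mat n n" by (simp add: A_def)
  have C: "cofactor A i j = C i j" for i j
    unfolding A_def C_def M_def by (rule cofactor_eq_sub_det) (use f in simp)
  have "M n i j = M n j i" for i j unfolding M_def by (rule sub_det_commute) (rule sym)
  then have C_sym: "C i j = C j i" for i j by (simp add: C_def add.commute)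
  have fb: "f b < n" if "b < r" for b using f(2) that by auto
  have CM: "M n i j = (- 1) ^ (i + j) * C i j" for i j
    by (simp add: C_def mult.assoc[symmetric] power_mult_distrib[symmetric])
  have C_mem: "C i j \<in> \<pp>" if "i \<in> {..<n} - ?I" "j \<in> {..<n} - ?I" for i j
    unfolding C_def by (rule class_ideal_mult_left[OF I M[OF that]])
  have CY: "(\<Sum>k<n. C i k * Y k j) = (if i = j then det A else 0)" if "i < n" "j < n" for i j
  proof -
    have "(\<Sum>k<n. C i k * Y k j) = (\<Sum>k<n. adj_mat A $$ (i, k) * A $$ (k, j))"
    proof (rule sum.cong)
      fix k assume "k \<in> {..<n}"
      then have "adj_mat A $$ (i, k) = C k i" "A $$ (k, j) = Y k j"
        using that A by (auto simp: adj_mat_def C) (simp add: A_def)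
      then show "C i k * Y k j = adj_mat A $$ (i, k) * A $$ (k, j)" using C_sym[of i k] by simp
    qed simp
    also have "\<dots> = (adj_mat A * A) $$ (i, j)"
      by (rule mult_mat_entry[symmetric, OF _ A that]) (use adj_mat[OF A] in auto)
    also have "\<dots> = (if i = j then det A else 0)" using adj_mat(3)[OF A] that by auto
    finally show ?thesis .
  qed
  have split: "(\<Sum>a<r. C i (f a) * Y (f a) j) = (\<Sum>k<n. C i k * Y k j) - (\<Sum>k\<in>{..<n} - ?I. C i k * Y k j)" for i j
  proof -
    have "(\<Sum>k<n. C i k * Y k j) = (\<Sum>k\<in>{..<n} - ?I. C i k * Y k j) + (\<Sum>k\<in>?I. C i k * Y k j)"
      by (rule sum.subset_diff) (use f in auto)
    also have "(\<Sum>k\<in>?I. C i k * Y k j) = (\<Sum>a<r. C i (f a) * Y (f a) j)"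
      by (simp add: sum.reindex[OF f(1)])
    finally show ?thesis by simp
  qed
  have 1: "\<Delta> * C i (f a) \<in> \<pp>" if i: "i \<in> {..<n} - ?I" and a: "a < r" for i a
    unfolding \<Delta>_def
  proof (rule sub_det_adj_mult[OF I a])
    fix b assume b: "b < r"
    have "(\<Sum>k\<in>{..<n} - ?I. C i k * Y k (f b)) \<in> \<pp>"
      by (rule class_ideal_sum[OF I]) (use C_mem[OF i] class_ideal_mult_right[OF I] in auto)
    moreover have "(\<Sum>k<n. C i k * Y k (f b)) = 0" using CY[of i "f b"] i b fb[OF b] by auto
    ultimately show "(\<Sum>a<r. C i (f a) * Y (f a) (f b)) \<in> \<pp>"
      unfolding split using class_ideal_uminus[OF I] by simp
  qed
  have mem1: "\<Delta> * C i k \<in> \<pp>" if "i \<in> {..<n} - ?I" "k < n" for i k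
    using 1[OF that(1)] class_ideal_mult_left[OF I C_mem[OF that(1)]] that by (cases "k \<in> ?I") auto
  have "card ?I \<noteq> card {..<n}" using f card_image[OF f(1)] by simp
  then have "?I \<noteq> {..<n}" by auto
  then obtain i\<^sub>0 where i0: "i\<^sub>0 \<in> {..<n} - ?I" using f(2) by blast
  have "(\<Sum>k<n. (\<Delta> * C i\<^sub>0 k) * Y k i\<^sub>0) \<in> \<pp>"
    by (rule class_ideal_sum[OF I]) (use mem1[OF i0] class_ideal_mult_right[OF I] in auto)
  also have "(\<Sum>k<n. (\<Delta> * C i\<^sub>0 k) * Y k i\<^sub>0) = \<Delta> * det A"
    using CY[of i\<^sub>0 i\<^sub>0] i0 by (simp add: sum_distrib_left[symmetric] mult.assoc)
  finally have det: "\<Delta> * det A \<in> \<pp>" .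
  have "\<Delta> * (\<Delta> * C i (f a)) \<in> \<pp>" if i: "i \<in> ?I" and a: "a < r" for i a
    unfolding \<Delta>_def
  proof (rule sub_det_adj_mult[OF I a, where y = "\<lambda>a. sub_det Y r f f * C i (f a)"])
    fix b assume b: "b < r"
    have "(\<Sum>k\<in>{..<n} - ?I. (\<Delta> * C i k) * Y k (f b)) \<in> \<pp>"
    proof (rule class_ideal_sum[OF I])
      fix k assume k: "k \<in> {..<n} - ?I"
      have "\<Delta> * C i k \<in> \<pp>" unfolding C_sym[of i k] by (rule mem1[OF k]) (use i f in auto)
      then show "(\<Delta> * C i k) * Y k (f b) \<in> \<pp>" by (rule class_ideal_mult_right[OF I])
    qed
    moreover have "\<Delta> * (\<Sum>k<n. C i k * Y k (f b)) \<in> \<pp>"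
      using CY[of i "f b"] i fb[OF b] f(2) det I by (auto simp: class_ideal_def)
    ultimately have "\<Delta> * (\<Sum>k<n. C i k * Y k (f b)) - (\<Sum>k\<in>{..<n} - ?I. (\<Delta> * C i k) * Y k (f b)) \<in> \<pp>"
      using class_ideal_diff[OF I] by blast
    also have "\<Delta> * (\<Sum>k<n. C i k * Y k (f b)) - (\<Sum>k\<in>{..<n} - ?I. (\<Delta> * C i k) * Y k (f b))
      = \<Delta> * (\<Sum>a<r. C i (f a) * Y (f a) (f b))"
      unfolding split by (simp add: sum_distrib_left right_diff_distrib mult.assoc)
    finally show "(\<Sum>a<r. sub_det Y r f f * C i (f a) * Y (f a) (f b)) \<in> \<pp>"
      by (simp add: \<Delta>_def sum_distrib_left mult.assoc)
  qed
  moreover have "\<Delta> * (\<Delta> * C i j) \<in> \<pp>" if "i \<notin> ?I \<or> j \<notin> ?I"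
  proof (rule class_ideal_mult_left[OF I])
    show "\<Delta> * C i j \<in> \<pp>"
      using mem1[of i j] mem1[of j i] C_sym[of i j] that ij by (cases "i \<in> ?I") auto
  qed
  ultimately have "\<Delta> * (\<Delta> * C i j) \<in> \<pp>" by blast
  from class_ideal_mult_left[OF I this, of "(- 1) ^ (i + j)"] show ?thesis
    unfolding CM[of i j] \<Delta>_def[symmetric] by (simp add: power2_eq_square mult_ac)
qed

lemma sub_det_sort_rows:
  fixes Y :: "nat \<Rightarrow> nat \<Rightarrow> 'z::comm_ring_1"
  assumes f: "inj_on f {..<t}" "f ` {..<t} \<subseteq> {..<n}"
  obtains s \<epsilon> where "s \<in> selections t n" "\<And>g. sub_det Y t f g = \<epsilon> * sub_det Y t s g"
proof -
  let ?L = "sorted_list_of_set (f ` {..<t})"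
  define s where "s = (\<lambda>k. ?L ! k)"
  have len: "length ?L = t" using card_image[OF f(1)] by simp
  have s: "strict_mono_on {..<t} s"
    unfolding s_def strict_mono_on_def using len
    by (auto intro!: sorted_wrt_nth_less[of "(<)"] strict_sorted_list_of_set)
  have img: "s ` {..<t} = f ` {..<t}"
  proof -
    have "s ` {..<t} = set ?L" unfolding s_def using len by (auto simp: set_conv_nth)
    then show ?thesis by simp
  qed
  have bij: "bij_betw s {..<t} (f ` {..<t})"
    using s img strict_mono_on_imp_inj_on by (auto simp: bij_betw_def)
  define \<pi> where "\<pi> = (\<lambda>k. if k < t then inv_into {..<t} s (f k) else k)"
  have bij\<pi>: "bij_betw \<pi> {..<t} {..<t}"
  proof -
    have "bij_betw (inv_into {..<t} s \<circ> f) {..<t} {..<t}"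
      by (rule bij_betw_trans[OF inj_on_imp_bij_betw[OF f(1)] bij_betw_inv_into[OF bij]])
    then show ?thesis by (rule bij_betw_cong[THEN iffD1, rotated]) (auto simp: \<pi>_def)
  qed
  then have \<pi>: "\<pi> permutes {..<t}" by (rule bij_imp_permutes) (auto simp: \<pi>_def)
  have s\<pi>: "s (\<pi> k) = f k" if "k < t" for k
    using that img by (auto simp: \<pi>_def intro!: f_inv_into_f)
  have "sub_det Y t f g = signof \<pi> * sub_det Y t s g" for g
  proof -
    have "mat t t (\<lambda>(i, j). mat t t (\<lambda>(a, b). Y (s a) (g b)) $$ (\<pi> i, j)) = mat t t (\<lambda>(a, b). Y (f a) (g b))"
      by (rule eq_matI) (use s\<pi> bij_betwE[OF bij\<pi>] in auto)
    then show ?thesis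
      using det_permute_rows[of "mat t t (\<lambda>(a, b). Y (s a) (g b))" t \<pi>] \<pi>
      by (simp add: sub_det_def fdet_def lessThan_atLeast0)
  qed
  moreover have "s \<in> selections t n" using s img f by (auto simp: selections_def)
  ultimately show ?thesis using that by blast
qed

lemma sub_det_mem_of_selections:
  fixes Y :: "nat \<Rightarrow> nat \<Rightarrow> 'z::comm_ring_1"
  assumes I: "class_ideal \<pp>"
    and Y: "\<And>s s'. s \<in> selections t n \<Longrightarrow> s' \<in> selections t n \<Longrightarrow> sub_det Y t s s' \<in> \<pp>"
    and f: "f ` {..<t} \<subseteq> {..<n}" and g: "g ` {..<t} \<subseteq> {..<n}"
  shows "sub_det Y t f g \<in> \<pp>"
proof (cases "inj_on f {..<t} \<and> inj_on g {..<t}")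
  case False
  then show ?thesis using sub_det_noninj_zero[of f t g Y] I by (auto simp: class_ideal_def)
next
  case True
  obtain s \<epsilon> where s: "s \<in> selections t n" "\<And>g. sub_det Y t f g = \<epsilon> * sub_det Y t s g"
    using sub_det_sort_rows[of f t n Y] True f by blast
  obtain s' \<epsilon>' where s': "s' \<in> selections t n"
      "\<And>h. sub_det (\<lambda>i j. Y j i) t g h = \<epsilon>' * sub_det (\<lambda>i j. Y j i) t s' h"
    using sub_det_sort_rows[of g t n "\<lambda>i j. Y j i"] True g by blast
  have tr: "sub_det (\<lambda>i j. Y j i) t h k = sub_det Y t k h" for h k
    unfolding sub_det_def by (rule fdet_transpose)
  have "sub_det Y t f g = \<epsilon> * (\<epsilon>' * sub_det Y t s s')" using s s' unfolding tr by simp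
  then show ?thesis using Y[OF s(1) s'(1)] class_ideal_mult_left[OF I] by simp
qed

abbreviation (in ring) Poly :: "'c set \<Rightarrow> ('c multiset \<Rightarrow> 'a) ring"
  where "Poly I \<equiv> indexed_poly_ring R I"

lemma finite_submultisets: "finite {a. a \<subseteq># m}"
proof (induct m)
  case (add x m)
  have "{a. a \<subseteq># add_mset x m} \<subseteq> {a. a \<subseteq># m} \<union> add_mset x ` {a. a \<subseteq># m}"
  proof
    fix a assume a: "a \<in> {a. a \<subseteq># add_mset x m}"
    show "a \<in> {a. a \<subseteq># m} \<union> add_mset x ` {a. a \<subseteq># m}"
    proof (cases "x \<in># a")
      case True
      then have "a = add_mset x (a - {#x#})" by simp
      moreover have "a - {#x#} \<subseteq># m" using a by (simp add: subset_eq_diff_conv)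
      ultimately show ?thesis by blast
    next
      case False
      have "count a y \<le> count m y" for y
        using mset_subset_eq_count[of a "add_mset x m" y] a False
        by (cases "y = x") (auto simp: not_in_iff)
      then show ?thesis by (simp add: subseteq_mset_def)
    qed
  qed
  then show ?case by (rule finite_subset) (use add in simp)
qed simp

context ring
begin

lemma poly_sel:
  "carrier (Poly I) = indexed_pset I (carrier R)"
  "\<zero>\<^bsub>Poly I\<^esub> = indexed_const \<zero>"
  "\<one>\<^bsub>Poly I\<^esub> = indexed_const \<one>"
  "x \<otimes>\<^bsub>Poly I\<^esub> y = indexed_mult R x y"
  "x \<oplus>\<^bsub>Poly I\<^esub> y = indexed_padd x y"
  by (simp_all add: indexed_poly_ring_def)

lemma pset_coeff: "P \<in> indexed_pset I (carrier R) \<Longrightarrow> P m \<in> carrier R"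
  using indexed_pset_in_carrier[of "carrier R" P I] by (simp add: carrier_coeff_def)

lemma pset_carrier_coeff: "P \<in> indexed_pset I (carrier R) \<Longrightarrow> carrier_coeff P"
  using indexed_pset_in_carrier[of "carrier R" P I] by simp

lemma pset_support: "P \<in> indexed_pset I (carrier R) \<Longrightarrow> P m \<noteq> \<zero> \<Longrightarrow> set_mset m \<subseteq> I"
proof (induct arbitrary: m rule: indexed_pset.induct)
  case (indexed_padd P Q)
  then have "P m \<noteq> \<zero> \<or> Q m \<noteq> \<zero>" by (auto simp: indexed_padd_def)
  then show ?case using indexed_padd by blast
next
  case (indexed_pmult P i)
  then have "i \<in># m" "P (m - {#i#}) \<noteq> \<zero>" by (auto simp: indexed_pmult_def split: if_splits)
  then have "m = add_mset i (m - {#i#})" by simp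
  moreover have "set_mset (m - {#i#}) \<subseteq> I" by (rule indexed_pmult(2)) fact
  ultimately show ?case using indexed_pmult(3) by (metis insert_subset set_mset_add_mset_insert)
qed (auto simp: indexed_const_def split: if_splits)

lemma pset_finite: "P \<in> indexed_pset I (carrier R) \<Longrightarrow> finite {m. P m \<noteq> \<zero>}"
proof (induct rule: indexed_pset.induct)
  case (indexed_const k)
  have "{m. indexed_const k m \<noteq> \<zero>} \<subseteq> {{#}}" by (auto simp: indexed_const_def)
  then show ?case by (rule finite_subset) simp
next
  case (indexed_padd P Q)
  have "{m. indexed_padd P Q m \<noteq> \<zero>} \<subseteq> {m. P m \<noteq> \<zero>} \<union> {m. Q m \<noteq> \<zero>}" by (auto simp: indexed_padd_def)
  then show ?case by (rule finite_subset) (use indexed_padd in simp)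
next
  case (indexed_pmult P i)
  have "{m. indexed_pmult P i m \<noteq> \<zero>} \<subseteq> add_mset i ` {m. P m \<noteq> \<zero>}"
  proof
    fix m assume "m \<in> {m. indexed_pmult P i m \<noteq> \<zero>}"
    then have "m = add_mset i (m - {#i#})" "m - {#i#} \<in> {m. P m \<noteq> \<zero>}"
      by (auto simp: indexed_pmult_def split: if_splits)
    then show "m \<in> add_mset i ` {m. P m \<noteq> \<zero>}" by blast
  qed
  then show ?case by (rule finite_subset) (use indexed_pmult in simp)
qed

lemma indexed_psetI:
  assumes "K \<subseteq> carrier R" "\<zero> \<in> K"
    and "\<And>m. P m \<in> K" "finite {m. P m \<noteq> \<zero>}" "\<And>m. P m \<noteq> \<zero> \<Longrightarrow> set_mset m \<subseteq> I"
  shows "P \<in> indexed_pset I K"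
proof -
  have mono: "(\<lambda>n. if n = m then c else \<zero>) \<in> indexed_pset I K"
    if "set_mset m \<subseteq> I" "c \<in> K" for m c
    using that
  proof (induct m)
    case empty
    have "(\<lambda>n. if n = {#} then c else \<zero>) = indexed_const c" by (auto simp: indexed_const_def)
    show ?case by (subst \<open>_ = indexed_const c\<close>) (rule indexed_pset.indexed_const, rule empty)
  next
    case (add x m)
    have "(\<lambda>n. if n = add_mset x m then c else \<zero>) = indexed_pmult (\<lambda>n. if n = m then c else \<zero>) x"
      unfolding indexed_pmult_def by (rule ext) (auto)
    then show ?case using add by (auto intro!: indexed_pset.indexed_pmult)
  qed
  have "finite F \<Longrightarrow> F = {m. P m \<noteq> \<zero>} \<Longrightarrow> (\<And>m. P m \<in> K) \<Longrightarrow> (\<And>m. P m \<noteq> \<zero> \<Longrightarrow> set_mset m \<subseteq> I)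
    \<Longrightarrow> P \<in> indexed_pset I K" for F
  proof (induct F arbitrary: P rule: finite_induct)
    case empty
    then have "P = indexed_const \<zero>" by (auto simp: indexed_zero_def)
    then show ?case using assms(2) by (auto intro: indexed_pset.indexed_const)
  next
    case (insert m F)
    define P' where "P' = P(m := \<zero>)"
    have "P' \<in> indexed_pset I K"
      by (rule insert(3)) (use insert(2,4-6) assms(2) in \<open>auto simp: P'_def split: if_splits\<close>)
    moreover have "P m \<noteq> \<zero>" using insert(4) by auto
    then have "(\<lambda>n. if n = m then P m else \<zero>) \<in> indexed_pset I K" by (intro mono) (use insert in auto)
    ultimately have "indexed_padd P' (\<lambda>n. if n = m then P m else \<zero>) \<in> indexed_pset I K"
      by (rule indexed_pset.indexed_padd)
    moreover have "indexed_padd P' (\<lambda>n. if n = m then P m else \<zero>) = P"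
      using subsetD[OF assms(1) insert(5)] by (auto simp: indexed_padd_def P'_def)
    ultimately show ?case by (simp only:)
  qed
  then show ?thesis using assms by blast
qed

lemma psetI:
  assumes "\<And>m. P m \<in> carrier R" "finite {m. P m \<noteq> \<zero>}" "\<And>m. P m \<noteq> \<zero> \<Longrightarrow> set_mset m \<subseteq> I"
  shows "P \<in> indexed_pset I (carrier R)"
  by (rule indexed_psetI) (use assms in auto)

lemma pset_mono: "J \<subseteq> I \<Longrightarrow> indexed_pset J (carrier R) \<subseteq> indexed_pset I (carrier R)"
proof
  fix P assume "J \<subseteq> I" and P: "P \<in> indexed_pset J (carrier R)"
  then show "P \<in> indexed_pset I (carrier R)"
    using pset_coeff[OF P] pset_finite[OF P] pset_support[OF P] by (intro psetI) auto
qed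

lemma pset_uminus: "P \<in> indexed_pset I (carrier R) \<Longrightarrow> (\<lambda>m. \<ominus> P m) \<in> indexed_pset I (carrier R)"
proof (rule psetI)
  assume P: "P \<in> indexed_pset I (carrier R)"
  have *: "{m. \<ominus> P m \<noteq> \<zero>} \<subseteq> {m. P m \<noteq> \<zero>}" by auto
  then show "finite {m. \<ominus> P m \<noteq> \<zero>}" using pset_finite[OF P] by (rule finite_subset)
  show "\<ominus> P m \<in> carrier R" for m using pset_coeff[OF P] by simp
  show "\<ominus> P m \<noteq> \<zero> \<Longrightarrow> set_mset m \<subseteq> I" for m using * pset_support[OF P] by blast
qed

lemma mult_coeff_closed:
  assumes "carrier_coeff P" "carrier_coeff Q"
  shows "carrier_coeff (indexed_mult R P Q)"
  using assms unfolding carrier_coeff_def indexed_mult_def by (auto intro!: finsum_closed)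

lemma mult_const:
  assumes "carrier_coeff P" "k \<in> carrier R"
  shows "indexed_mult R P (indexed_const k) = (\<lambda>m. P m \<otimes> k)"
proof (rule ext)
  fix m
  have "indexed_mult R P (indexed_const k) m = (\<Oplus>a\<in>{m}. P a \<otimes> k)"
    unfolding indexed_mult_def
  proof (rule add.finprod_mono_neutral_cong_right)
    show "P i \<otimes> indexed_const k (m - i) = \<zero>" if "i \<in> {a. a \<subseteq># m} - {m}" for i
    proof -
      have "m - i \<noteq> {#}" using that by (metis DiffE Diff_eq_empty_iff_mset mem_Collect_eq singletonI subset_mset.antisym)
      then show ?thesis using assms by (simp add: indexed_const_def carrier_coeff_def)
    qed
  qed (use assms in \<open>auto simp: finite_submultisets carrier_coeff_def indexed_const_def\<close>)
  then show "indexed_mult R P (indexed_const k) m = P m \<otimes> k" using assms by (simp add: carrier_coeff_def)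
qed

lemma mult_padd:
  assumes "carrier_coeff P" "carrier_coeff Q" "carrier_coeff Q'"
  shows "indexed_mult R P (indexed_padd Q Q') = indexed_padd (indexed_mult R P Q) (indexed_mult R P Q')"
  using assms unfolding carrier_coeff_def indexed_mult_def indexed_padd_def
  by (auto simp: r_distr intro!: finsum_addf)

lemma mult_pmult:
  assumes "carrier_coeff P" "carrier_coeff Q"
  shows "indexed_mult R P (indexed_pmult Q x) = indexed_pmult (indexed_mult R P Q) x"
proof (rule ext)
  fix m
  note c = assms[unfolded carrier_coeff_def]
  show "indexed_mult R P (indexed_pmult Q x) m = indexed_pmult (indexed_mult R P Q) x m"
  proof (cases "x \<in># m")
    case True
    have sub: "{a. a \<subseteq># m - {#x#}} = {a. a \<subseteq># m \<and> x \<in># m - a}"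
    proof (intro equalityI subsetI)
      fix a assume "a \<in> {a. a \<subseteq># m - {#x#}}"
      then have a: "count a y \<le> count m y - count {#x#} y" for y by (simp add: subseteq_mset_def)
      have "a \<subseteq># m" unfolding subseteq_mset_def using a by (meson diff_le_self le_trans)
      moreover have "count a x \<le> count m x - 1" "0 < count m x" using a[of x] True by simp_all
      then have "count a x < count m x" by linarith
      ultimately show "a \<in> {a. a \<subseteq># m \<and> x \<in># m - a}" by (simp add: in_diff_count)
    next
      fix a assume "a \<in> {a. a \<subseteq># m \<and> x \<in># m - a}"
      then have a: "count a y \<le> count m y" "count a x < count m x" for y
        by (auto simp: subseteq_mset_def in_diff_count)
      have "count a y \<le> count (m - {#x#}) y" for y using a by (cases "y = x") auto
      then show "a \<in> {a. a \<subseteq># m - {#x#}}" by (simp add: subseteq_mset_def)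
    qed
    have "indexed_mult R P (indexed_pmult Q x) m = (\<Oplus>a\<in>{a. a \<subseteq># m - {#x#}}. P a \<otimes> Q (m - {#x#} - a))"
      unfolding indexed_mult_def
      by (rule add.finprod_mono_neutral_cong_right)
        (use c in \<open>auto simp: finite_submultisets indexed_pmult_def sub diff_right_commute\<close>)
    then show ?thesis using True by (simp add: indexed_pmult_def indexed_mult_def)
  next
    case False
    have "indexed_mult R P (indexed_pmult Q x) m = \<zero>" unfolding indexed_mult_def
      by (rule add.finprod_one_eqI) (use c False in \<open>auto simp: indexed_pmult_def dest: in_diffD\<close>)
    then show ?thesis using False by (simp add: indexed_pmult_def)
  qed
qed

end

context cring
begin

lemma mult_commute_coeff:
  fixes P Q :: "'c multiset \<Rightarrow> 'a"
  assumes "carrier_coeff P" "carrier_coeff Q"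
  shows "indexed_mult R P Q = indexed_mult R Q P"
proof (rule ext)
  fix m :: "'c multiset"
  note c = assms[unfolded carrier_coeff_def]
  have dd: "m - (m - a) = a" if "a \<subseteq># m" for a :: "'c multiset"
    by (rule multiset_eqI) (use that in \<open>simp add: subseteq_mset_def\<close>)
  have bij: "(\<lambda>a. m - a) ` {a. a \<subseteq># m} = {a. a \<subseteq># m}"
  proof
    show "{a. a \<subseteq># m} \<subseteq> (\<lambda>a. m - a) ` {a. a \<subseteq># m}"
    proof
      fix a assume "a \<in> {a. a \<subseteq># m}"
      then have "a = m - (m - a)" "m - a \<in> {a. a \<subseteq># m}" using dd by auto
      then show "a \<in> (\<lambda>a. m - a) ` {a. a \<subseteq># m}" by blast
    qed
  qed auto
  have inj: "inj_on (\<lambda>a. m - a) {a. a \<subseteq># m}"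
    by (rule inj_on_inverseI[of _ "\<lambda>a. m - a"]) (use dd in auto)
  have "indexed_mult R P Q m = (\<Oplus>a\<in>(\<lambda>a. m - a) ` {a. a \<subseteq># m}. P a \<otimes> Q (m - a))"
    by (simp add: indexed_mult_def bij)
  also have "\<dots> = (\<Oplus>a\<in>{a. a \<subseteq># m}. P (m - a) \<otimes> Q (m - (m - a)))"
    by (rule finsum_reindex) (use inj c in auto)
  also have "\<dots> = indexed_mult R Q P m" unfolding indexed_mult_def
    by (rule finsum_cong') (use c dd m_comm in auto)
  finally show "indexed_mult R P Q m = indexed_mult R Q P m" .
qed

lemma mult_closed:
  assumes "P \<in> indexed_pset I (carrier R)" "Q \<in> indexed_pset I (carrier R)"
  shows "indexed_mult R P Q \<in> indexed_pset I (carrier R)"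
  using assms(2)
proof (induct rule: indexed_pset.induct)
  case (indexed_const k)
  have fin: "{m. P m \<otimes> k \<noteq> \<zero>} \<subseteq> {m. P m \<noteq> \<zero>}" using indexed_const by auto
  have "(\<lambda>m. P m \<otimes> k) \<in> indexed_pset I (carrier R)"
  proof (rule psetI)
    show "finite {m. P m \<otimes> k \<noteq> \<zero>}" using fin pset_finite[OF assms(1)] by (rule finite_subset)
  qed (use fin pset_support[OF assms(1)] pset_coeff[OF assms(1)] indexed_const in auto)
  then show ?case using mult_const[OF pset_carrier_coeff[OF assms(1)]] indexed_const by simp
next
  case (indexed_padd Q Q')
  then show ?case using assms(1)
    by (simp add: mult_padd pset_carrier_coeff[where I = I] indexed_pset.indexed_padd)
next
  case (indexed_pmult Q i)
  then show ?case using assms(1)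
    by (simp add: mult_pmult pset_carrier_coeff[where I = I] indexed_pset.indexed_pmult)
qed

lemma mult_assoc_coeff:
  assumes "P \<in> indexed_pset I (carrier R)" "Q \<in> indexed_pset I (carrier R)" "T \<in> indexed_pset I (carrier R)"
  shows "indexed_mult R (indexed_mult R P Q) T = indexed_mult R P (indexed_mult R Q T)"
  using assms(3)
proof (induct rule: indexed_pset.induct)
  case (indexed_const k)
  note c = pset_carrier_coeff[OF assms(1)] pset_carrier_coeff[OF assms(2)]
  have "indexed_mult R P Q m \<otimes> k = indexed_mult R P (\<lambda>m. Q m \<otimes> k) m" for m
  proof -
    have "indexed_mult R P Q m \<otimes> k = (\<Oplus>a\<in>{a. a \<subseteq># m}. P a \<otimes> Q (m - a) \<otimes> k)"
      unfolding indexed_mult_def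
      by (rule finsum_ldistr) (use c indexed_const in \<open>auto simp: carrier_coeff_def finite_submultisets\<close>)
    then show ?thesis unfolding indexed_mult_def
      using c indexed_const by (auto simp: carrier_coeff_def m_assoc intro!: finsum_cong')
  qed
  then show ?case using indexed_const c mult_coeff_closed[OF c] by (simp add: mult_const)
next
  case (indexed_padd T T')
  then show ?case using assms(1,2) mult_closed[OF assms(1,2)]
    by (simp add: mult_padd pset_carrier_coeff[where I = I] mult_closed)
next
  case (indexed_pmult T i)
  then show ?case using assms(1,2) mult_closed[OF assms(1,2)]
    by (simp add: mult_pmult pset_carrier_coeff[where I = I] mult_closed)
qed

lemma poly_cring: "cring (Poly I)"
proof (rule cringI)
  note poly_sel [simp]
  note c = pset_coeff[where I = I]
  show "abelian_group (Poly I)"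
  proof (rule abelian_groupI)
    fix x assume x: "x \<in> carrier (Poly I)"
    have "indexed_padd (\<lambda>m. \<ominus> x m) x = indexed_const \<zero>"
      using c x by (auto simp: indexed_padd_def indexed_zero_def l_neg)
    then show "\<exists>y\<in>carrier (Poly I). y \<oplus>\<^bsub>Poly I\<^esub> x = \<zero>\<^bsub>Poly I\<^esub>"
      using pset_uminus[of x I] x by auto
  next
    fix x y z assume "x \<in> carrier (Poly I)" "y \<in> carrier (Poly I)" "z \<in> carrier (Poly I)"
    then show "x \<oplus>\<^bsub>Poly I\<^esub> y \<oplus>\<^bsub>Poly I\<^esub> z = x \<oplus>\<^bsub>Poly I\<^esub> (y \<oplus>\<^bsub>Poly I\<^esub> z)"
      using c by (auto simp: indexed_padd_def a_assoc)
  next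
    fix x y assume "x \<in> carrier (Poly I)" "y \<in> carrier (Poly I)"
    then show "x \<oplus>\<^bsub>Poly I\<^esub> y = y \<oplus>\<^bsub>Poly I\<^esub> x"
      using c by (auto simp: indexed_padd_def a_comm)
  qed (use indexed_padd_zero pset_carrier_coeff[where I = I] in \<open>auto intro: indexed_pset.indexed_padd indexed_pset.indexed_const\<close>)
  show "comm_monoid (Poly I)"
  proof (rule comm_monoidI)
    fix x assume x: "x \<in> carrier (Poly I)"
    have "indexed_const \<one> \<in> indexed_pset I (carrier R)" by (rule indexed_pset.indexed_const) simp
    then have "indexed_mult R (indexed_const \<one>) x = indexed_mult R x (indexed_const \<one>)"
      using x by (intro mult_commute_coeff) (auto simp: pset_carrier_coeff[where I = I])
    also have "\<dots> = x" using x c by (auto simp: mult_const pset_carrier_coeff[where I = I])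
    finally show "\<one>\<^bsub>Poly I\<^esub> \<otimes>\<^bsub>Poly I\<^esub> x = x" by simp
  next
    fix x y assume "x \<in> carrier (Poly I)" "y \<in> carrier (Poly I)"
    then show "x \<otimes>\<^bsub>Poly I\<^esub> y = y \<otimes>\<^bsub>Poly I\<^esub> x"
      by (simp add: mult_commute_coeff[of x y] pset_carrier_coeff[where I = I])
  qed (auto simp: mult_closed mult_assoc_coeff intro: indexed_pset.indexed_const)
  fix x y z assume "x \<in> carrier (Poly I)" "y \<in> carrier (Poly I)" "z \<in> carrier (Poly I)"
  then show "(x \<oplus>\<^bsub>Poly I\<^esub> y) \<otimes>\<^bsub>Poly I\<^esub> z = x \<otimes>\<^bsub>Poly I\<^esub> z \<oplus>\<^bsub>Poly I\<^esub> y \<otimes>\<^bsub>Poly I\<^esub> z"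
    by (simp add: mult_commute_coeff[of _ z] mult_padd pset_carrier_coeff[where I = I] indexed_pset.indexed_padd)
qed

lemma var_closed: "x \<in> I \<Longrightarrow> indexed_var x \<in> indexed_pset I (carrier R)"
  unfolding indexed_var_def by (intro indexed_pset.intros) auto

lemma pmult_eq_mult_var: "carrier_coeff P \<Longrightarrow> indexed_pmult P x = indexed_mult R P (indexed_var x)"
proof -
  assume P: "carrier_coeff P"
  have 1: "carrier_coeff (indexed_const \<one>)" by (simp add: carrier_coeff_def indexed_const_def)
  have "(\<lambda>m. P m \<otimes> \<one>) = P" using P by (simp add: carrier_coeff_def)
  then show ?thesis unfolding indexed_var_def mult_pmult[OF P 1] using mult_const[OF P, of \<one>] by simp
qed

end

lemma (in ring_hom_cring) ideal_vimage:
  "ideal Q S \<Longrightarrow> ideal {a \<in> carrier R. h a \<in> Q} R"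
  by (rule ring_hom_ring.ideal_vimage[OF ring_hom_ringI2[OF R.ring_axioms S.ring_axioms homh]])

lemma (in ring_hom_cring) primeideal_vimage:
  assumes "primeideal Q S"
  shows "primeideal {a \<in> carrier R. h a \<in> Q} R"
proof -
  interpret Q: primeideal Q S by fact
  have "\<one>\<^bsub>S\<^esub> \<notin> Q" using Q.I_notcarr Q.one_imp_carrier by blast
  then have "\<one> \<notin> {a \<in> carrier R. h a \<in> Q}" by simp
  then have "carrier R \<noteq> {a \<in> carrier R. h a \<in> Q}" by blast
  then show ?thesis
    using Q.I_prime by (intro primeidealI[OF ideal_vimage[OF Q.is_ideal] R.is_cring]) auto
qed

lemma (in cring) genideal_finite_sum:
  assumes B: "finite B" "B \<subseteq> carrier R" and x: "x \<in> Idl B"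
  shows "\<exists>c \<in> B \<rightarrow> carrier R. x = (\<Oplus>b\<in>B. c b \<otimes> b)"
proof -
  let ?J = "{(\<Oplus>b\<in>B. c b \<otimes> b) | c. c \<in> B \<rightarrow> carrier R}"
  have cl: "(\<lambda>b. c b \<otimes> b) \<in> B \<rightarrow> carrier R" if "c \<in> B \<rightarrow> carrier R" for c using that B by auto
  have JI: "x \<in> ?J" if "x = (\<Oplus>b\<in>B. c b \<otimes> b)" "\<And>b. b \<in> B \<Longrightarrow> c b \<in> carrier R" for x c
    using that by blast
  have "ideal ?J R"
  proof (rule idealI[OF ring_axioms])
    show "subgroup ?J (add_monoid R)"
    proof (rule add.subgroupI)
      show "?J \<subseteq> carrier R" using cl by (auto intro: finsum_closed)
      have "(\<lambda>_. \<zero>) \<in> B \<rightarrow> carrier R" by simp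
      then show "?J \<noteq> {}" by blast
    next
      fix x assume "x \<in> ?J"
      then obtain c where c: "c \<in> B \<rightarrow> carrier R" "x = (\<Oplus>b\<in>B. c b \<otimes> b)" by blast
      have "\<ominus> x = (\<ominus> \<one>) \<otimes> x" using finsum_closed[OF cl[OF c(1)]] by (simp add: c(2) l_minus)
      also have "\<dots> = (\<Oplus>b\<in>B. (\<ominus> \<one>) \<otimes> (c b \<otimes> b))"
        unfolding c(2) by (rule finsum_rdistr) (use B cl[OF c(1)] in auto)
      also have "\<dots> = (\<Oplus>b\<in>B. (\<ominus> \<one> \<otimes> c b) \<otimes> b)"
        by (rule finsum_cong') (use B c in \<open>auto simp: m_assoc Pi_def subset_eq\<close>)
      finally show "\<ominus> x \<in> ?J" by (rule JI) (use c(1) in auto)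
    next
      fix x y assume "x \<in> ?J" "y \<in> ?J"
      then obtain c d where c: "c \<in> B \<rightarrow> carrier R" "x = (\<Oplus>b\<in>B. c b \<otimes> b)"
        and d: "d \<in> B \<rightarrow> carrier R" "y = (\<Oplus>b\<in>B. d b \<otimes> b)" by blast
      have "x \<oplus> y = (\<Oplus>b\<in>B. c b \<otimes> b \<oplus> d b \<otimes> b)"
        unfolding c(2) d(2) by (rule finsum_addf[symmetric]) (use cl c(1) d(1) in auto)
      also have "\<dots> = (\<Oplus>b\<in>B. (c b \<oplus> d b) \<otimes> b)"
        by (rule finsum_cong') (use B c(1) d(1) in \<open>auto simp: l_distr Pi_def subset_eq\<close>)
      finally show "x \<oplus> y \<in> ?J" by (rule JI) (use c(1) d(1) in auto)
    qed
    fix x y assume "x \<in> ?J" and y: "y \<in> carrier R"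
    then obtain c where c: "c \<in> B \<rightarrow> carrier R" "x = (\<Oplus>b\<in>B. c b \<otimes> b)" by blast
    have "y \<otimes> x = (\<Oplus>b\<in>B. y \<otimes> (c b \<otimes> b))"
      unfolding c(2) by (rule finsum_rdistr) (use B y cl[OF c(1)] in auto)
    also have "\<dots> = (\<Oplus>b\<in>B. (y \<otimes> c b) \<otimes> b)"
      by (rule finsum_cong') (use B y c in \<open>auto simp: m_assoc Pi_def subset_eq\<close>)
    finally show *: "y \<otimes> x \<in> ?J" by (rule JI) (use c(1) y in auto)
    then show "x \<otimes> y \<in> ?J" using finsum_closed[OF cl[OF c(1)]] y by (simp add: c(2) m_comm)
  qed
  moreover have "B \<subseteq> ?J"
  proof
    fix b assume b: "b \<in> B"
    have "(\<Oplus>b'\<in>B. (if b' = b then \<one> else \<zero>) \<otimes> b') = (\<Oplus>b'\<in>B. if b = b' then b' else \<zero>)"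
      by (rule finsum_cong') (use B in auto)
    also have "\<dots> = b" by (rule finsum_singleton) (use B b in auto)
    finally show "b \<in> ?J" by (intro JI[of b "\<lambda>b'. if b' = b then \<one> else \<zero>"]) auto
  qed
  ultimately have "x \<in> ?J" using genideal_minimal x by blast
  then show ?thesis by blast
qed

locale mult_submonoid = cring +
  fixes M
  assumes M_sub: "M \<subseteq> carrier R" and M_one: "\<one> \<in> M"
    and M_mult: "\<And>a b. a \<in> M \<Longrightarrow> b \<in> M \<Longrightarrow> a \<otimes> b \<in> M"
begin

lemma M_closed [intro, simp]: "s \<in> M \<Longrightarrow> s \<in> carrier R" using M_sub by auto

abbreviation frac :: "'a \<Rightarrow> 'a \<Rightarrow> ('a \<times> 'a) set" where "frac \<equiv> loc_frac R M"

abbreviation Loc :: "('a \<times> 'a) set ring" where "Loc \<equiv> localization R M"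

definition frac_rel :: "'a \<Rightarrow> 'a \<Rightarrow> 'a \<Rightarrow> 'a \<Rightarrow> bool"
  where "frac_rel a s b t \<longleftrightarrow> (\<exists>u\<in>M. u \<otimes> (a \<otimes> t) = u \<otimes> (b \<otimes> s))"

lemma mem_frac: "(b, t) \<in> frac a s \<longleftrightarrow> b \<in> carrier R \<and> t \<in> M \<and> frac_rel a s b t"
  by (simp add: loc_frac_def frac_rel_def)

lemma frac_rel_refl: "frac_rel a s a s"
  using M_one by (auto simp: frac_rel_def)

lemma frac_rel_sym: "frac_rel a s b t \<Longrightarrow> frac_rel b t a s"
  by (auto simp: frac_rel_def intro: sym)

lemma frac_rel_trans:
  assumes "a \<in> carrier R" "b \<in> carrier R" "c \<in> carrier R" "s \<in> M" "t \<in> M" "w \<in> M"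
    and "frac_rel a s b t" "frac_rel b t c w"
  shows "frac_rel a s c w"
proof -
  obtain u v where u: "u \<in> M" "u \<otimes> (a \<otimes> t) = u \<otimes> (b \<otimes> s)"
    and v: "v \<in> M" "v \<otimes> (b \<otimes> w) = v \<otimes> (c \<otimes> t)" using assms by (auto simp: frac_rel_def)
  have "(u \<otimes> v \<otimes> t) \<otimes> (a \<otimes> w) = (u \<otimes> (a \<otimes> t)) \<otimes> (v \<otimes> w)"
    using u(1) v(1) assms by (simp add: m_ac)
  also have "\<dots> = (u \<otimes> (b \<otimes> s)) \<otimes> (v \<otimes> w)" by (simp only: u)
  also have "\<dots> = (v \<otimes> (b \<otimes> w)) \<otimes> (u \<otimes> s)" using u(1) v(1) assms by (simp add: m_ac)
  also have "\<dots> = (v \<otimes> (c \<otimes> t)) \<otimes> (u \<otimes> s)" by (simp only: v)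
  also have "\<dots> = (u \<otimes> v \<otimes> t) \<otimes> (c \<otimes> s)" using u(1) v(1) assms by (simp add: m_ac)
  finally show ?thesis using u v assms M_mult unfolding frac_rel_def by blast
qed

lemma frac_eq_iff:
  assumes "a \<in> carrier R" "b \<in> carrier R" "s \<in> M" "t \<in> M"
  shows "frac a s = frac b t \<longleftrightarrow> frac_rel a s b t"
proof
  assume "frac a s = frac b t"
  moreover have "(b, t) \<in> frac b t" using assms by (simp add: mem_frac frac_rel_refl)
  ultimately have "(b, t) \<in> frac a s" by simp
  then show "frac_rel a s b t" by (simp add: mem_frac)
next
  assume *: "frac_rel a s b t"
  have "frac_rel a s c w \<longleftrightarrow> frac_rel b t c w" if "c \<in> carrier R" "w \<in> M" for c w
    using * frac_rel_trans frac_rel_sym assms that by meson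
  then show "frac a s = frac b t" by (auto simp: mem_frac)
qed

lemma frac_eqI:
  assumes "a \<in> carrier R" "b \<in> carrier R" "s \<in> M" "t \<in> M" "a \<otimes> t = b \<otimes> s"
  shows "frac a s = frac b t"
  using assms M_one by (auto simp: frac_eq_iff frac_rel_def)

lemma frac_rel_mult:
  assumes c: "a \<in> carrier R" "b \<in> carrier R" "a' \<in> carrier R" "b' \<in> carrier R" "s \<in> M" "t \<in> M" "s' \<in> M" "t' \<in> M"
    and r: "frac_rel a s a' s'" "frac_rel b t b' t'"
  shows "frac_rel (a \<otimes> b) (s \<otimes> t) (a' \<otimes> b') (s' \<otimes> t')"
proof -
  obtain u v where u: "u \<in> M" "u \<otimes> (a \<otimes> s') = u \<otimes> (a' \<otimes> s)"
    and v: "v \<in> M" "v \<otimes> (b \<otimes> t') = v \<otimes> (b' \<otimes> t)" using r by (auto simp: frac_rel_def)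
  have "(u \<otimes> v) \<otimes> ((a \<otimes> b) \<otimes> (s' \<otimes> t')) = (u \<otimes> (a \<otimes> s')) \<otimes> (v \<otimes> (b \<otimes> t'))"
    using u(1) v(1) c by (simp add: m_ac)
  also have "\<dots> = (u \<otimes> (a' \<otimes> s)) \<otimes> (v \<otimes> (b' \<otimes> t))" by (simp only: u v)
  also have "\<dots> = (u \<otimes> v) \<otimes> ((a' \<otimes> b') \<otimes> (s \<otimes> t))"
    using u(1) v(1) c by (simp add: m_ac)
  finally show ?thesis using u v M_mult unfolding frac_rel_def by blast
qed

lemma frac_rel_add:
  assumes c: "a \<in> carrier R" "b \<in> carrier R" "a' \<in> carrier R" "b' \<in> carrier R" "s \<in> M" "t \<in> M" "s' \<in> M" "t' \<in> M"
    and r: "frac_rel a s a' s'" "frac_rel b t b' t'"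
  shows "frac_rel (a \<otimes> t \<oplus> b \<otimes> s) (s \<otimes> t) (a' \<otimes> t' \<oplus> b' \<otimes> s') (s' \<otimes> t')"
proof -
  obtain u v where u: "u \<in> M" "u \<otimes> (a \<otimes> s') = u \<otimes> (a' \<otimes> s)"
    and v: "v \<in> M" "v \<otimes> (b \<otimes> t') = v \<otimes> (b' \<otimes> t)" using r by (auto simp: frac_rel_def)
  have "(u \<otimes> v) \<otimes> ((a \<otimes> t \<oplus> b \<otimes> s) \<otimes> (s' \<otimes> t'))
     = (u \<otimes> (a \<otimes> s')) \<otimes> (v \<otimes> (t \<otimes> t')) \<oplus> (v \<otimes> (b \<otimes> t')) \<otimes> (u \<otimes> (s \<otimes> s'))"
    using u(1) v(1) c by (simp add: m_ac r_distr l_distr)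
  also have "\<dots> = (u \<otimes> (a' \<otimes> s)) \<otimes> (v \<otimes> (t \<otimes> t')) \<oplus> (v \<otimes> (b' \<otimes> t)) \<otimes> (u \<otimes> (s \<otimes> s'))"
    by (simp only: u v)
  also have "\<dots> = (u \<otimes> v) \<otimes> ((a' \<otimes> t' \<oplus> b' \<otimes> s') \<otimes> (s \<otimes> t))"
    using u(1) v(1) c by (simp add: m_ac r_distr l_distr)
  finally show ?thesis using u v M_mult unfolding frac_rel_def by blast
qed

lemma Loc_carrier: "carrier Loc = {frac a s | a s. a \<in> carrier R \<and> s \<in> M}"
  and Loc_zero: "\<zero>\<^bsub>Loc\<^esub> = frac \<zero> \<one>"
  and Loc_one: "\<one>\<^bsub>Loc\<^esub> = frac \<one> \<one>"
  by (simp_all add: localization_def)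

lemma union_frac:
  assumes "a \<in> carrier R" "b \<in> carrier R" "s \<in> M" "t \<in> M"
    and "\<And>a' s' b' t'. (a', s') \<in> frac a s \<Longrightarrow> (b', t') \<in> frac b t \<Longrightarrow> F a' s' b' t' = F a s b t"
  shows "(\<Union>(a, s)\<in>frac a s. \<Union>(b, t)\<in>frac b t. F a s b t) = F a s b t"
proof -
  have ne: "(a, s) \<in> frac a s" "(b, t) \<in> frac b t" using assms(1-4) by (auto simp: mem_frac frac_rel_refl)
  have "(\<Union>(b', t')\<in>frac b t. F a' s' b' t') = F a s b t" if "(a', s') \<in> frac a s" for a' s'
    by (rule UN_constant_eq[OF ne(2)]) (use assms(5)[OF that] in \<open>simp add: case_prod_unfold\<close>)
  then show ?thesis by (intro UN_constant_eq[OF ne(1)]) (simp add: case_prod_unfold)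
qed

lemma Loc_mult:
  assumes "a \<in> carrier R" "b \<in> carrier R" "s \<in> M" "t \<in> M"
  shows "frac a s \<otimes>\<^bsub>Loc\<^esub> frac b t = frac (a \<otimes> b) (s \<otimes> t)"
proof -
  have "frac a s \<otimes>\<^bsub>Loc\<^esub> frac b t = (\<Union>(a, s)\<in>frac a s. \<Union>(b, t)\<in>frac b t. frac (a \<otimes> b) (s \<otimes> t))"
    by (simp add: localization_def)
  also have "\<dots> = frac (a \<otimes> b) (s \<otimes> t)"
    by (rule union_frac[OF assms])
      (use assms in \<open>simp add: mem_frac frac_eq_iff M_mult frac_rel_mult frac_rel_sym\<close>)
  finally show ?thesis .
qed

lemma Loc_add:
  assumes "a \<in> carrier R" "b \<in> carrier R" "s \<in> M" "t \<in> M"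
  shows "frac a s \<oplus>\<^bsub>Loc\<^esub> frac b t = frac (a \<otimes> t \<oplus> b \<otimes> s) (s \<otimes> t)"
proof -
  have "frac a s \<oplus>\<^bsub>Loc\<^esub> frac b t = (\<Union>(a, s)\<in>frac a s. \<Union>(b, t)\<in>frac b t. frac (a \<otimes> t \<oplus> b \<otimes> s) (s \<otimes> t))"
    by (simp add: localization_def)
  also have "\<dots> = frac (a \<otimes> t \<oplus> b \<otimes> s) (s \<otimes> t)"
    by (rule union_frac[OF assms])
      (use assms in \<open>simp add: mem_frac frac_eq_iff M_mult frac_rel_add frac_rel_sym\<close>)
  finally show ?thesis .
qed

lemma frac_in_Loc [intro]: "a \<in> carrier R \<Longrightarrow> s \<in> M \<Longrightarrow> frac a s \<in> carrier Loc"
  by (auto simp: Loc_carrier)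

lemma Loc_cases:
  assumes "x \<in> carrier Loc"
  obtains a s where "x = frac a s" "a \<in> carrier R" "s \<in> M"
  using assms by (auto simp: Loc_carrier)

lemma Loc_cring: "cring Loc"
proof (rule cringI)
  show "abelian_group Loc"
  proof (rule abelian_groupI)
    fix x y assume "x \<in> carrier Loc" "y \<in> carrier Loc"
    then obtain a s b t where *: "x = frac a s" "a \<in> carrier R" "s \<in> M" "y = frac b t" "b \<in> carrier R" "t \<in> M"
      by (elim Loc_cases, blast)
    then show "x \<oplus>\<^bsub>Loc\<^esub> y \<in> carrier Loc" by (auto simp: Loc_add M_mult)
    show "x \<oplus>\<^bsub>Loc\<^esub> y = y \<oplus>\<^bsub>Loc\<^esub> x" using * by (simp add: Loc_add m_comm a_comm)
    fix z assume "z \<in> carrier Loc"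
    then obtain c w where **: "z = frac c w" "c \<in> carrier R" "w \<in> M" by (elim Loc_cases, blast)
    show "x \<oplus>\<^bsub>Loc\<^esub> y \<oplus>\<^bsub>Loc\<^esub> z = x \<oplus>\<^bsub>Loc\<^esub> (y \<oplus>\<^bsub>Loc\<^esub> z)"
      using * ** by (simp add: Loc_add M_mult l_distr r_distr m_ac a_ac)
  next
    fix x assume "x \<in> carrier Loc"
    then obtain a s where *: "x = frac a s" "a \<in> carrier R" "s \<in> M" by (elim Loc_cases, blast)
    show "\<zero>\<^bsub>Loc\<^esub> \<oplus>\<^bsub>Loc\<^esub> x = x" using * M_one by (simp add: Loc_zero Loc_add)
    have "frac (\<ominus> a) s \<oplus>\<^bsub>Loc\<^esub> x = frac \<zero> \<one>"
      using * M_one by (simp add: Loc_add M_mult l_distr[symmetric] l_neg) (rule frac_eqI; simp add: M_mult)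
    then show "\<exists>y\<in>carrier Loc. y \<oplus>\<^bsub>Loc\<^esub> x = \<zero>\<^bsub>Loc\<^esub>" using * by (auto simp: Loc_zero)
  qed (use M_one in \<open>auto simp: Loc_zero\<close>)
  show "comm_monoid Loc"
  proof (rule comm_monoidI)
    fix x y assume "x \<in> carrier Loc" "y \<in> carrier Loc"
    then obtain a s b t where *: "x = frac a s" "a \<in> carrier R" "s \<in> M" "y = frac b t" "b \<in> carrier R" "t \<in> M"
      by (elim Loc_cases, blast)
    then show "x \<otimes>\<^bsub>Loc\<^esub> y \<in> carrier Loc" by (auto simp: Loc_mult M_mult)
    show "x \<otimes>\<^bsub>Loc\<^esub> y = y \<otimes>\<^bsub>Loc\<^esub> x" using * by (simp add: Loc_mult m_comm)
    fix z assume "z \<in> carrier Loc"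
    then obtain c w where **: "z = frac c w" "c \<in> carrier R" "w \<in> M" by (elim Loc_cases, blast)
    show "x \<otimes>\<^bsub>Loc\<^esub> y \<otimes>\<^bsub>Loc\<^esub> z = x \<otimes>\<^bsub>Loc\<^esub> (y \<otimes>\<^bsub>Loc\<^esub> z)"
      using * ** by (simp add: Loc_mult M_mult m_ac)
  next
    fix x assume "x \<in> carrier Loc"
    then obtain a s where *: "x = frac a s" "a \<in> carrier R" "s \<in> M" by (elim Loc_cases, blast)
    show "\<one>\<^bsub>Loc\<^esub> \<otimes>\<^bsub>Loc\<^esub> x = x" using * M_one by (simp add: Loc_one Loc_mult)
  qed (use M_one in \<open>auto simp: Loc_one\<close>)
  fix x y z assume "x \<in> carrier Loc" "y \<in> carrier Loc" "z \<in> carrier Loc"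
  then obtain a s b t c w where *: "x = frac a s" "a \<in> carrier R" "s \<in> M" "y = frac b t" "b \<in> carrier R" "t \<in> M"
    "z = frac c w" "c \<in> carrier R" "w \<in> M" by (elim Loc_cases, blast)
  have "frac ((a \<otimes> t \<oplus> b \<otimes> s) \<otimes> c) (s \<otimes> t \<otimes> w) = frac (a \<otimes> c \<otimes> (t \<otimes> w) \<oplus> b \<otimes> c \<otimes> (s \<otimes> w)) (s \<otimes> w \<otimes> (t \<otimes> w))"
    by (rule frac_eqI) (use * in \<open>simp_all add: M_mult l_distr r_distr m_ac\<close>)
  then show "(x \<oplus>\<^bsub>Loc\<^esub> y) \<otimes>\<^bsub>Loc\<^esub> z = x \<otimes>\<^bsub>Loc\<^esub> z \<oplus>\<^bsub>Loc\<^esub> y \<otimes>\<^bsub>Loc\<^esub> z"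
    using * by (simp add: Loc_mult Loc_add M_mult)
qed

lemma frac_hom: "(\<lambda>a. frac a \<one>) \<in> Ring.ring_hom R Loc"
  by (rule ring_hom_memI) (use M_one in \<open>auto simp: Loc_mult Loc_add Loc_one\<close>)

text \<open>The ideal of the localization generated by an ideal.\<close>

definition ext_ideal :: "'a set \<Rightarrow> ('a \<times> 'a) set set"
  where "ext_ideal J = {frac a s | a s. a \<in> J \<and> s \<in> M}"

lemma ext_idealI: "a \<in> J \<Longrightarrow> s \<in> M \<Longrightarrow> frac a s \<in> ext_ideal J"
  by (auto simp: ext_ideal_def)

lemma ext_ideal_ideal:
  assumes "ideal J R"
  shows "ideal (ext_ideal J) Loc"
proof -
  interpret J: ideal J R by fact
  interpret L: cring Loc by (rule Loc_cring)
  have [simp]: "a \<in> J \<Longrightarrow> a \<in> carrier R" for a by (rule J.Icarr)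
  have sub: "ext_ideal J \<subseteq> carrier Loc" by (auto simp: ext_ideal_def)
  show ?thesis
  proof (rule idealI[OF L.ring_axioms])
    show "subgroup (ext_ideal J) (add_monoid Loc)"
    proof (rule L.add.subgroupI)
      show "ext_ideal J \<noteq> {}" using ext_idealI[OF J.zero_closed M_one] by blast
      fix x y assume "x \<in> ext_ideal J" "y \<in> ext_ideal J"
      then obtain a s b t where *: "x = frac a s" "a \<in> J" "s \<in> M" "y = frac b t" "b \<in> J" "t \<in> M"
        by (auto simp: ext_ideal_def)
      then have "frac (a \<otimes> t \<oplus> b \<otimes> s) (s \<otimes> t) \<in> ext_ideal J"
        by (intro ext_idealI J.a_closed J.I_r_closed M_mult) simp_all
      then show "x \<oplus>\<^bsub>Loc\<^esub> y \<in> ext_ideal J" using * by (simp add: Loc_add)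
    next
      fix x assume "x \<in> ext_ideal J"
      then obtain a s where x: "x = frac a s" "a \<in> J" "s \<in> M" by (auto simp: ext_ideal_def)
      have "frac (\<ominus> a) s \<oplus>\<^bsub>Loc\<^esub> x = \<zero>\<^bsub>Loc\<^esub>"
        using x M_one by (simp add: Loc_zero Loc_add M_mult l_distr[symmetric] l_neg) (rule frac_eqI; simp add: M_mult)
      then have "\<ominus>\<^bsub>Loc\<^esub> x = frac (\<ominus> a) s"
        by (intro L.minus_equality) (use x in \<open>simp_all add: frac_in_Loc\<close>)
      then show "\<ominus>\<^bsub>Loc\<^esub> x \<in> ext_ideal J" using ext_idealI[OF J.a_inv_closed[OF x(2)] x(3)] by simp
    qed (rule sub)
    fix x y assume "x \<in> ext_ideal J" "y \<in> carrier Loc"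
    then obtain a s b t where *: "x = frac a s" "a \<in> J" "s \<in> M" "y = frac b t" "b \<in> carrier R" "t \<in> M"
      by (auto simp: ext_ideal_def Loc_carrier)
    have "frac (a \<otimes> b) (s \<otimes> t) \<in> ext_ideal J" "frac (b \<otimes> a) (t \<otimes> s) \<in> ext_ideal J"
      by (intro ext_idealI J.I_r_closed J.I_l_closed M_mult *)+
    then show "x \<otimes>\<^bsub>Loc\<^esub> y \<in> ext_ideal J" "y \<otimes>\<^bsub>Loc\<^esub> x \<in> ext_ideal J"
      using * by (simp_all add: Loc_mult)
  qed
qed

lemma frac_mem_ext_ideal_iff:
  assumes "ideal J R" "a \<in> carrier R" "s \<in> M"
  shows "frac a s \<in> ext_ideal J \<longleftrightarrow> (\<exists>u\<in>M. u \<otimes> a \<in> J)"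
proof -
  interpret J: ideal J R by fact
  show ?thesis
  proof
    assume "frac a s \<in> ext_ideal J"
    then obtain b t where b: "b \<in> J" "t \<in> M" "frac a s = frac b t" by (auto simp: ext_ideal_def)
    then have "frac_rel a s b t" using frac_eq_iff[of a b s t] assms J.Icarr[of b] by simp
    then obtain u where u: "u \<in> M" "u \<otimes> (a \<otimes> t) = u \<otimes> (b \<otimes> s)" by (auto simp: frac_rel_def)
    have "(u \<otimes> t) \<otimes> a = u \<otimes> (a \<otimes> t)" using u(1) b assms by (simp add: m_ac)
    also have "\<dots> \<in> J" unfolding u(2) using u(1) b assms by (intro J.I_l_closed J.I_r_closed) auto
    finally show "\<exists>u\<in>M. u \<otimes> a \<in> J" using M_mult[OF u(1) b(2)] by blast
  next
    assume "\<exists>u\<in>M. u \<otimes> a \<in> J"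
    then obtain u where u: "u \<in> M" "u \<otimes> a \<in> J" by blast
    have "frac a s = frac (u \<otimes> a) (u \<otimes> s)"
      by (rule frac_eqI) (use u assms M_mult in \<open>auto simp: m_ac\<close>)
    then show "frac a s \<in> ext_ideal J" using u assms M_mult by (auto intro: ext_idealI)
  qed
qed

lemma genideal_frac_image:
  assumes "ideal J R"
  shows "Idl\<^bsub>Loc\<^esub> ((\<lambda>a. frac a \<one>) ` J) = ext_ideal J"
proof
  interpret J: ideal J R by fact
  interpret L: cring Loc by (rule Loc_cring)
  show "Idl\<^bsub>Loc\<^esub> ((\<lambda>a. frac a \<one>) ` J) \<subseteq> ext_ideal J"
    by (rule L.genideal_minimal[OF ext_ideal_ideal[OF assms]]) (auto intro: ext_idealI M_one)
  have sub: "(\<lambda>a. frac a \<one>) ` J \<subseteq> carrier Loc" using J.Icarr M_one by auto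
  interpret K: ideal "Idl\<^bsub>Loc\<^esub> ((\<lambda>a. frac a \<one>) ` J)" Loc by (rule L.genideal_ideal[OF sub])
  show "ext_ideal J \<subseteq> Idl\<^bsub>Loc\<^esub> ((\<lambda>a. frac a \<one>) ` J)"
  proof
    fix x assume "x \<in> ext_ideal J"
    then obtain a s where x: "x = frac a s" "a \<in> J" "s \<in> M" by (auto simp: ext_ideal_def)
    have "x = frac \<one> s \<otimes>\<^bsub>Loc\<^esub> frac a \<one>" using x J.Icarr M_one by (simp add: Loc_mult)
    moreover have "frac a \<one> \<in> Idl\<^bsub>Loc\<^esub> ((\<lambda>a. frac a \<one>) ` J)" using L.genideal_self[OF sub] x by blast
    ultimately show "x \<in> Idl\<^bsub>Loc\<^esub> ((\<lambda>a. frac a \<one>) ` J)" using K.I_l_closed[of "frac a \<one>" "frac \<one> s"] frac_in_Loc[of \<one> s] x by simp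
  qed
qed

lemma ext_ideal_prime:
  assumes "primeideal P R" "P \<inter> M = {}"
  shows "primeideal (ext_ideal P) Loc"
    and "\<And>a s. a \<in> carrier R \<Longrightarrow> s \<in> M \<Longrightarrow> frac a s \<in> ext_ideal P \<longleftrightarrow> a \<in> P"
proof -
  interpret P: primeideal P R by fact
  show iff: "frac a s \<in> ext_ideal P \<longleftrightarrow> a \<in> P" if as: "a \<in> carrier R" "s \<in> M" for a s
  proof
    assume "frac a s \<in> ext_ideal P"
    then obtain u where u: "u \<in> M" "u \<otimes> a \<in> P" using frac_mem_ext_ideal_iff[OF P.is_ideal as] by blast
    then have "u \<notin> P" using assms(2) by blast
    with P.I_prime[OF M_closed[OF u(1)] as(1) u(2)] show "a \<in> P" by simp
  qed (rule ext_idealI[OF _ as(2)])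
  show "primeideal (ext_ideal P) Loc"
  proof (rule primeidealI[OF ext_ideal_ideal[OF P.is_ideal] Loc_cring])
    have "\<one> \<notin> P" using assms(2) M_one by blast
    then have "frac \<one> \<one> \<notin> ext_ideal P" using iff M_one by simp
    then show "carrier Loc \<noteq> ext_ideal P" using M_one by blast
    fix x y assume xy: "x \<in> carrier Loc" "y \<in> carrier Loc" "x \<otimes>\<^bsub>Loc\<^esub> y \<in> ext_ideal P"
    from xy(1,2) obtain a s b t where *: "x = frac a s" "a \<in> carrier R" "s \<in> M" "y = frac b t" "b \<in> carrier R" "t \<in> M"
      by (elim Loc_cases, blast)
    then have "a \<otimes> b \<in> P" using xy(3) by (simp add: Loc_mult iff M_mult)
    then show "x \<in> ext_ideal P \<or> y \<in> ext_ideal P" using P.I_prime[of a b] * by (simp add: iff)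
  qed
qed

lemma contract_prime:
  assumes "primeideal Q Loc"
  shows "primeideal {a \<in> carrier R. frac a \<one> \<in> Q} R" "{a \<in> carrier R. frac a \<one> \<in> Q} \<inter> M = {}"
    and "\<And>a s. a \<in> carrier R \<Longrightarrow> s \<in> M \<Longrightarrow> frac a s \<in> Q \<longleftrightarrow> frac a \<one> \<in> Q"
proof -
  interpret Q: primeideal Q Loc by fact
  interpret L: cring Loc by (rule Loc_cring)
  have h: "ring_hom_cring R Loc (\<lambda>a. frac a \<one>)"
    by (intro ring_hom_cring.intro ring_hom_cring_axioms.intro cring_axioms Loc_cring frac_hom)
  have one: "\<one>\<^bsub>Loc\<^esub> \<notin> Q" using Q.I_notcarr Q.one_imp_carrier by blast
  show "primeideal {a \<in> carrier R. frac a \<one> \<in> Q} R"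
    using ring_hom_cring.primeideal_vimage[OF h assms] by simp
  show "{a \<in> carrier R. frac a \<one> \<in> Q} \<inter> M = {}"
  proof -
    have False if "a \<in> M" "frac a \<one> \<in> Q" for a
    proof -
      have "frac a \<one> \<otimes>\<^bsub>Loc\<^esub> frac \<one> a \<in> Q" using that by (intro Q.I_r_closed) auto
      also have "frac a \<one> \<otimes>\<^bsub>Loc\<^esub> frac \<one> a = \<one>\<^bsub>Loc\<^esub>"
        using that M_one by (simp add: Loc_mult Loc_one) (rule frac_eqI; simp)
      finally show False using one by simp
    qed
    then show ?thesis by blast
  qed
  show "frac a s \<in> Q \<longleftrightarrow> frac a \<one> \<in> Q" if "a \<in> carrier R" "s \<in> M" for a s
  proof -
    have 1: "frac a \<one> \<otimes>\<^bsub>Loc\<^esub> frac \<one> s = frac a s" using that M_one by (simp add: Loc_mult)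
    have 2: "frac a s \<otimes>\<^bsub>Loc\<^esub> frac s \<one> = frac a \<one>"
      using that M_one by (simp add: Loc_mult) (rule frac_eqI; simp add: m_ac)
    show ?thesis
    proof
      assume "frac a s \<in> Q"
      from Q.I_r_closed[OF this, of "frac s \<one>"] show "frac a \<one> \<in> Q" unfolding 2 using that M_one by blast
    next
      assume "frac a \<one> \<in> Q"
      from Q.I_r_closed[OF this, of "frac \<one> s"] show "frac a s \<in> Q" unfolding 1 using that by blast
    qed
  qed
qed

lemma genideal_frac_image_set:
  assumes B: "B \<subseteq> carrier R"
  shows "Idl\<^bsub>Loc\<^esub> ((\<lambda>a. frac a \<one>) ` B) = ext_ideal (Idl B)"
proof
  interpret L: cring Loc by (rule Loc_cring)
  have h: "ring_hom_cring R Loc (\<lambda>a. frac a \<one>)"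
    by (intro ring_hom_cring.intro ring_hom_cring_axioms.intro cring_axioms Loc_cring frac_hom)
  have J: "ideal (Idl B) R" by (rule genideal_ideal[OF B])
  have sub: "(\<lambda>a. frac a \<one>) ` B \<subseteq> carrier Loc" using B M_one by auto
  have K: "ideal (Idl\<^bsub>Loc\<^esub> ((\<lambda>a. frac a \<one>) ` B)) Loc" by (rule L.genideal_ideal[OF sub])
  show "Idl\<^bsub>Loc\<^esub> ((\<lambda>a. frac a \<one>) ` B) \<subseteq> ext_ideal (Idl B)"
    using genideal_self[OF B] M_one
    by (intro L.genideal_minimal[OF ext_ideal_ideal[OF J]]) (auto intro!: ext_idealI)
  have "Idl B \<subseteq> {a \<in> carrier R. frac a \<one> \<in> Idl\<^bsub>Loc\<^esub> ((\<lambda>a. frac a \<one>) ` B)}"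
    using L.genideal_self[OF sub] B by (intro genideal_minimal[OF ring_hom_cring.ideal_vimage[OF h K]]) auto
  then show "ext_ideal (Idl B) \<subseteq> Idl\<^bsub>Loc\<^esub> ((\<lambda>a. frac a \<one>) ` B)"
    unfolding genideal_frac_image[OF J, symmetric] by (intro L.genideal_minimal[OF K]) auto
qed

end

locale prime_localization = cring + primeideal p R for p
begin

sublocale mult_submonoid R "carrier R - p"
proof
  show "\<one> \<in> carrier R - p" using I_notcarr one_imp_carrier by blast
  show "a \<otimes> b \<in> carrier R - p" if "a \<in> carrier R - p" "b \<in> carrier R - p" for a b
    using that I_prime[of a b] by auto
qed auto

lemma loc_at_eq: "loc_at R p = Loc" by (simp add: loc_at_def)

lemma ideal_at_eq: "ideal I R \<Longrightarrow> ideal_at R p I = ext_ideal I"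
  unfolding ideal_at_def loc_at_eq by (rule genideal_frac_image)

lemma krull_dim_loc_at_ge:
  assumes P: "\<And>i. i \<le> d \<Longrightarrow> primeideal (P i) R" "\<And>i. i \<le> d \<Longrightarrow> P i \<subseteq> p"
    and strict: "\<And>i. i < d \<Longrightarrow> P i \<subset> P (Suc i)"
  shows "enat d \<le> krull_dim (loc_at R p)"
  unfolding krull_dim_def loc_at_eq
proof (rule Sup_upper, rule CollectI, rule exI[of _ d], rule conjI[OF refl], rule exI[of _ "\<lambda>i. ext_ideal (P i)"],
    intro conjI allI impI)
  fix i assume i: "i \<le> d"
  have "P i \<inter> (carrier R - p) = {}" using P(2)[OF i] by blast
  then show "primeideal (ext_ideal (P i)) Loc" by (rule ext_ideal_prime(1)[OF P(1)[OF i]])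
next
  fix i assume i: "i < d"
  then have di: "P i \<inter> (carrier R - p) = {}" using P(2)[of i] by auto
  obtain a where a: "a \<in> P (Suc i)" "a \<notin> P i" using strict[OF i] by blast
  have "a \<in> carrier R" using a(1) P(1)[of "Suc i"] i by (auto simp: primeideal_def dest: ideal.Icarr)
  then have "frac a \<one> \<notin> ext_ideal (P i)"
    using ext_ideal_prime(2)[OF P(1) di, of a \<one>] a(2) i M_one by auto
  moreover have "frac a \<one> \<in> ext_ideal (P (Suc i))" by (rule ext_idealI[OF a(1) M_one])
  moreover have "ext_ideal (P i) \<subseteq> ext_ideal (P (Suc i))" using strict[OF i] by (auto simp: ext_ideal_def)
  ultimately show "ext_ideal (P i) \<subset> ext_ideal (P (Suc i))" by blast
qed

lemma krull_dim_loc_at_le: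
  assumes no: "\<And>P. (\<And>i. i \<le> Suc d \<Longrightarrow> primeideal (P i) R \<and> P i \<subseteq> p) \<Longrightarrow>
      (\<And>i. i < Suc d \<Longrightarrow> P i \<subset> P (Suc i)) \<Longrightarrow> False"
  shows "krull_dim (loc_at R p) \<le> enat d"
  unfolding krull_dim_def loc_at_eq
proof (rule Sup_least)
  fix e assume "e \<in> {enat d | d. \<exists>P :: nat \<Rightarrow> ('a \<times> 'a) set set.
    (\<forall>i\<le>d. primeideal (P i) Loc) \<and> (\<forall>i<d. P i \<subset> P (Suc i))}"
  then obtain d' Q where e: "e = enat d'" and Q: "\<And>i. i \<le> d' \<Longrightarrow> primeideal (Q i) Loc" "\<And>i. i < d' \<Longrightarrow> Q i \<subset> Q (Suc i)"
    by blast
  have "d' \<le> d"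
  proof (rule ccontr)
    assume "\<not> d' \<le> d"
    then have d: "Suc d \<le> d'" by simp
    let ?P = "\<lambda>i. {a \<in> carrier R. frac a \<one> \<in> Q i}"
    show False
    proof (rule no[of ?P])
      fix i assume i: "i \<le> Suc d"
      then have "primeideal (Q i) Loc" using Q(1) d by simp
      from contract_prime(1,2)[OF this] show "primeideal (?P i) R \<and> ?P i \<subseteq> p" by (auto intro: conjI)
    next
      fix i assume i: "i < Suc d"
      then have prime: "primeideal (Q i) Loc" "primeideal (Q (Suc i)) Loc" using Q(1) d by simp_all
      have QQ: "Q i \<subset> Q (Suc i)" using Q(2) d i by simp
      then obtain x where x: "x \<in> Q (Suc i)" "x \<notin> Q i" by blast
      have "x \<in> carrier Loc" using x(1) prime(2) by (auto simp: primeideal_def dest: ideal.Icarr)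
      then obtain a s where as: "x = frac a s" "a \<in> carrier R" "s \<in> carrier R - p" by (rule Loc_cases)
      have "a \<in> ?P (Suc i)"
        using x(1) as(2) contract_prime(3)[OF prime(2) as(2,3)] unfolding as(1) by simp
      moreover have "a \<notin> ?P i"
        using x(2) contract_prime(3)[OF prime(1) as(2,3)] unfolding as(1) by simp
      moreover have "?P i \<subseteq> ?P (Suc i)" using QQ by auto
      ultimately show "?P i \<subset> ?P (Suc i)" by (intro psubsetI notI) simp_all
    qed
  qed
  then show "e \<le> enat d" by (simp add: e)
qed

lemma min_gens_loc_at_le:
  assumes I: "ideal I R" and B: "finite B" "B \<subseteq> I" "\<And>f. f \<in> I \<Longrightarrow> \<exists>s\<in>carrier R - p. s \<otimes> f \<in> Idl B"
  shows "min_gens (loc_at R p) (ideal_at R p I) \<le> enat (card B)"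
proof -
  interpret I: ideal I R by fact
  have Bc: "B \<subseteq> carrier R" using B(2) I.Icarr by blast
  let ?A = "(\<lambda>a. frac a \<one>) ` B"
  have "ext_ideal (Idl B) = ext_ideal I"
  proof
    show "ext_ideal (Idl B) \<subseteq> ext_ideal I" using genideal_minimal[OF I B(2)] by (auto simp: ext_ideal_def)
    show "ext_ideal I \<subseteq> ext_ideal (Idl B)"
    proof
      fix x assume "x \<in> ext_ideal I"
      then obtain a s where "x = frac a s" "a \<in> I" "s \<in> carrier R - p" unfolding ext_ideal_def by blast
      then show "x \<in> ext_ideal (Idl B)"
        using frac_mem_ext_ideal_iff[OF genideal_ideal[OF Bc] I.Icarr, of a s] B(3)[of a] by simp
    qed
  qed
  then have "Idl\<^bsub>Loc\<^esub> ?A = ideal_at R p I"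
    unfolding ideal_at_eq[OF I] genideal_frac_image_set[OF Bc] .
  moreover have "?A \<subseteq> carrier Loc" using Bc M_one by blast
  ultimately have "min_gens Loc (ideal_at R p I) \<le> enat (card ?A)"
    unfolding min_gens_def
    by (intro Inf_lower CollectI exI[of _ ?A] conjI refl finite_imageI B(1))
  also have "\<dots> \<le> enat (card B)" using card_image_le[OF B(1)] by simp
  finally show ?thesis by (simp add: loc_at_eq)
qed

lemma min_gens_loc_at_obtain:
  assumes I: "ideal I R" and k: "min_gens (loc_at R p) (ideal_at R p I) \<le> enat k"
  obtains B where "finite B" "card B \<le> k" "B \<subseteq> I" "\<And>f. f \<in> I \<Longrightarrow> \<exists>s\<in>carrier R - p. s \<otimes> f \<in> Idl B"
proof -
  interpret I: ideal I R by fact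
  interpret L: cring Loc by (rule Loc_cring)
  define S where "S = {enat (card A) | A. finite A \<and> A \<subseteq> carrier Loc \<and> Idl\<^bsub>Loc\<^esub> A = ext_ideal I}"
  have Inf: "Inf S \<le> enat k" using k by (simp add: min_gens_def loc_at_eq ideal_at_eq[OF I] S_def)
  have "S \<noteq> {}"
  proof
    assume "S = {}"
    then have "Inf S = \<infinity>" unfolding Inf_enat_def by (rule if_P)
    then show False using Inf by simp
  qed
  then have "Inf S = (LEAST x. x \<in> S)" "\<exists>x. x \<in> S" by (auto simp: Inf_enat_def)
  then have "Inf S \<in> S" by (metis LeastI_ex)
  then have "\<exists>A. Inf S = enat (card A) \<and> finite A \<and> A \<subseteq> carrier Loc \<and> Idl\<^bsub>Loc\<^esub> A = ext_ideal I"
    unfolding S_def by (rule CollectD)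
  then obtain A where A: "finite A" "A \<subseteq> carrier Loc" "Idl\<^bsub>Loc\<^esub> A = ext_ideal I" "Inf S = enat (card A)"
    by blast
  have "\<exists>b\<in>I. \<exists>s\<in>carrier R - p. x = frac b s" if "x \<in> A" for x
    using that L.genideal_self[OF A(2)] A(3) unfolding ext_ideal_def by blast
  then obtain \<beta> where \<beta>: "\<And>x. x \<in> A \<Longrightarrow> \<beta> x \<in> I" "\<And>x. x \<in> A \<Longrightarrow> \<exists>s\<in>carrier R - p. x = frac (\<beta> x) s"
    by metis
  let ?B = "\<beta> ` A"
  have B: "?B \<subseteq> I" "?B \<subseteq> carrier R" using \<beta>(1) I.Icarr by auto
  have J: "ideal (Idl ?B) R" by (rule genideal_ideal[OF B(2)])
  have "A \<subseteq> ext_ideal (Idl ?B)"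
  proof
    fix x assume x: "x \<in> A"
    then have "\<beta> x \<in> Idl ?B" using genideal_self[OF B(2)] by blast
    then show "x \<in> ext_ideal (Idl ?B)" using \<beta>(2)[OF x] unfolding ext_ideal_def by blast
  qed
  then have sub: "ext_ideal I \<subseteq> ext_ideal (Idl ?B)"
    using L.genideal_minimal[OF ext_ideal_ideal[OF J]] A(3) by blast
  show ?thesis
  proof (rule that)
    show "finite ?B" using A(1) by simp
    show "card ?B \<le> k" using card_image_le[OF A(1), of \<beta>] Inf A(4) by simp
    show "?B \<subseteq> I" by (rule B)
    fix f assume f: "f \<in> I"
    then have "frac f \<one> \<in> ext_ideal (Idl ?B)" using sub ext_idealI[OF f M_one] by blast
    then show "\<exists>s\<in>carrier R - p. s \<otimes> f \<in> Idl ?B"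
      using frac_mem_ext_ideal_iff[OF J I.Icarr[OF f] M_one] by simp
  qed
qed

end

context cring
begin

definition int_mono :: "(nat \<Rightarrow> 'a) \<Rightarrow> (nat \<Rightarrow>\<^sub>0 nat) \<Rightarrow> 'a"
  where "int_mono x m = (\<Otimes>i\<in>Poly_Mapping.keys m. x i [^] Poly_Mapping.lookup m i)"

definition int_eval :: "(nat \<Rightarrow> 'a) \<Rightarrow> ((nat \<Rightarrow>\<^sub>0 nat) \<Rightarrow>\<^sub>0 int) \<Rightarrow> 'a"
  where "int_eval x f = (\<Oplus>m\<in>Poly_Mapping.keys f. [Poly_Mapping.lookup f m] \<cdot> int_mono x m)"

lemma add_pow_int_add:
  assumes "y \<in> carrier R"
  shows "[(a + b :: int)] \<cdot> y = [a] \<cdot> y \<oplus> [b] \<cdot> y"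
proof -
  have "y [^]\<^bsub>add_monoid R\<^esub> (a + b) = y [^]\<^bsub>add_monoid R\<^esub> a \<otimes>\<^bsub>add_monoid R\<^esub> y [^]\<^bsub>add_monoid R\<^esub> b"
    by (rule group.int_pow_mult[OF add.is_group]) (use assms in simp)
  then show ?thesis by (simp add: add_pow_def)
qed

lemma add_pow_int_zero: "[(0::int)] \<cdot> y = \<zero>"
  by (simp add: add_pow_def)

lemma add_pow_int_one: "y \<in> carrier R \<Longrightarrow> [(1::int)] \<cdot> y = y"
  using add_pow_int_ge[of 1 R y] by (simp add: add_pow_def nat_pow_def)

lemma add_pow_int_neg_one: "y \<in> carrier R \<Longrightarrow> [(- 1::int)] \<cdot> y = \<ominus> y"
  using add_pow_int_lt[of "-1" R y] by (simp add: add_pow_def nat_pow_def)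

lemma add_pow_int_closed: "y \<in> carrier R \<Longrightarrow> [(a::int)] \<cdot> y \<in> carrier R"
  by (rule add.int_pow_closed)

context
  fixes x :: "nat \<Rightarrow> 'a"
  assumes x: "\<And>i. x i \<in> carrier R"
begin

lemma int_mono_closed: "int_mono x m \<in> carrier R"
  unfolding int_mono_def by (rule finprod_closed) (use x in auto)

lemma int_mono_superset:
  assumes "finite K" "Poly_Mapping.keys m \<subseteq> K"
  shows "int_mono x m = (\<Otimes>i\<in>K. x i [^] Poly_Mapping.lookup m i)"
  unfolding int_mono_def
  by (rule finprod_mono_neutral_cong_left) (use assms x in \<open>auto simp: in_keys_iff\<close>)

lemma int_mono_add: "int_mono x (m + n) = int_mono x m \<otimes> int_mono x n"
proof -
  let ?K = "Poly_Mapping.keys m \<union> Poly_Mapping.keys n"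
  have "int_mono x (m + n) = (\<Otimes>i\<in>?K. x i [^] Poly_Mapping.lookup (m + n) i)"
    by (rule int_mono_superset) (auto dest: keys_add[THEN subsetD])
  also have "\<dots> = (\<Otimes>i\<in>?K. x i [^] Poly_Mapping.lookup m i \<otimes> x i [^] Poly_Mapping.lookup n i)"
    by (rule finprod_cong') (use x in \<open>auto simp: lookup_add nat_pow_mult\<close>)
  also have "\<dots> = (\<Otimes>i\<in>?K. x i [^] Poly_Mapping.lookup m i) \<otimes> (\<Otimes>i\<in>?K. x i [^] Poly_Mapping.lookup n i)"
    by (rule finprod_multf) (use x in auto)
  finally show ?thesis using int_mono_superset[of ?K m] int_mono_superset[of ?K n] by simp
qed

lemma int_eval_closed: "int_eval x f \<in> carrier R"
  unfolding int_eval_def by (rule finsum_closed) (auto intro!: add_pow_int_closed int_mono_closed)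

lemma int_eval_superset:
  assumes "finite K" "Poly_Mapping.keys f \<subseteq> K"
  shows "int_eval x f = (\<Oplus>m\<in>K. [Poly_Mapping.lookup f m] \<cdot> int_mono x m)"
  unfolding int_eval_def
  by (rule add.finprod_mono_neutral_cong_left)
    (use assms in \<open>auto simp: in_keys_iff add_pow_int_zero intro!: add_pow_int_closed int_mono_closed\<close>)

lemma int_eval_add: "int_eval x (f + g) = int_eval x f \<oplus> int_eval x g"
proof -
  let ?K = "Poly_Mapping.keys f \<union> Poly_Mapping.keys g"
  have "int_eval x (f + g) = (\<Oplus>m\<in>?K. [Poly_Mapping.lookup (f + g) m] \<cdot> int_mono x m)"
    by (rule int_eval_superset) (auto dest: keys_add[THEN subsetD])
  also have "\<dots> = (\<Oplus>m\<in>?K. [Poly_Mapping.lookup f m] \<cdot> int_mono x m \<oplus> [Poly_Mapping.lookup g m] \<cdot> int_mono x m)"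
    by (rule finsum_cong')
      (auto simp: lookup_add intro!: add_pow_int_add add_pow_int_closed int_mono_closed)
  also have "\<dots> = (\<Oplus>m\<in>?K. [Poly_Mapping.lookup f m] \<cdot> int_mono x m) \<oplus> (\<Oplus>m\<in>?K. [Poly_Mapping.lookup g m] \<cdot> int_mono x m)"
    by (rule finsum_addf) (auto intro!: add_pow_int_closed int_mono_closed)
  finally show ?thesis using int_eval_superset[of ?K f] int_eval_superset[of ?K g] by simp
qed

lemma int_eval_zero: "int_eval x 0 = \<zero>"
  by (simp add: int_eval_def)

lemma int_eval_single: "int_eval x (Poly_Mapping.single m c) = [c] \<cdot> int_mono x m"
proof -
  have "int_eval x (Poly_Mapping.single m c) = (\<Oplus>k\<in>{m}. [Poly_Mapping.lookup (Poly_Mapping.single m c) k] \<cdot> int_mono x k)"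
    by (rule int_eval_superset) simp_all
  then show ?thesis using add_pow_int_closed[OF int_mono_closed, of c m] by simp
qed

lemma int_eval_single_mult:
  "int_eval x (Poly_Mapping.single m c * Poly_Mapping.single n d)
    = int_eval x (Poly_Mapping.single m c) \<otimes> int_eval x (Poly_Mapping.single n d)"
proof -
  have "([(c * d)] \<cdot> y) = ([d] \<cdot> ([c] \<cdot> y))" if "y \<in> carrier R" for y
    using group.int_pow_pow[OF add.is_group, of y c d] that by (simp add: add_pow_def mult.commute)
  then have "[(c * d)] \<cdot> (int_mono x m \<otimes> int_mono x n) = ([c] \<cdot> int_mono x m) \<otimes> ([d] \<cdot> int_mono x n)"
    by (simp add: add_pow_ldistr_int add_pow_rdistr_int int_mono_closed add_pow_int_closed)
  then show ?thesis by (simp add: int_eval_single mult_single int_mono_add)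
qed

lemma update_eq_add_single:
  "k \<notin> Poly_Mapping.keys f \<Longrightarrow> Poly_Mapping.update k v f = f + Poly_Mapping.single k v"
  by (rule poly_mapping_eqI) (auto simp: lookup_update lookup_add lookup_single when_def in_keys_iff)

lemma int_eval_mult: "int_eval x (f * g) = int_eval x f \<otimes> int_eval x g"
proof (induct f rule: update_induct)
  case const
  show ?case by (simp add: int_eval_zero int_eval_closed)
next
  case (update f m c)
  have "int_eval x (Poly_Mapping.single m c * g) = int_eval x (Poly_Mapping.single m c) \<otimes> int_eval x g"
  proof (induct g rule: update_induct)
    case const
    show ?case by (simp add: int_eval_zero int_eval_closed)
  next
    case (update g n d)
    then show ?case
      by (simp add: update_eq_add_single distrib_left int_eval_add int_eval_single_mult r_distr int_eval_closed)
  qed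
  then show ?case using update
    by (simp add: update_eq_add_single distrib_right int_eval_add l_distr int_eval_closed)
qed

lemma int_eval_one: "int_eval x 1 = \<one>"
proof -
  have "int_eval x (Poly_Mapping.single 0 1) = \<one>"
    unfolding int_eval_single by (simp add: int_mono_def add_pow_int_one)
  then show ?thesis by simp
qed

lemma int_eval_uminus: "int_eval x (- f) = \<ominus> int_eval x f"
proof -
  have "int_eval x (- f) \<oplus> int_eval x f = \<zero>" unfolding int_eval_add[symmetric] by (simp add: int_eval_zero)
  then show ?thesis using minus_equality int_eval_closed by metis
qed

lemma int_eval_var: "int_eval x (Poly_Mapping.single (Poly_Mapping.single i 1) 1) = x i"
  unfolding int_eval_single int_mono_def using x by (simp add: add_pow_int_one)

lemma int_eval_power: "int_eval x (f ^ k) = int_eval x f [^] k"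
  by (induct k) (simp_all add: int_eval_one int_eval_mult m_comm int_eval_closed)

lemma int_eval_sum: "finite A \<Longrightarrow> int_eval x (sum f A) = (\<Oplus>a\<in>A. int_eval x (f a))"
proof (induct A rule: finite_induct)
  case (insert a A)
  then show ?case by (simp add: int_eval_add int_eval_closed)
qed (simp add: int_eval_zero)

lemma int_eval_prod: "finite A \<Longrightarrow> int_eval x (prod f A) = (\<Otimes>a\<in>A. int_eval x (f a))"
proof (induct A rule: finite_induct)
  case (insert a A)
  then show ?case by (simp add: int_eval_mult int_eval_closed)
qed (simp add: int_eval_one)

lemma int_eval_fdet: "int_eval x (fdet t A) = mat_det R t (\<lambda>i j. int_eval x (A i j))"
proof -
  have "int_eval x (of_int (sign p) * f) = [sign p] \<cdot> int_eval x f" for p :: "nat \<Rightarrow> nat" and f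
    by (cases "evenperm p")
      (simp_all add: sign_def add_pow_int_one add_pow_int_neg_one int_eval_closed int_eval_uminus)
  then show ?thesis unfolding fdet_leibniz mat_det_def
    by (simp add: int_eval_sum int_eval_prod finite_permutations)
qed

end

end

locale sym_matrix = cring +
  fixes A :: "nat \<Rightarrow> nat \<Rightarrow> 'a"
  assumes A_closed: "\<And>i j. A i j \<in> carrier R" and A_sym: "\<And>i j. A i j = A j i"
begin

definition minor :: "nat \<Rightarrow> (nat \<Rightarrow> nat) \<Rightarrow> (nat \<Rightarrow> nat) \<Rightarrow> 'a"
  where "minor t f g = mat_det R t (\<lambda>a b. A (f a) (g b))"

text \<open>The generic symmetric matrix over the integers, and its evaluation at \<open>A\<close>: determinant
  identities are proved for the former, in a type of class \<open>idom\<close>, and transported to \<open>R\<close>.\<close>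

definition \<Y> :: "nat \<Rightarrow> nat \<Rightarrow> (nat \<Rightarrow>\<^sub>0 nat) \<Rightarrow>\<^sub>0 int"
  where "\<Y> i j = Poly_Mapping.single (Poly_Mapping.single (prod_encode (min i j, max i j)) 1) 1"

definition entry :: "nat \<Rightarrow> 'a"
  where "entry k = (case prod_decode k of (i, j) \<Rightarrow> A i j)"

lemma entry_closed: "entry k \<in> carrier R"
  using A_closed by (simp add: entry_def case_prod_unfold)

definition ev :: "((nat \<Rightarrow>\<^sub>0 nat) \<Rightarrow>\<^sub>0 int) \<Rightarrow> 'a"
  where "ev = int_eval entry"

lemmas ev_closed = int_eval_closed[where x = entry, OF entry_closed, folded ev_def]
  and ev_add = int_eval_add[where x = entry, OF entry_closed, folded ev_def]
  and ev_mult = int_eval_mult[where x = entry, OF entry_closed, folded ev_def]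
  and ev_zero = int_eval_zero[where x = entry, OF entry_closed, folded ev_def]
  and ev_one = int_eval_one[where x = entry, OF entry_closed, folded ev_def]
  and ev_uminus = int_eval_uminus[where x = entry, OF entry_closed, folded ev_def]
  and ev_power = int_eval_power[where x = entry, OF entry_closed, folded ev_def]
  and ev_fdet = int_eval_fdet[where x = entry, OF entry_closed, folded ev_def]

lemma ev_Y: "ev (\<Y> i j) = A i j"
  unfolding ev_def \<Y>_def int_eval_var[where x = entry, OF entry_closed]
  using A_sym[of i j] by (simp add: entry_def min_def max_def)

lemma Y_sym: "\<Y> i j = \<Y> j i"
  by (simp add: \<Y>_def min.commute max.commute)

lemma ev_sub_det: "ev (sub_det \<Y> t f g) = minor t f g"
  by (simp add: sub_det_def ev_fdet ev_Y minor_def)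

lemma minor_closed: "minor t f g \<in> carrier R"
  using ev_closed[of "sub_det \<Y> t f g"] by (simp add: ev_sub_det)

lemma class_ideal_ev: "ideal I R \<Longrightarrow> class_ideal {z. ev z \<in> I}"
  unfolding class_ideal_def
  by (auto simp: ev_zero ev_add ev_mult ev_closed additive_subgroup.zero_closed[OF ideal.axioms(1)]
      additive_subgroup.a_closed[OF ideal.axioms(1)] ideal.I_l_closed)

lemma class_subring_ev: "subring T R \<Longrightarrow> class_subring {z. ev z \<in> T}"
  unfolding class_subring_def
  by (auto simp: ev_one ev_add ev_mult ev_uminus subringE)

lemma minor_cong:
  assumes "\<And>i. i < t \<Longrightarrow> f i = f' i" "\<And>i. i < t \<Longrightarrow> g i = g' i"
  shows "minor t f g = minor t f' g'"
  using arg_cong[OF sub_det_cong[of t f f' g g' \<Y>], of ev] assms by (simp add: ev_sub_det)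

lemma minor_commute: "minor t f g = minor t g f"
  using arg_cong[OF sub_det_commute[of \<Y> t f g, OF Y_sym], of ev] by (simp add: ev_sub_det)

lemma minor_noninj: "\<not> inj_on f {..<t} \<or> \<not> inj_on g {..<t} \<Longrightarrow> minor t f g = \<zero>"
  using arg_cong[OF sub_det_noninj_zero[of f t g \<Y>], of ev] by (simp add: ev_sub_det ev_zero)

lemma minor_mem_subring:
  assumes "subring T R" "\<And>a b. a < t \<Longrightarrow> b < t \<Longrightarrow> A (f a) (g b) \<in> T"
  shows "minor t f g \<in> T"
  using fdet_mem_subring[OF class_subring_ev[OF assms(1)], of t "\<lambda>a b. \<Y> (f a) (g b)"] assms(2)
  by (simp add: ev_Y sub_det_def[symmetric] ev_sub_det)

lemma minor_last_row:
  assumes T: "subring T R"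
    and "\<And>a b. a < r \<Longrightarrow> b < r \<Longrightarrow> A (f a) (g b) \<in> T"
    and "\<And>a. a < r \<Longrightarrow> A (f a) j \<in> T" and "\<And>b. b < r \<Longrightarrow> A i (g b) \<in> T"
  obtains c where "c \<in> T" "minor (Suc r) (f(r := i)) (g(r := j)) = minor r f g \<otimes> A i j \<oplus> c"
proof -
  obtain c where c: "ev c \<in> T" "sub_det \<Y> (Suc r) (f(r := i)) (g(r := j)) = sub_det \<Y> r f g * \<Y> i j + c"
    using sub_det_last_row[OF class_subring_ev[OF T], of r \<Y> f g j i] assms by (auto simp: ev_Y)
  have "minor (Suc r) (f(r := i)) (g(r := j)) = minor r f g \<otimes> A i j \<oplus> ev c"
    unfolding ev_sub_det[symmetric] c(2) by (simp add: ev_add ev_mult ev_Y)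
  then show ?thesis by (rule that[OF c(1)])
qed

lemma minor_mem_of_bordered:
  assumes "ideal I R" "r < t"
    and "\<And>a b. a < t \<Longrightarrow> b < t \<Longrightarrow> minor (Suc r) (f(r := f' a)) (g(r := g' b)) \<in> I"
  shows "(minor r f g [^] (2::nat)) [^] t \<otimes> minor t f' g' \<in> I"
  using sub_det_mem_of_bordered[OF class_ideal_ev[OF assms(1)] assms(2), of \<Y> f f' g g'] assms(3)
  by (simp add: ev_sub_det ev_mult ev_power)

lemma minor_mem_of_bordered_square:
  assumes "ideal I R" "Suc r < t"
    and "\<And>a b c d. a < t \<Longrightarrow> b < t \<Longrightarrow> c < t \<Longrightarrow> d < t \<Longrightarrow>
      minor (Suc r) (f(r := f' a)) (g(r := g' b)) \<otimes> minor (Suc r) (f(r := f' c)) (g(r := g' d)) \<in> I"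
  shows "(minor r f g [^] (2::nat)) [^] t \<otimes> minor t f' g' \<in> I"
  using sub_det_mem_of_bordered_square[OF class_ideal_ev[OF assms(1)] assms(2), of \<Y> f f' g g'] assms(3)
  by (simp add: ev_sub_det ev_mult ev_power)

lemma bordered_minor_mem_of_principal:
  assumes p: "primeideal p R" and "minor r f f \<notin> p"
    and "minor (Suc r) (f(r := i)) (f(r := i)) \<in> p"
    and "minor (Suc (Suc r)) (f(r := i, Suc r := j)) (f(r := i, Suc r := j)) \<in> p"
  shows "minor (Suc r) (f(r := i)) (f(r := j)) \<in> p"
proof -
  have I: "class_ideal {z. ev z \<in> p}" by (rule class_ideal_ev) (rule primeideal.axioms(1)[OF p])
  have "a \<in> {z. ev z \<in> p} \<or> b \<in> {z. ev z \<in> p}" if "a * b \<in> {z. ev z \<in> p}" for a b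
    using primeideal.I_prime[OF p ev_closed ev_closed, of a b] that by (simp add: ev_mult)
  from bordered_mem_of_principal[where Y = \<Y>, OF I this Y_sym, where r = r and f = f and i = i and j = j] assms show ?thesis
    by (simp add: ev_sub_det)
qed

lemma maximal_minor_mem:
  assumes I: "ideal I R" and f: "inj_on f {..<r}" "f ` {..<r} \<subseteq> {..<n}" "r < n"
    and M: "\<And>i j. i \<in> {..<n} - f ` {..<r} \<Longrightarrow> j \<in> {..<n} - f ` {..<r} \<Longrightarrow>
      minor (n - 1) (insert_index i) (insert_index j) \<in> I"
    and ij: "i < n" "j < n"
  shows "(minor r f f [^] (2::nat)) \<otimes> minor (n - 1) (insert_index i) (insert_index j) \<in> I"
  using maximal_minors_mem[where Y = \<Y>, OF class_ideal_ev[OF I] Y_sym f _ ij] M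
  by (simp add: ev_sub_det ev_mult ev_power)

lemma minor_mem_of_selections:
  assumes I: "ideal I R"
    and Y: "\<And>s s'. s \<in> selections t n \<Longrightarrow> s' \<in> selections t n \<Longrightarrow> minor t s s' \<in> I"
    and f: "f ` {..<t} \<subseteq> {..<n}" and g: "g ` {..<t} \<subseteq> {..<n}"
  shows "minor t f g \<in> I"
  using sub_det_mem_of_selections[OF class_ideal_ev[OF I] _ f g, of \<Y>] Y by (simp add: ev_sub_det)

end

definition exps :: "nat \<Rightarrow> nat \<Rightarrow> nat list set"
  where "exps M k = {\<beta>. set \<beta> \<subseteq> {..M} \<and> length \<beta> = k}"

lemma exps_0: "exps M 0 = {[]}"
  by (auto simp: exps_def)

lemma finite_exps: "finite (exps M k)"
  unfolding exps_def by (rule finite_lists_length_eq) simp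

lemma card_exps: "card (exps M k) = Suc M ^ k"
  unfolding exps_def by (subst card_lists_length_eq) auto

lemma exps_Suc: "exps M (Suc k) = (\<lambda>(b, \<beta>). b # \<beta>) ` ({..M} \<times> exps M k)"
proof
  show "exps M (Suc k) \<subseteq> (\<lambda>(b, \<beta>). b # \<beta>) ` ({..M} \<times> exps M k)"
  proof
    fix \<beta> assume "\<beta> \<in> exps M (Suc k)"
    then obtain b \<beta>' where "\<beta> = b # \<beta>'" "b \<le> M" "\<beta>' \<in> exps M k"
      by (cases \<beta>) (auto simp: exps_def)
    then show "\<beta> \<in> (\<lambda>(b, \<beta>). b # \<beta>) ` ({..M} \<times> exps M k)" by force
  qed
qed (auto simp: exps_def)

context primeideal
begin

lemma one_notin: "\<one> \<notin> I"
  using I_notcarr one_imp_carrier by blast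

lemma mult_mem_iff: "a \<in> carrier R \<Longrightarrow> b \<in> carrier R \<Longrightarrow> a \<otimes> b \<in> I \<longleftrightarrow> a \<in> I \<or> b \<in> I"
  using I_prime[of a b] I_l_closed[of b a] I_r_closed[of a b] by blast

lemma pow_mem: "a \<in> carrier R \<Longrightarrow> a [^] (k::nat) \<in> I \<Longrightarrow> a \<in> I"
  by (induct k) (auto simp: one_notin mult_mem_iff)

lemma finsum_mem:
  assumes "\<And>i. i \<in> A \<Longrightarrow> f i \<in> I"
  shows "finsum R f A \<in> I"
  using assms
proof (induct A rule: infinite_finite_induct)
  case (insert a A)
  then have "f \<in> A \<rightarrow> carrier R" "f a \<in> carrier R" using Icarr by auto
  moreover have "f a \<oplus> finsum R f A \<in> I"
    by (rule additive_subgroup.a_closed[OF additive_subgroup_axioms]) (use insert in auto)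
  ultimately show ?case using insert by simp
qed simp_all

lemma add_mem_left:
  assumes "a \<in> carrier R" "b \<in> I" "a \<oplus> b \<in> I"
  shows "a \<in> I"
proof -
  have "(a \<oplus> b) \<oplus> \<ominus> b \<in> I"
    by (rule additive_subgroup.a_closed[OF additive_subgroup_axioms assms(3)])
      (rule additive_subgroup.a_inv_closed[OF additive_subgroup_axioms assms(2)])
  also have "(a \<oplus> b) \<oplus> \<ominus> b = a" using assms Icarr[OF assms(2)] by (simp add: a_assoc r_neg)
  finally show ?thesis .
qed

text \<open>Gaussian elimination over the domain \<open>R/I\<close>: more unknowns than homogeneous equations.\<close>

lemma dependent_mod:
  assumes "finite J" "finite W" "card J < card W"
    and "\<And>w j. w \<in> W \<Longrightarrow> j \<in> J \<Longrightarrow> u w j \<in> carrier R"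
  shows "\<exists>v. (\<forall>w\<in>W. v w \<in> carrier R) \<and> (\<exists>w\<in>W. v w \<notin> I) \<and> (\<forall>j\<in>J. (\<Oplus>w\<in>W. v w \<otimes> u w j) \<in> I)"
  using assms
proof (induct J arbitrary: W u rule: finite_induct)
  case empty
  then have "W \<noteq> {}" by auto
  then show ?case using one_notin by (intro exI[of _ "\<lambda>_. \<one>"]) auto
next
  case (insert j J)
  note W = \<open>finite W\<close> and u = insert(6)
  show ?case
  proof (cases "\<forall>w\<in>W. u w j \<in> I")
    case True
    have "card J < card W" using insert by simp
    then have "\<exists>v. (\<forall>w\<in>W. v w \<in> carrier R) \<and> (\<exists>w\<in>W. v w \<notin> I) \<and> (\<forall>j\<in>J. (\<Oplus>w\<in>W. v w \<otimes> u w j) \<in> I)"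
      by (rule insert(3)[OF W]) (rule u, simp_all)
    then obtain v where v: "\<forall>w\<in>W. v w \<in> carrier R" "\<exists>w\<in>W. v w \<notin> I"
      "\<forall>j\<in>J. (\<Oplus>w\<in>W. v w \<otimes> u w j) \<in> I" by blast
    have "(\<Oplus>w\<in>W. v w \<otimes> u w j) \<in> I" by (rule finsum_mem) (use True v(1) I_l_closed in auto)
    then have "\<forall>j'\<in>insert j J. (\<Oplus>w\<in>W. v w \<otimes> u w j') \<in> I" using v(3) by simp
    then show ?thesis using v(1,2) by blast
  next
    case False
    then obtain w0 where w0: "w0 \<in> W" "u w0 j \<notin> I" by blast
    define d where "d = u w0 j"
    define W' where "W' = W - {w0}"
    have W': "finite W'" "w0 \<notin> W'" "W = insert w0 W'" using W w0 by (auto simp: W'_def)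
    have d: "d \<in> carrier R" "d \<notin> I" using w0 u by (auto simp: d_def)
    define u' where "u' = (\<lambda>w j'. d \<otimes> u w j' \<oplus> \<ominus> (u w j \<otimes> u w0 j'))"
    have uc: "u w j' \<in> carrier R" if "w \<in> W'" "j' \<in> insert j J" for w j' using u that W' by auto
    have u0: "u w0 j' \<in> carrier R" if "j' \<in> insert j J" for j' using u that w0 by auto
    have u'c: "u' w j' \<in> carrier R" if "w \<in> W'" "j' \<in> insert j J" for w j'
      using uc[OF that] uc[OF that(1), of j] u0[OF that(2)] d by (simp add: u'_def)
    have "card J < card W'" using insert(2,1,5) W w0 W' by simp
    then have "\<exists>v. (\<forall>w\<in>W'. v w \<in> carrier R) \<and> (\<exists>w\<in>W'. v w \<notin> I) \<and> (\<forall>j\<in>J. (\<Oplus>w\<in>W'. v w \<otimes> u' w j) \<in> I)"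
      by (rule insert(3)[OF W'(1)]) (rule u'c, simp_all)
    then obtain v' where v': "\<forall>w\<in>W'. v' w \<in> carrier R" "\<exists>w\<in>W'. v' w \<notin> I"
      "\<forall>j\<in>J. (\<Oplus>w\<in>W'. v' w \<otimes> u' w j) \<in> I" by blast
    define T where "T = (\<Oplus>w\<in>W'. v' w \<otimes> u w j)"
    have Tf: "(\<lambda>w. v' w \<otimes> u w j) \<in> W' \<rightarrow> carrier R" using v'(1) uc by auto
    then have T: "T \<in> carrier R" by (simp add: T_def)
    define v where "v = (\<lambda>w. if w = w0 then \<ominus> T else d \<otimes> v' w)"
    have vc: "v w \<in> carrier R" if "w \<in> W" for w using that T d v'(1) W' by (auto simp: v_def)
    have key: "(\<Oplus>w\<in>W. v w \<otimes> u w j') = (\<Oplus>w\<in>W'. v' w \<otimes> u' w j')" if j': "j' \<in> insert j J" for j'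
    proof -
      have "(\<Oplus>w\<in>W. v w \<otimes> u w j') = \<ominus> T \<otimes> u w0 j' \<oplus> (\<Oplus>w\<in>W'. v w \<otimes> u w j')"
      proof -
        have "(\<Oplus>w\<in>insert w0 W'. v w \<otimes> u w j') = v w0 \<otimes> u w0 j' \<oplus> (\<Oplus>w\<in>W'. v w \<otimes> u w j')"
          by (rule finsum_insert[OF W'(1,2)]) (use W'(3) vc uc[OF _ j'] u0[OF j'] in auto)
        then show ?thesis using W'(3) by (simp add: v_def)
      qed
      also have "\<ominus> T \<otimes> u w0 j' = T \<otimes> (\<ominus> u w0 j')" using T u0[OF j'] by (simp add: l_minus r_minus)
      also have "T \<otimes> (\<ominus> u w0 j') = (\<Oplus>w\<in>W'. (v' w \<otimes> u w j) \<otimes> (\<ominus> u w0 j'))"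
        unfolding T_def by (rule finsum_ldistr[OF W'(1) _ Tf]) (use u0[OF j'] in simp)
      also have "(\<Oplus>w\<in>W'. v w \<otimes> u w j') = (\<Oplus>w\<in>W'. v' w \<otimes> (d \<otimes> u w j'))"
        by (rule finsum_cong') (use W' d v'(1) uc[OF _ j'] in \<open>auto simp: v_def m_ac\<close>)
      also have "(\<Oplus>w\<in>W'. (v' w \<otimes> u w j) \<otimes> (\<ominus> u w0 j')) \<oplus> (\<Oplus>w\<in>W'. v' w \<otimes> (d \<otimes> u w j'))
        = (\<Oplus>w\<in>W'. (v' w \<otimes> u w j) \<otimes> (\<ominus> u w0 j') \<oplus> v' w \<otimes> (d \<otimes> u w j'))"
        by (rule finsum_addf[symmetric]) (use d v'(1) uc[OF _ j'] uc[of _ j] u0[OF j'] in auto)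
      also have "\<dots> = (\<Oplus>w\<in>W'. v' w \<otimes> u' w j')"
      proof (rule finsum_cong')
        fix w assume w: "w \<in> W'"
        then have c: "v' w \<in> carrier R" "u w j \<in> carrier R" "u w j' \<in> carrier R" "u w0 j' \<in> carrier R"
          using v'(1) uc[OF w j'] uc[OF w, of j] u0[OF j'] by auto
        then show "(v' w \<otimes> u w j) \<otimes> (\<ominus> u w0 j') \<oplus> v' w \<otimes> (d \<otimes> u w j') = v' w \<otimes> u' w j'"
          using d by (simp add: u'_def r_distr r_minus m_assoc a_comm)
      qed (use v'(1) u'c[OF _ j'] in auto)
      finally show ?thesis .
    qed
    have "(\<Oplus>w\<in>W'. v' w \<otimes> u' w j) = (\<Oplus>w\<in>W'. \<zero>)"
    proof (rule finsum_cong')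
      fix w assume w: "w \<in> W'"
      have "u' w j = \<zero>" using uc[OF w, of j] d by (simp add: u'_def d_def[symmetric] m_comm r_neg)
      then show "v' w \<otimes> u' w j = \<zero>" using v'(1) w by simp
    qed simp_all
    then have "(\<Oplus>w\<in>W. v w \<otimes> u w j) \<in> I" using key[of j] by simp
    moreover have "\<forall>j\<in>J. (\<Oplus>w\<in>W. v w \<otimes> u w j) \<in> I" using key v'(3) by simp
    moreover have "\<exists>w\<in>W. v w \<notin> I"
    proof -
      obtain w where w: "w \<in> W'" "v' w \<notin> I" using v'(2) by blast
      then have "w \<noteq> w0" "v' w \<in> carrier R" using W' v'(1) by auto
      then show ?thesis using w d W' mult_mem_iff[of d "v' w"] by (intro bexI[of _ w]) (auto simp: v_def)
    qed
    moreover have "\<forall>w\<in>W. v w \<in> carrier R" using vc by simp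
    ultimately show ?thesis by blast
  qed
qed

end

context cring
begin

lemma lowest_coeff:
  assumes P: "primeideal P R" and Q: "ideal Q R" "P \<subseteq> Q" and x: "x \<in> Q" "x \<notin> P"
  shows "(\<And>i. i \<le> M \<Longrightarrow> f i \<in> carrier R) \<Longrightarrow> (\<Oplus>i\<in>{..M::nat}. x [^] i \<otimes> f i) \<in> P \<Longrightarrow> b \<le> M
    \<Longrightarrow> (\<And>i. i < b \<Longrightarrow> f i \<in> P) \<Longrightarrow> f b \<in> Q"
proof (induct b arbitrary: f M)
  interpret P: primeideal P R by fact
  interpret Q: ideal Q R by fact
  have xc: "x \<in> carrier R" using x by (simp add: Q.Icarr)
  have step: "(\<Oplus>i\<in>{..Suc M}. x [^] i \<otimes> f i) = f 0 \<oplus> x \<otimes> (\<Oplus>i\<in>{..M}. x [^] i \<otimes> f (Suc i))"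
    and cl: "(\<Oplus>i\<in>{..M}. x [^] i \<otimes> f (Suc i)) \<in> carrier R"
    if f: "\<And>i. i \<le> Suc M \<Longrightarrow> f i \<in> carrier R" for f M
  proof -
    show "(\<Oplus>i\<in>{..M}. x [^] i \<otimes> f (Suc i)) \<in> carrier R"
      by (rule finsum_closed) (use xc f in simp)
    have "(\<Oplus>i\<in>{..Suc M}. x [^] i \<otimes> f i) = (\<Oplus>i\<in>{..M}. x [^] Suc i \<otimes> f (Suc i)) \<oplus> x [^] (0::nat) \<otimes> f 0"
      by (rule finsum_Suc2) (use xc f in auto)
    also have "(\<Oplus>i\<in>{..M}. x [^] Suc i \<otimes> f (Suc i)) = (\<Oplus>i\<in>{..M}. x \<otimes> (x [^] i \<otimes> f (Suc i)))"
      by (rule finsum_cong') (use xc f in \<open>auto simp: m_ac\<close>)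
    also have "\<dots> = x \<otimes> (\<Oplus>i\<in>{..M}. x [^] i \<otimes> f (Suc i))"
      by (rule finsum_rdistr[symmetric]) (use xc f in auto)
    finally show "(\<Oplus>i\<in>{..Suc M}. x [^] i \<otimes> f i) = f 0 \<oplus> x \<otimes> (\<Oplus>i\<in>{..M}. x [^] i \<otimes> f (Suc i))"
      using xc f[of 0] \<open>(\<Oplus>i\<in>{..M}. x [^] i \<otimes> f (Suc i)) \<in> carrier R\<close> by (simp add: a_comm)
  qed
  have addQ: "a \<in> Q" if "a \<in> carrier R" "b \<in> carrier R" "a \<oplus> x \<otimes> b \<in> Q" for a b
  proof -
    have "x \<otimes> b \<in> Q" using x that by (simp add: Q.I_r_closed)
    then have "(a \<oplus> x \<otimes> b) \<oplus> \<ominus> (x \<otimes> b) \<in> Q"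
      by (intro Q.a_closed[OF that(3)] Q.a_inv_closed)
    then show ?thesis using that xc by (simp add: a_assoc r_neg)
  qed
  {
    case 0
    note pr = 0
    have f0: "f 0 \<in> carrier R" using pr(1)[of 0] by simp
    show ?case
    proof (cases M)
      case 0
      have "(\<Oplus>i\<in>{..0::nat}. x [^] i \<otimes> f i) = x [^] (0::nat) \<otimes> f 0"
        by (rule finsum_0) (use f0 xc in simp)
      also have "\<dots> = f 0" using f0 by simp
      finally have "f 0 \<in> P" using pr(2) 0 by (simp only:)
      then show ?thesis using Q(2) by blast
    next
      case (Suc M')
      then have f: "\<And>i. i \<le> Suc M' \<Longrightarrow> f i \<in> carrier R" using pr(1) by simp
      have "(\<Oplus>i\<in>{..Suc M'}. x [^] i \<otimes> f i) = f 0 \<oplus> x \<otimes> (\<Oplus>i\<in>{..M'}. x [^] i \<otimes> f (Suc i))"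
        by (rule step) (rule f)
      with pr(2) Suc have "f 0 \<oplus> x \<otimes> (\<Oplus>i\<in>{..M'}. x [^] i \<otimes> f (Suc i)) \<in> P" by (simp only:)
      then have "f 0 \<oplus> x \<otimes> (\<Oplus>i\<in>{..M'}. x [^] i \<otimes> f (Suc i)) \<in> Q" by (rule subsetD[OF Q(2)])
      moreover have "(\<Oplus>i\<in>{..M'}. x [^] i \<otimes> f (Suc i)) \<in> carrier R" by (rule cl) (rule f)
      ultimately show ?thesis by (rule addQ[OF f0, rotated])
    qed
  next
    case (Suc b)
    then obtain M' where M: "M = Suc M'" by (cases M) auto
    let ?S = "\<Oplus>i\<in>{..M'}. x [^] i \<otimes> f (Suc i)"
    have f: "\<And>i. i \<le> Suc M' \<Longrightarrow> f i \<in> carrier R" using Suc.prems(1) M by simp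
    have S_cl: "?S \<in> carrier R" by (rule cl) (rule f)
    have "(\<Oplus>i\<in>{..Suc M'}. x [^] i \<otimes> f i) = f 0 \<oplus> x \<otimes> ?S" by (rule step) (rule f)
    with Suc.prems(2) M have "f 0 \<oplus> x \<otimes> ?S \<in> P" by (simp only:)
    moreover have "f 0 \<in> P" using Suc.prems(4)[of 0] by simp
    ultimately have "x \<otimes> ?S \<in> P"
    proof -
      assume f0: "f 0 \<in> P" and sum: "f 0 \<oplus> x \<otimes> ?S \<in> P"
      have "x \<otimes> ?S \<in> carrier R" using xc S_cl by (rule m_closed)
      moreover have "x \<otimes> ?S \<oplus> f 0 \<in> P"
        unfolding a_comm[OF \<open>x \<otimes> ?S \<in> carrier R\<close> P.Icarr[OF f0]] by (rule sum)
      ultimately show "x \<otimes> ?S \<in> P" by (rule P.add_mem_left[OF _ f0])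
    qed
    from P.I_prime[OF xc S_cl this] x(2) have S: "?S \<in> P" by blast
    show ?case
    proof (rule Suc.hyps[of M' "\<lambda>i. f (Suc i)", OF _ S])
      show "b \<le> M'" using Suc.prems(3) M by simp
      show "f (Suc i) \<in> carrier R" if "i \<le> M'" for i by (rule f) (use that in simp)
      show "f (Suc i) \<in> P" if "i < b" for i by (rule Suc.prems(4)) (use that in simp)
    qed
  }
qed

primrec mono_list :: "'a list \<Rightarrow> nat list \<Rightarrow> 'a"
  where "mono_list [] \<beta> = \<one>"
  | "mono_list (x # xs) \<beta> = x [^] hd \<beta> \<otimes> mono_list xs (tl \<beta>)"

lemma mono_list_closed: "set xs \<subseteq> carrier R \<Longrightarrow> mono_list xs \<beta> \<in> carrier R"
  by (induct xs arbitrary: \<beta>) auto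

lemma finsum_Times:
  assumes "finite A" "finite B" "\<And>a b. a \<in> A \<Longrightarrow> b \<in> B \<Longrightarrow> f a b \<in> carrier R"
  shows "(\<Oplus>p\<in>A \<times> B. case p of (a, b) \<Rightarrow> f a b) = (\<Oplus>a\<in>A. \<Oplus>b\<in>B. f a b)"
  using assms(1,3)
proof (induct A rule: finite_induct)
  case (insert a A)
  have "(\<Oplus>p\<in>insert a A \<times> B. case p of (a, b) \<Rightarrow> f a b)
    = (\<Oplus>p\<in>Pair a ` B. case p of (a, b) \<Rightarrow> f a b) \<oplus> (\<Oplus>p\<in>A \<times> B. case p of (a, b) \<Rightarrow> f a b)"
  proof -
    have "insert a A \<times> B = Pair a ` B \<union> A \<times> B" by auto
    then show ?thesis
      using insert assms(2) by (simp only:) (rule finsum_Un_disjoint; force)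
  qed
  also have "(\<Oplus>p\<in>Pair a ` B. case p of (a, b) \<Rightarrow> f a b) = (\<Oplus>b\<in>B. f a b)"
    by (subst finsum_reindex) (use insert in \<open>auto simp: inj_on_def\<close>)
  finally show ?case using insert by (subst finsum_insert) (auto intro!: finsum_closed)
qed simp

lemma finsum_exps_Suc:
  assumes "\<And>\<beta>. \<beta> \<in> exps M (Suc k) \<Longrightarrow> f \<beta> \<in> carrier R"
  shows "(\<Oplus>\<beta>\<in>exps M (Suc k). f \<beta>) = (\<Oplus>b\<in>{..M}. \<Oplus>\<beta>\<in>exps M k. f (b # \<beta>))"
proof -
  have c: "f (b # \<beta>) \<in> carrier R" if "b \<in> {..M}" "\<beta> \<in> exps M k" for b \<beta>
    by (rule assms) (use that in \<open>auto simp: exps_def\<close>)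
  have "(\<Oplus>\<beta>\<in>exps M (Suc k). f \<beta>) = (\<Oplus>p\<in>{..M} \<times> exps M k. f ((\<lambda>(b, \<beta>). b # \<beta>) p))"
    unfolding exps_Suc
  proof (rule finsum_reindex)
    show "f \<in> (\<lambda>(b, \<beta>). b # \<beta>) ` ({..M} \<times> exps M k) \<rightarrow> carrier R" using c by auto
    show "inj_on (\<lambda>(b, \<beta>). b # \<beta>) ({..M} \<times> exps M k)" by (auto intro!: inj_onI)
  qed
  also have "\<dots> = (\<Oplus>p\<in>{..M} \<times> exps M k. case p of (b, \<beta>) \<Rightarrow> f (b # \<beta>))"
  proof (rule finsum_cong')
    show "(\<lambda>p. case p of (b, \<beta>) \<Rightarrow> f (b # \<beta>)) \<in> {..M} \<times> exps M k \<rightarrow> carrier R" using c by auto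
    show "f ((\<lambda>(b, \<beta>). b # \<beta>) p) = (case p of (b, \<beta>) \<Rightarrow> f (b # \<beta>))" for p by (simp add: case_prod_unfold)
  qed simp
  also have "\<dots> = (\<Oplus>b\<in>{..M}. \<Oplus>\<beta>\<in>exps M k. f (b # \<beta>))"
    by (rule finsum_Times[OF _ finite_exps]) (simp, rule c)
  finally show ?thesis .
qed

text \<open>The Coquand--Lombardi criterion: along a chain of primes \<open>P 0, \<dots>, P k\<close> with \<open>x\<^sub>i \<in> P (i + 1) - P i\<close>,
  the lexicographically lowest coefficient of an algebraic relation between the \<open>x\<^sub>i\<close> lies in \<open>P k\<close>.\<close>

lemma prime_chain_relation:
  assumes "\<And>i. i \<le> length xs \<Longrightarrow> primeideal (P i) R"
    and "\<And>i. i < length xs \<Longrightarrow> P i \<subseteq> P (Suc i)"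
    and "\<And>i. i < length xs \<Longrightarrow> xs ! i \<in> P (Suc i) - P i"
    and "\<And>\<beta>. \<beta> \<in> exps M (length xs) \<Longrightarrow> G \<beta> \<in> carrier R \<and> (G \<beta> \<in> P 0 \<or> G \<beta> \<notin> P (length xs))"
    and "(\<Oplus>\<beta>\<in>exps M (length xs). G \<beta> \<otimes> mono_list xs \<beta>) \<in> P 0"
  shows "\<forall>\<beta>\<in>exps M (length xs). G \<beta> \<in> P 0"
  using assms
proof (induct xs arbitrary: P G)
  case Nil
  have G: "G [] \<in> carrier R" using Nil(4)[of "[]"] exps_0 by simp
  have "(\<Oplus>\<beta>\<in>{[]}. G \<beta> \<otimes> mono_list [] \<beta>) = G []" using G by simp
  then have "G [] \<in> P 0" using Nil(5) unfolding list.size(3) exps_0 by (simp only:)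
  then show ?case unfolding list.size(3) exps_0 by (simp only: ball_simps simp_thms)
next
  case (Cons x xs)
  let ?k = "length xs"
  have prime: "primeideal (P i) R" if "i \<le> Suc ?k" for i using Cons(2) that by simp
  interpret P0: primeideal "P 0" R by (rule prime) simp
  interpret P1: primeideal "P 1" R by (rule prime) simp
  have sub: "P i \<subseteq> P (Suc i)" if "i \<le> ?k" for i using Cons(3) that by simp
  have sub01: "P 0 \<subseteq> P 1" using sub[of 0] by simp
  have x: "x \<in> P 1" "x \<notin> P 0" using Cons(4)[of 0] by auto
  then have xc: "x \<in> carrier R" by (simp add: P1.Icarr)
  have xs: "set xs \<subseteq> carrier R"
  proof
    fix y assume "y \<in> set xs"
    then obtain i where i: "i < length xs" "y = xs ! i" by (auto simp: in_set_conv_nth)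
    have "xs ! i \<in> P (Suc (Suc i))" using Cons(4)[of "Suc i"] i by simp
    moreover have "primeideal (P (Suc (Suc i))) R" by (rule prime) (use i in simp)
    ultimately show "y \<in> carrier R" using i(2) by (auto simp: primeideal_def dest: ideal.Icarr)
  qed
  have mem: "b # \<beta> \<in> exps M (length (x # xs))" if "b \<le> M" "\<beta> \<in> exps M ?k" for b \<beta>
    using that by (auto simp: exps_def)
  have Gc: "G (b # \<beta>) \<in> carrier R" if "b \<le> M" "\<beta> \<in> exps M ?k" for b \<beta> using Cons(5)[OF mem[OF that]] by simp
  define F where "F = (\<lambda>b. \<Oplus>\<beta>\<in>exps M ?k. G (b # \<beta>) \<otimes> mono_list xs \<beta>)"
  have mc: "mono_list xs \<beta> \<in> carrier R" for \<beta> by (rule mono_list_closed[OF xs])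
  have mc': "mono_list (x # xs) \<beta> \<in> carrier R" for \<beta> by (rule mono_list_closed) (use xs xc in auto)
  have Fc: "F b \<in> carrier R" if "b \<le> M" for b
    unfolding F_def by (rule finsum_closed) (use Gc[OF that] mc in auto)
  have "(\<Oplus>\<beta>\<in>exps M (length (x # xs)). G \<beta> \<otimes> mono_list (x # xs) \<beta>)
    = (\<Oplus>b\<in>{..M}. \<Oplus>\<beta>\<in>exps M ?k. G (b # \<beta>) \<otimes> mono_list (x # xs) (b # \<beta>))"
    unfolding length_Cons
    by (rule finsum_exps_Suc) (use Cons(5) mc' in \<open>simp del: mono_list.simps\<close>)
  also have "\<dots> = (\<Oplus>b\<in>{..M}. x [^] b \<otimes> F b)"
  proof (rule finsum_cong')
    fix b assume b: "b \<in> {..M}"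
    have "x [^] b \<otimes> F b = (\<Oplus>\<beta>\<in>exps M ?k. x [^] b \<otimes> (G (b # \<beta>) \<otimes> mono_list xs \<beta>))"
      unfolding F_def by (rule finsum_rdistr) (use b Gc mc xc finite_exps in auto)
    also have "\<dots> = (\<Oplus>\<beta>\<in>exps M ?k. G (b # \<beta>) \<otimes> mono_list (x # xs) (b # \<beta>))"
      by (rule finsum_cong') (use b Gc mc xc in \<open>auto simp: m_lcomm\<close>)
    finally show "(\<Oplus>\<beta>\<in>exps M ?k. G (b # \<beta>) \<otimes> mono_list (x # xs) (b # \<beta>)) = x [^] b \<otimes> F b" by simp
  qed (use Fc xc in auto)
  finally have rel: "(\<Oplus>b\<in>{..M}. x [^] b \<otimes> F b) \<in> P 0" using Cons(6) by simp
  have "\<forall>\<beta>\<in>exps M ?k. G (b # \<beta>) \<in> P 0" if "b \<le> M" for b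
    using that
  proof (induct b rule: less_induct)
    case (less b)
    have "F i \<in> P 0" if "i < b" for i
      unfolding F_def by (rule P0.finsum_mem) (use less that mc in \<open>auto intro!: P0.I_r_closed\<close>)
    then have Fb: "F b \<in> P 1"
      using lowest_coeff[OF P0.primeideal P1.is_ideal sub01 x, of M F b] Fc rel less(2) by auto
    have le: "P 1 \<subseteq> P (Suc i)" if "i \<le> ?k" for i
      using that by (induct i) (use sub in \<open>auto dest: Suc_leD\<close>)
    have "\<forall>\<beta>\<in>exps M ?k. G (b # \<beta>) \<in> P (Suc 0)"
    proof (rule Cons(1)[of "\<lambda>i. P (Suc i)" "\<lambda>\<beta>. G (b # \<beta>)"])
      fix i assume "i \<le> length xs"
      then show "primeideal (P (Suc i)) R" by (intro prime) simp
    next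
      fix i assume "i < length xs"
      then show "P (Suc i) \<subseteq> P (Suc (Suc i))" by (intro sub) simp
      show "xs ! i \<in> P (Suc (Suc i)) - P (Suc i)" using Cons(4)[of "Suc i"] \<open>i < length xs\<close> by simp
    next
      fix \<beta> assume "\<beta> \<in> exps M (length xs)"
      from Cons(5)[OF mem[OF less(2) this]] sub01
      show "G (b # \<beta>) \<in> carrier R \<and> (G (b # \<beta>) \<in> P (Suc 0) \<or> G (b # \<beta>) \<notin> P (Suc (length xs)))"
        by auto
    next
      show "(\<Oplus>\<beta>\<in>exps M (length xs). G (b # \<beta>) \<otimes> mono_list xs \<beta>) \<in> P (Suc 0)"
        using Fb by (simp add: F_def)
    qed
    then have in_top: "G (b # \<beta>) \<in> P (length (x # xs))" if "\<beta> \<in> exps M ?k" for \<beta>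
      using subsetD[OF le[of ?k]] that by simp
    show ?case
    proof
      fix \<beta> assume \<beta>: "\<beta> \<in> exps M ?k"
      show "G (b # \<beta>) \<in> P 0" using Cons(5)[OF mem[OF less(2) \<beta>]] in_top[OF \<beta>] by blast
    qed
  qed
  then show ?case unfolding length_Cons exps_Suc by auto
qed

end

locale poly_over = cring +
  fixes I :: "'c set"
begin

sublocale poly: cring "Poly I"
  by (rule poly_cring)

lemma add_app: "(f \<oplus>\<^bsub>Poly I\<^esub> g) m = f m \<oplus> g m"
  by (simp add: poly_sel indexed_padd_def)

lemma zero_app: "\<zero>\<^bsub>Poly I\<^esub> m = \<zero>"
  by (simp add: poly_sel indexed_zero_def)

lemma coeff_closed: "f \<in> carrier (Poly I) \<Longrightarrow> f m \<in> carrier R"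
  by (simp add: poly_sel pset_coeff)

lemma const_mem: "k \<in> carrier R \<Longrightarrow> indexed_const k \<in> carrier (Poly I)"
  by (simp add: poly_sel indexed_pset.indexed_const)

lemma var_mem: "i \<in> I \<Longrightarrow> indexed_var i \<in> carrier (Poly I)"
  by (simp add: poly_sel var_closed)

lemma carrier_memI:
  "\<lbrakk>\<And>m. f m \<in> carrier R; finite {m. f m \<noteq> \<zero>}; \<And>m. f m \<noteq> \<zero> \<Longrightarrow> set_mset m \<subseteq> I\<rbrakk> \<Longrightarrow> f \<in> carrier (Poly I)"
  by (simp add: poly_sel psetI)

lemma finite_support: "f \<in> carrier (Poly I) \<Longrightarrow> finite {m. f m \<noteq> \<zero>}"
  by (simp add: poly_sel pset_finite)

lemma support_subset: "f \<in> carrier (Poly I) \<Longrightarrow> f m \<noteq> \<zero> \<Longrightarrow> set_mset m \<subseteq> I"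
  by (simp add: poly_sel pset_support)

lemma var_mult_app:
  assumes "f \<in> carrier (Poly I)"
  shows "(f \<otimes>\<^bsub>Poly I\<^esub> indexed_var i) m = (if i \<in># m then f (m - {#i#}) else \<zero>)"
proof -
  have "f \<otimes>\<^bsub>Poly I\<^esub> indexed_var i = indexed_pmult f i"
    using assms by (simp add: poly_sel pmult_eq_mult_var[OF pset_carrier_coeff[where I = I]])
  then show ?thesis by (simp add: indexed_pmult_def)
qed

lemma mult_const_app:
  assumes "f \<in> carrier (Poly I)" "k \<in> carrier R"
  shows "(f \<otimes>\<^bsub>Poly I\<^esub> indexed_const k) m = f m \<otimes> k"
  using assms by (simp add: poly_sel mult_const[OF pset_carrier_coeff[where I = I]])

lemma const_mult_app:
  assumes "f \<in> carrier (Poly I)" "k \<in> carrier R"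
  shows "(indexed_const k \<otimes>\<^bsub>Poly I\<^esub> f) m = k \<otimes> f m"
  using mult_const_app[OF assms] poly.m_comm[OF assms(1) const_mem[OF assms(2)]] assms coeff_closed
  by (simp add: m_comm)

lemma const_app: "indexed_const k m = (if m = {#} then k else \<zero>)"
  by (simp add: indexed_const_def)

lemma uminus_app:
  assumes "f \<in> carrier (Poly I)"
  shows "(\<ominus>\<^bsub>Poly I\<^esub> f) m = \<ominus> f m"
proof -
  have "(\<ominus>\<^bsub>Poly I\<^esub> f \<oplus>\<^bsub>Poly I\<^esub> f) m = \<zero>" using assms by (simp add: poly.l_neg zero_app)
  then have "(\<ominus>\<^bsub>Poly I\<^esub> f) m \<oplus> f m = \<zero>" by (simp add: add_app)
  then show ?thesis using assms coeff_closed poly.a_inv_closed minus_equality by metis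
qed

lemma poly_induct [consumes 1, case_names const add mult]:
  assumes "f \<in> carrier (Poly I)"
    and "\<And>k. k \<in> carrier R \<Longrightarrow> Q (indexed_const k)"
    and "\<And>f g. \<lbrakk>f \<in> carrier (Poly I); g \<in> carrier (Poly I); Q f; Q g\<rbrakk> \<Longrightarrow> Q (f \<oplus>\<^bsub>Poly I\<^esub> g)"
    and "\<And>f i. \<lbrakk>f \<in> carrier (Poly I); Q f; i \<in> I\<rbrakk> \<Longrightarrow> Q (f \<otimes>\<^bsub>Poly I\<^esub> indexed_var i)"
  shows "Q f"
proof -
  have "f \<in> indexed_pset I (carrier R)" using assms(1) by (simp add: poly_sel)
  then show ?thesis
  proof (induct rule: indexed_pset.induct)
    case (indexed_padd P P')
    then show ?case using assms(3)[of P P'] by (simp add: poly_sel)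
  next
    case (indexed_pmult P i)
    have "indexed_pmult P i = P \<otimes>\<^bsub>Poly I\<^esub> indexed_var i"
      using indexed_pmult(1) by (simp add: poly_sel pmult_eq_mult_var[OF pset_carrier_coeff[where I = I]])
    then show ?case using indexed_pmult assms(4)[of P i] by (simp add: poly_sel)
  qed (rule assms(2))
qed

lemma finsum_app:
  assumes "F \<in> A \<rightarrow> carrier (Poly I)"
  shows "finsum (Poly I) F A m = (\<Oplus>a\<in>A. F a m)"
  using assms
proof (induct A rule: infinite_finite_induct)
  case (insert a A)
  then have F: "F \<in> A \<rightarrow> carrier (Poly I)" "F a \<in> carrier (Poly I)" by auto
  have "finsum (Poly I) F (insert a A) m = F a m \<oplus> finsum (Poly I) F A m"
    by (simp only: poly.finsum_insert[OF insert(1,2) F] add_app)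
  also have "\<dots> = F a m \<oplus> (\<Oplus>a\<in>A. F a m)" using insert(3)[OF F(1)] by (rule arg_cong)
  also have "\<dots> = (\<Oplus>a\<in>insert a A. F a m)"
    by (rule finsum_insert[symmetric, OF insert(1,2)]) (use F coeff_closed in auto)
  finally show ?case .
qed (simp_all add: zero_app)

lemma const_hom: "indexed_const \<in> Ring.ring_hom R (Poly I)"
proof (rule ring_hom_memI)
  fix x y assume xy: "x \<in> carrier R" "y \<in> carrier R"
  show "indexed_const (x \<otimes> y) = indexed_const x \<otimes>\<^bsub>Poly I\<^esub> indexed_const y"
    by (rule ext) (use xy in \<open>simp add: const_mult_app[OF const_mem[OF xy(2)] xy(1)] const_app\<close>)
  show "indexed_const (x \<oplus> y) = indexed_const x \<oplus>\<^bsub>Poly I\<^esub> indexed_const y"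
    by (rule ext) (use xy in \<open>simp add: add_app const_app\<close>)
qed (simp_all add: const_mem poly_sel(3))

lemma sub_carrier: "J \<subseteq> I \<Longrightarrow> carrier (Poly J) \<subseteq> carrier (Poly I)"
  using pset_mono by (simp add: poly_sel)

lemma sub_subring:
  assumes "J \<subseteq> I"
  shows "subring (carrier (Poly J)) (Poly I)"
proof -
  interpret J: cring "Poly J" by (rule poly_cring)
  show ?thesis
  proof (rule poly.subringI)
    show "carrier (Poly J) \<subseteq> carrier (Poly I)" by (rule sub_carrier[OF assms])
    show "\<one>\<^bsub>Poly I\<^esub> \<in> carrier (Poly J)" using J.one_closed by (simp add: poly_sel)
    fix f assume f: "f \<in> carrier (Poly J)"
    have "\<ominus>\<^bsub>Poly J\<^esub> f \<oplus>\<^bsub>Poly I\<^esub> f = \<zero>\<^bsub>Poly I\<^esub>" using J.l_neg[OF f] by (simp add: poly_sel)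
    then have "\<ominus>\<^bsub>Poly I\<^esub> f = \<ominus>\<^bsub>Poly J\<^esub> f"
      using f J.a_inv_closed[OF f] sub_carrier[OF assms] by (intro poly.minus_equality) auto
    then show "\<ominus>\<^bsub>Poly I\<^esub> f \<in> carrier (Poly J)" using J.a_inv_closed[OF f] by simp
    fix g assume g: "g \<in> carrier (Poly J)"
    show "f \<otimes>\<^bsub>Poly I\<^esub> g \<in> carrier (Poly J)" using J.m_closed[OF f g] by (simp add: poly_sel)
    show "f \<oplus>\<^bsub>Poly I\<^esub> g \<in> carrier (Poly J)" using J.a_closed[OF f g] by (simp add: poly_sel)
  qed
qed

lemma eval_hom:
  assumes "cring T" and \<phi>: "\<phi> \<in> Ring.ring_hom R T" and v: "\<And>i. i \<in> I \<Longrightarrow> v i \<in> carrier T"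
  obtains h where "h \<in> Ring.ring_hom (Poly I) T"
    "\<And>k. k \<in> carrier R \<Longrightarrow> h (indexed_const k) = \<phi> k" "\<And>i. i \<in> I \<Longrightarrow> h (indexed_var i) = v i"
proof -
  interpret T: cring T by fact
  have \<phi>c: "\<phi> k \<in> carrier T" if "k \<in> carrier R" for k using ring_hom_closed[OF \<phi> that] .
  have \<phi>0: "\<phi> \<zero> = \<zero>\<^bsub>T\<^esub>" by (rule ring_hom_zero[OF \<phi> ring_axioms T.ring_axioms])
  define w where "w = (\<lambda>i. if i \<in> I then v i else \<zero>\<^bsub>T\<^esub>)"
  have w: "w i \<in> carrier T" for i using v by (simp add: w_def)
  define mon where "mon = (\<lambda>m. \<Otimes>\<^bsub>T\<^esub>i\<in>set_mset m. w i [^]\<^bsub>T\<^esub> count m i)"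
  have monc: "mon m \<in> carrier T" for m unfolding mon_def by (rule T.finprod_closed) (use w in auto)
  have mon_sup: "mon m = (\<Otimes>\<^bsub>T\<^esub>i\<in>K. w i [^]\<^bsub>T\<^esub> count m i)" if "finite K" "set_mset m \<subseteq> K" for K m
    unfolding mon_def
    by (rule T.finprod_mono_neutral_cong_left) (use that w in \<open>auto simp: not_in_iff\<close>)
  have mon_add: "mon (add_mset i m) = mon m \<otimes>\<^bsub>T\<^esub> w i" for i m
  proof -
    let ?K = "insert i (set_mset m)"
    have "mon (add_mset i m) = (\<Otimes>\<^bsub>T\<^esub>j\<in>?K. w j [^]\<^bsub>T\<^esub> count (add_mset i m) j)" by (rule mon_sup) auto
    also have "\<dots> = (\<Otimes>\<^bsub>T\<^esub>j\<in>?K. w j [^]\<^bsub>T\<^esub> count m j \<otimes>\<^bsub>T\<^esub> (if j = i then w j else \<one>\<^bsub>T\<^esub>))"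
      by (rule T.finprod_cong') (use w in auto)
    also have "\<dots> = (\<Otimes>\<^bsub>T\<^esub>j\<in>?K. w j [^]\<^bsub>T\<^esub> count m j) \<otimes>\<^bsub>T\<^esub> (\<Otimes>\<^bsub>T\<^esub>j\<in>?K. if j = i then w j else \<one>\<^bsub>T\<^esub>)"
      by (rule T.finprod_multf) (use w in auto)
    also have "(\<Otimes>\<^bsub>T\<^esub>j\<in>?K. w j [^]\<^bsub>T\<^esub> count m j) = mon m" by (rule mon_sup[symmetric]) auto
    also have "(\<Otimes>\<^bsub>T\<^esub>j\<in>?K. if j = i then w j else \<one>\<^bsub>T\<^esub>) = w i"
      by (rule T.finprod_singleton_swap) (use w in auto)
    finally show ?thesis .
  qed
  have mon_empty: "mon {#} = \<one>\<^bsub>T\<^esub>" by (simp add: mon_def)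
  define h where "h = (\<lambda>f. \<Oplus>\<^bsub>T\<^esub>m\<in>{m. f m \<noteq> \<zero>}. \<phi> (f m) \<otimes>\<^bsub>T\<^esub> mon m)"
  have hc: "h f \<in> carrier T" if "f \<in> carrier (Poly I)" for f
    unfolding h_def by (rule T.finsum_closed) (use coeff_closed[OF that] \<phi>c monc in auto)
  have h_sup: "h f = (\<Oplus>\<^bsub>T\<^esub>m\<in>K. \<phi> (f m) \<otimes>\<^bsub>T\<^esub> mon m)"
    if "f \<in> carrier (Poly I)" "finite K" "{m. f m \<noteq> \<zero>} \<subseteq> K" for f K
    unfolding h_def
    by (rule T.add.finprod_mono_neutral_cong_left) (use that coeff_closed[OF that(1)] \<phi>c \<phi>0 monc in auto)
  have h_const: "h (indexed_const k) = \<phi> k" if "k \<in> carrier R" for k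
  proof -
    have "h (indexed_const k) = (\<Oplus>\<^bsub>T\<^esub>m\<in>{{#}}. \<phi> (indexed_const k m) \<otimes>\<^bsub>T\<^esub> mon m)"
      by (rule h_sup[OF const_mem[OF that]]) (auto simp: const_app)
    then show ?thesis using \<phi>c[OF that] by (simp add: const_app mon_empty)
  qed
  have h_add: "h (f \<oplus>\<^bsub>Poly I\<^esub> g) = h f \<oplus>\<^bsub>T\<^esub> h g" if f: "f \<in> carrier (Poly I)" and g: "g \<in> carrier (Poly I)" for f g
  proof -
    let ?K = "{m. f m \<noteq> \<zero>} \<union> {m. g m \<noteq> \<zero>}"
    have K: "finite ?K" using finite_support f g by simp
    have "h (f \<oplus>\<^bsub>Poly I\<^esub> g) = (\<Oplus>\<^bsub>T\<^esub>m\<in>?K. \<phi> ((f \<oplus>\<^bsub>Poly I\<^esub> g) m) \<otimes>\<^bsub>T\<^esub> mon m)"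
      by (rule h_sup[OF poly.a_closed[OF f g] K]) (auto simp: add_app)
    also have "\<dots> = (\<Oplus>\<^bsub>T\<^esub>m\<in>?K. \<phi> (f m) \<otimes>\<^bsub>T\<^esub> mon m \<oplus>\<^bsub>T\<^esub> \<phi> (g m) \<otimes>\<^bsub>T\<^esub> mon m)"
      by (rule T.finsum_cong')
        (use coeff_closed[OF f] coeff_closed[OF g] \<phi>c monc in \<open>auto simp: add_app ring_hom_add[OF \<phi>] T.l_distr\<close>)
    also have "\<dots> = (\<Oplus>\<^bsub>T\<^esub>m\<in>?K. \<phi> (f m) \<otimes>\<^bsub>T\<^esub> mon m) \<oplus>\<^bsub>T\<^esub> (\<Oplus>\<^bsub>T\<^esub>m\<in>?K. \<phi> (g m) \<otimes>\<^bsub>T\<^esub> mon m)"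
      by (rule T.finsum_addf) (use coeff_closed[OF f] coeff_closed[OF g] \<phi>c monc in auto)
    finally show ?thesis using h_sup[OF f K] h_sup[OF g K] by simp
  qed
  have h_var: "h (f \<otimes>\<^bsub>Poly I\<^esub> indexed_var i) = h f \<otimes>\<^bsub>T\<^esub> w i" if f: "f \<in> carrier (Poly I)" and i: "i \<in> I" for f i
  proof -
    let ?S = "{m. f m \<noteq> \<zero>}" and ?g = "f \<otimes>\<^bsub>Poly I\<^esub> indexed_var i"
    have gc: "?g \<in> carrier (Poly I)" using f var_mem[OF i] by (rule poly.m_closed)
    have app: "?g (add_mset i m) = f m" for m by (simp add: var_mult_app[OF f])
    have "{m. ?g m \<noteq> \<zero>} \<subseteq> add_mset i ` ?S"
    proof
      fix m assume "m \<in> {m. ?g m \<noteq> \<zero>}"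
      then have "i \<in># m" "f (m - {#i#}) \<noteq> \<zero>" by (auto simp: var_mult_app[OF f] split: if_splits)
      then have "m = add_mset i (m - {#i#})" "m - {#i#} \<in> ?S" by auto
      then show "m \<in> add_mset i ` ?S" by (rule image_eqI)
    qed
    then have "h ?g = (\<Oplus>\<^bsub>T\<^esub>m\<in>add_mset i ` ?S. \<phi> (?g m) \<otimes>\<^bsub>T\<^esub> mon m)"
      by (intro h_sup[OF gc]) (use finite_support[OF f] in auto)
    also have "\<dots> = (\<Oplus>\<^bsub>T\<^esub>m\<in>?S. \<phi> (?g (add_mset i m)) \<otimes>\<^bsub>T\<^esub> mon (add_mset i m))"
      by (rule T.finsum_reindex) (use coeff_closed[OF gc] \<phi>c monc in \<open>auto simp: inj_on_def\<close>)
    also have "\<dots> = (\<Oplus>\<^bsub>T\<^esub>m\<in>?S. (\<phi> (f m) \<otimes>\<^bsub>T\<^esub> mon m) \<otimes>\<^bsub>T\<^esub> w i)"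
      by (rule T.finsum_cong')
        (use coeff_closed[OF f] \<phi>c monc w in \<open>auto simp: app mon_add T.m_assoc\<close>)
    also have "\<dots> = h f \<otimes>\<^bsub>T\<^esub> w i" unfolding h_def
      by (rule T.finsum_ldistr[symmetric]) (use finite_support[OF f] coeff_closed[OF f] \<phi>c monc w in auto)
    finally show ?thesis .
  qed
  have one: "h \<one>\<^bsub>Poly I\<^esub> = \<one>\<^bsub>T\<^esub>" using h_const[of \<one>] ring_hom_one[OF \<phi>] by (simp add: poly_sel(3))
  have h_mult: "h (f \<otimes>\<^bsub>Poly I\<^esub> g) = h f \<otimes>\<^bsub>T\<^esub> h g" if f: "f \<in> carrier (Poly I)" and g: "g \<in> carrier (Poly I)" for f g
    using g
  proof (induct g rule: poly_induct)
    case (const k)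
    have fk: "f \<otimes>\<^bsub>Poly I\<^esub> indexed_const k \<in> carrier (Poly I)" by (rule poly.m_closed[OF f const_mem[OF const]])
    have "h (f \<otimes>\<^bsub>Poly I\<^esub> indexed_const k)
      = (\<Oplus>\<^bsub>T\<^esub>m\<in>{m. f m \<noteq> \<zero>}. \<phi> ((f \<otimes>\<^bsub>Poly I\<^esub> indexed_const k) m) \<otimes>\<^bsub>T\<^esub> mon m)"
      by (rule h_sup[OF fk finite_support[OF f]]) (use const in \<open>auto simp: mult_const_app[OF f const]\<close>)
    also have "\<dots> = (\<Oplus>\<^bsub>T\<^esub>m\<in>{m. f m \<noteq> \<zero>}. (\<phi> (f m) \<otimes>\<^bsub>T\<^esub> mon m) \<otimes>\<^bsub>T\<^esub> \<phi> k)"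
      by (rule T.finsum_cong')
        (use coeff_closed[OF f] const \<phi>c monc in \<open>auto simp: mult_const_app[OF f const] ring_hom_mult[OF \<phi>] T.m_ac\<close>)
    also have "\<dots> = h f \<otimes>\<^bsub>T\<^esub> \<phi> k" unfolding h_def
      by (rule T.finsum_ldistr[symmetric]) (use finite_support[OF f] coeff_closed[OF f] const \<phi>c monc in auto)
    finally show ?case by (simp add: h_const[OF const])
  next
    case (add g g')
    then show ?case using f
      by (simp add: poly.r_distr h_add hc T.r_distr)
  next
    case (mult g i)
    have "f \<otimes>\<^bsub>Poly I\<^esub> (g \<otimes>\<^bsub>Poly I\<^esub> indexed_var i) = (f \<otimes>\<^bsub>Poly I\<^esub> g) \<otimes>\<^bsub>Poly I\<^esub> indexed_var i"
      by (rule poly.m_assoc[symmetric, OF f mult(1) var_mem[OF mult(3)]])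
    then show ?case
      by (simp only: h_var[OF poly.m_closed[OF f mult(1)] mult(3)] h_var[OF mult(1,3)] mult(2)
          T.m_assoc[OF hc[OF f] hc[OF mult(1)] w])
  qed
  have h_v: "h (indexed_var i) = v i" if "i \<in> I" for i
  proof -
    have "h (\<one>\<^bsub>Poly I\<^esub> \<otimes>\<^bsub>Poly I\<^esub> indexed_var i) = w i"
      using h_var[OF poly.one_closed that] one w by simp
    then show ?thesis using var_mem[OF that] that by (simp add: w_def)
  qed
  have "h \<in> Ring.ring_hom (Poly I) T"
    by (rule ring_hom_memI) (simp_all add: hc h_mult h_add one)
  then show ?thesis by (rule that) (use h_const h_v in auto)
qed

end

lemma (in ring) add_minus_cancel_left:
  assumes "x \<in> carrier R" "y \<in> carrier R"
  shows "(x \<oplus> y) \<oplus> \<ominus> x = y"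
  using assms by (simp add: a_comm[of x y] a_assoc r_neg)

context poly_over
begin

text \<open>The coefficient of the monomial \<open>m\<close>, for polynomials in the indeterminates of \<open>C\<close> over
  the polynomial ring in the other indeterminates.\<close>

definition coeff_at :: "'c set \<Rightarrow> 'c multiset \<Rightarrow> ('c multiset \<Rightarrow> 'a) \<Rightarrow> ('c multiset \<Rightarrow> 'a)"
  where "coeff_at C m f = (\<lambda>n. if set_mset n \<inter> C = {} then f (n + m) else \<zero>)"

lemma coeff_at_app: "coeff_at C m f n = (if set_mset n \<inter> C = {} then f (n + m) else \<zero>)"
  by (simp add: coeff_at_def)

lemma coeff_at_mem:
  assumes f: "f \<in> carrier (Poly I)"
  shows "coeff_at C m f \<in> carrier (Poly (I - C))"
proof -
  interpret J: poly_over R "I - C" ..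
  have "finite ((\<lambda>n. n + m) -` {n. f n \<noteq> \<zero>})"
    by (rule finite_vimageI[OF finite_support[OF f]]) (simp add: inj_def)
  then have fin: "finite {n. f (n + m) \<noteq> \<zero>}" by (simp add: vimage_def)
  show ?thesis
  proof (rule J.carrier_memI)
    show "coeff_at C m f n \<in> carrier R" for n using coeff_closed[OF f] by (simp add: coeff_at_app)
    show "finite {n. coeff_at C m f n \<noteq> \<zero>}"
      by (rule finite_subset[OF _ fin]) (auto simp: coeff_at_app)
    fix n assume "coeff_at C m f n \<noteq> \<zero>"
    then have "set_mset n \<inter> C = {}" "f (n + m) \<noteq> \<zero>" by (auto simp: coeff_at_app split: if_splits)
    then show "set_mset n \<subseteq> I - C" using support_subset[OF f, of "n + m"] by auto
  qed
qed

lemma coeff_at_closed: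
  assumes "f \<in> carrier (Poly I)"
  shows "coeff_at C m f \<in> carrier (Poly I)"
  using coeff_at_mem[OF assms] sub_carrier[of "I - C"] by blast

lemma coeff_at_add: "coeff_at C m (f \<oplus>\<^bsub>Poly I\<^esub> g) = coeff_at C m f \<oplus>\<^bsub>Poly I\<^esub> coeff_at C m g"
  by (rule ext) (simp add: coeff_at_app add_app)

lemma coeff_at_zero: "coeff_at C m \<zero>\<^bsub>Poly I\<^esub> = \<zero>\<^bsub>Poly I\<^esub>"
  by (rule ext) (simp add: coeff_at_app zero_app)

lemma coeff_at_uminus:
  assumes "f \<in> carrier (Poly I)"
  shows "coeff_at C m (\<ominus>\<^bsub>Poly I\<^esub> f) = \<ominus>\<^bsub>Poly I\<^esub> coeff_at C m f"
  by (rule ext) (simp add: uminus_app[OF coeff_at_closed[OF assms]], simp add: coeff_at_app uminus_app[OF assms])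

lemma coeff_at_var_notin:
  assumes f: "f \<in> carrier (Poly I)" and "set_mset m \<subseteq> C" "y \<notin> C"
  shows "coeff_at C m (f \<otimes>\<^bsub>Poly I\<^esub> indexed_var y) = coeff_at C m f \<otimes>\<^bsub>Poly I\<^esub> indexed_var y"
proof (rule ext)
  fix n
  have y: "y \<notin># m" using assms by auto
  have "n + m - {#y#} = n - {#y#} + m" if "y \<in># n" using that by simp
  moreover have "set_mset (n - {#y#}) \<inter> C = {} \<longleftrightarrow> set_mset n \<inter> C = {}" if "y \<in># n"
    using that assms(3) by (metis Int_insert_left_if0 insert_DiffM set_mset_add_mset_insert)
  ultimately show "coeff_at C m (f \<otimes>\<^bsub>Poly I\<^esub> indexed_var y) n = (coeff_at C m f \<otimes>\<^bsub>Poly I\<^esub> indexed_var y) n"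
    using y by (simp add: var_mult_app[OF coeff_at_closed[OF f]] coeff_at_app var_mult_app[OF f])
qed

lemma coeff_at_var_in:
  assumes f: "f \<in> carrier (Poly I)" and "y \<in> C"
  shows "coeff_at C m (f \<otimes>\<^bsub>Poly I\<^esub> indexed_var y)
    = (if y \<in># m then coeff_at C (m - {#y#}) f else \<zero>\<^bsub>Poly I\<^esub>)"
proof (rule ext)
  fix n
  have "n + m - {#y#} = n + (m - {#y#})" if "y \<in># m" using that by simp
  moreover have "y \<notin># n" if "set_mset n \<inter> C = {}" using that assms by auto
  ultimately show "coeff_at C m (f \<otimes>\<^bsub>Poly I\<^esub> indexed_var y) n
      = (if y \<in># m then coeff_at C (m - {#y#}) f else \<zero>\<^bsub>Poly I\<^esub>) n"
    by (auto simp: coeff_at_app var_mult_app[OF f] zero_app)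
qed

lemma coeff_at_free:
  assumes f: "f \<in> carrier (Poly (I - C))" and m: "set_mset m \<subseteq> C"
  shows "coeff_at C m f = (if m = {#} then f else \<zero>\<^bsub>Poly I\<^esub>)"
proof (rule ext)
  interpret J: poly_over R "I - C" ..
  fix n
  have *: "f k = \<zero>" if "x \<in># k" "x \<in> C" for k x using J.support_subset[OF f, of k] that by blast
  show "coeff_at C m f n = (if m = {#} then f else \<zero>\<^bsub>Poly I\<^esub>) n"
  proof (cases "m = {#}")
    case True
    then show ?thesis using * by (auto simp: coeff_at_app)
  next
    case False
    then obtain x where "x \<in># m" by blast
    then have "f (n + m) = \<zero>" using m by (intro *[of x]) auto
    then show ?thesis using False by (simp add: coeff_at_app zero_app)
  qed
qed

lemma coeff_at_mult_free:
  assumes G: "G \<in> carrier (Poly (I - C))" and f: "f \<in> carrier (Poly I)" and m: "set_mset m \<subseteq> C"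
  shows "coeff_at C m (f \<otimes>\<^bsub>Poly I\<^esub> G) = coeff_at C m f \<otimes>\<^bsub>Poly I\<^esub> G"
proof -
  interpret J: poly_over R "I - C" ..
  have sub: "x \<in> carrier (Poly (I - C)) \<Longrightarrow> x \<in> carrier (Poly I)" for x using sub_carrier[of "I - C"] by blast
  note cf = coeff_at_closed[OF f]
  from G show ?thesis
  proof (induct G rule: J.poly_induct)
    case (const k)
    show ?case
      by (rule ext) (simp add: mult_const_app[OF cf const], simp add: coeff_at_app mult_const_app[OF f const] const)
  next
    case (add g g')
    have "g \<oplus>\<^bsub>Poly (I - C)\<^esub> g' = g \<oplus>\<^bsub>Poly I\<^esub> g'" by (simp add: poly_sel)
    then show ?case using add(3,4) by (simp add: poly.r_distr[OF sub[OF add(1)] sub[OF add(2)]] f cf coeff_at_add)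
  next
    case (mult g y)
    have y: "y \<in> I" "y \<notin> C" using mult(3) by auto
    note gI = sub[OF mult(1)]
    have "g \<otimes>\<^bsub>Poly (I - C)\<^esub> indexed_var y = g \<otimes>\<^bsub>Poly I\<^esub> indexed_var y" by (simp add: poly_sel)
    moreover have "coeff_at C m (f \<otimes>\<^bsub>Poly I\<^esub> (g \<otimes>\<^bsub>Poly I\<^esub> indexed_var y))
      = coeff_at C m f \<otimes>\<^bsub>Poly I\<^esub> (g \<otimes>\<^bsub>Poly I\<^esub> indexed_var y)"
      unfolding poly.m_assoc[OF f gI var_mem[OF y(1)], symmetric] poly.m_assoc[OF cf gI var_mem[OF y(1)], symmetric]
        coeff_at_var_notin[OF poly.m_closed[OF f gI] m y(2)] mult(2) ..
    ultimately show ?case by (simp only:)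
  qed
qed

abbreviation xcoeff :: "'c \<Rightarrow> nat \<Rightarrow> ('c multiset \<Rightarrow> 'a) \<Rightarrow> ('c multiset \<Rightarrow> 'a)"
  where "xcoeff x k \<equiv> coeff_at {x} (replicate_mset k x)"

lemma set_replicate_mset_subset': "set_mset (replicate_mset k x) \<subseteq> {x}"
  by (simp add: set_mset_replicate_mset_subset)

lemma xcoeff_var_same:
  assumes "f \<in> carrier (Poly I)"
  shows "xcoeff x 0 (f \<otimes>\<^bsub>Poly I\<^esub> indexed_var x) = \<zero>\<^bsub>Poly I\<^esub>"
    and "xcoeff x (Suc k) (f \<otimes>\<^bsub>Poly I\<^esub> indexed_var x) = xcoeff x k f"
  by (simp_all add: coeff_at_var_in[OF assms])

lemma xcoeff_0_mult:
  assumes f: "f \<in> carrier (Poly I)" and g: "g \<in> carrier (Poly I)"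
  shows "xcoeff x 0 (f \<otimes>\<^bsub>Poly I\<^esub> g) = xcoeff x 0 f \<otimes>\<^bsub>Poly I\<^esub> xcoeff x 0 g"
  using g
proof (induct g rule: poly_induct)
  note cf = coeff_at_closed[OF f]
  {
    case (const k)
    interpret J: poly_over R "I - {x}" ..
    have k: "indexed_const k \<in> carrier (Poly (I - {x}))" by (rule J.const_mem[OF const])
    show ?case unfolding coeff_at_mult_free[OF k f set_replicate_mset_subset'] coeff_at_free[OF k set_replicate_mset_subset'] by simp
  next
    case (add g g')
    then show ?case by (simp add: coeff_at_add poly.r_distr f coeff_at_closed)
  next
    case (mult g y)
    note yc = var_mem[OF mult(3)]
    have eq: "f \<otimes>\<^bsub>Poly I\<^esub> (g \<otimes>\<^bsub>Poly I\<^esub> indexed_var y) = (f \<otimes>\<^bsub>Poly I\<^esub> g) \<otimes>\<^bsub>Poly I\<^esub> indexed_var y"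
      by (rule poly.m_assoc[symmetric, OF f mult(1) yc])
    note fg = poly.m_closed[OF f mult(1)]
    show ?case
    proof (cases "y = x")
      case True
      show ?thesis unfolding True eq[unfolded True] xcoeff_var_same(1)[OF fg] xcoeff_var_same(1)[OF mult(1)] using cf by simp
    next
      case False
      then have y: "y \<notin> {x}" by simp
      show ?thesis
        unfolding eq coeff_at_var_notin[OF fg set_replicate_mset_subset' y]
          coeff_at_var_notin[OF mult(1) set_replicate_mset_subset' y] mult(2)
        by (rule poly.m_assoc[OF cf coeff_at_closed[OF mult(1)] yc])
    qed
  }
qed

definition shift :: "'c \<Rightarrow> ('c multiset \<Rightarrow> 'a) \<Rightarrow> ('c multiset \<Rightarrow> 'a)"
  where "shift x f = (\<lambda>m. f (add_mset x m))"

lemma shift_app: "shift x f m = f (add_mset x m)"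
  by (simp add: shift_def)

lemma shift_closed:
  assumes f: "f \<in> carrier (Poly I)"
  shows "shift x f \<in> carrier (Poly I)"
proof (rule carrier_memI)
  have "finite (add_mset x -` {n. f n \<noteq> \<zero>})"
    by (rule finite_vimageI[OF finite_support[OF f]]) (simp add: inj_def)
  then show "finite {m. shift x f m \<noteq> \<zero>}" by (simp add: vimage_def shift_app)
  show "shift x f m \<in> carrier R" for m using coeff_closed[OF f] by (simp add: shift_app)
  show "set_mset m \<subseteq> I" if "shift x f m \<noteq> \<zero>" for m
    using support_subset[OF f, of "add_mset x m"] that by (simp add: shift_app)
qed

lemma xcoeff_shift: "xcoeff x k (shift x f) = xcoeff x (Suc k) f"
  by (rule ext) (simp add: coeff_at_app shift_app)

lemma shift_decomp:
  assumes f: "f \<in> carrier (Poly I)"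
  shows "f = xcoeff x 0 f \<oplus>\<^bsub>Poly I\<^esub> shift x f \<otimes>\<^bsub>Poly I\<^esub> indexed_var x"
proof (rule ext)
  fix m
  show "f m = (xcoeff x 0 f \<oplus>\<^bsub>Poly I\<^esub> shift x f \<otimes>\<^bsub>Poly I\<^esub> indexed_var x) m"
    using coeff_closed[OF f, of m]
    by (cases "x \<in># m") (simp_all add: add_app var_mult_app[OF shift_closed[OF f]] coeff_at_app shift_app)
qed

text \<open>The extension to the whole ring of the contraction of \<open>P\<close> to the polynomials free of \<open>x\<close>.\<close>

definition free_part :: "'c \<Rightarrow> ('c multiset \<Rightarrow> 'a) set \<Rightarrow> ('c multiset \<Rightarrow> 'a) set"
  where "free_part x P = {f \<in> carrier (Poly I). \<forall>k. xcoeff x k f \<in> P}"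

context
  fixes P x
  assumes P: "primeideal P (Poly I)" and x: "x \<in> I"
begin

interpretation P: primeideal P "Poly I" by (rule P)

lemma free_part_var: "f \<in> free_part x P \<Longrightarrow> y \<in> I \<Longrightarrow> f \<otimes>\<^bsub>Poly I\<^esub> indexed_var y \<in> free_part x P"
proof -
  assume f: "f \<in> free_part x P" and y: "y \<in> I"
  then have fc: "f \<in> carrier (Poly I)" and fP: "xcoeff x k f \<in> P" for k by (auto simp: free_part_def)
  have "xcoeff x k (f \<otimes>\<^bsub>Poly I\<^esub> indexed_var y) \<in> P" for k
  proof (cases "y = x")
    case True
    show ?thesis
    proof (cases k)
      case 0
      show ?thesis unfolding 0 True xcoeff_var_same(1)[OF fc] by simp
    next
      case (Suc k')
      show ?thesis unfolding Suc True xcoeff_var_same(2)[OF fc] by (rule fP)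
    qed
  next
    case False
    then have yx: "y \<notin> {x}" by simp
    show ?thesis unfolding coeff_at_var_notin[OF fc set_replicate_mset_subset' yx]
      by (rule P.I_r_closed[OF fP var_mem[OF y]])
  qed
  then show ?thesis using poly.m_closed[OF fc var_mem[OF y]] by (simp add: free_part_def)
qed

lemma free_part_mult: "f \<in> free_part x P \<Longrightarrow> g \<in> carrier (Poly I) \<Longrightarrow> f \<otimes>\<^bsub>Poly I\<^esub> g \<in> free_part x P"
proof -
  assume f: "f \<in> free_part x P" and g: "g \<in> carrier (Poly I)"
  then have fc: "f \<in> carrier (Poly I)" and fP: "xcoeff x k f \<in> P" for k by (auto simp: free_part_def)
  from g show ?thesis
  proof (induct g rule: poly_induct)
    case (const k)
    interpret J: poly_over R "I - {x}" ..
    have k: "indexed_const k \<in> carrier (Poly (I - {x}))" by (rule J.const_mem[OF const])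
    have "xcoeff x j (f \<otimes>\<^bsub>Poly I\<^esub> indexed_const k) \<in> P" for j
      unfolding coeff_at_mult_free[OF k fc set_replicate_mset_subset']
      by (rule P.I_r_closed[OF fP const_mem[OF const]])
    then show ?case using poly.m_closed[OF fc const_mem[OF const]] by (simp add: free_part_def)
  next
    case (add g g')
    have "f \<otimes>\<^bsub>Poly I\<^esub> (g \<oplus>\<^bsub>Poly I\<^esub> g') = f \<otimes>\<^bsub>Poly I\<^esub> g \<oplus>\<^bsub>Poly I\<^esub> f \<otimes>\<^bsub>Poly I\<^esub> g'"
      by (rule poly.r_distr[OF add(1,2) fc])
    then show ?case using add fc by (simp add: free_part_def coeff_at_add P.a_closed)
  next
    case (mult g y)
    have eq: "f \<otimes>\<^bsub>Poly I\<^esub> (g \<otimes>\<^bsub>Poly I\<^esub> indexed_var y) = (f \<otimes>\<^bsub>Poly I\<^esub> g) \<otimes>\<^bsub>Poly I\<^esub> indexed_var y"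
      by (rule poly.m_assoc[symmetric, OF fc mult(1) var_mem[OF mult(3)]])
    show ?case unfolding eq by (rule free_part_var[OF mult(2,3)])
  qed
qed

lemma free_part_ideal: "ideal (free_part x P) (Poly I)"
proof (rule idealI[OF poly.ring_axioms])
  show "subgroup (free_part x P) (add_monoid (Poly I))"
  proof (rule poly.add.subgroupI)
    show "free_part x P \<subseteq> carrier (Poly I)" by (auto simp: free_part_def)
    have "\<zero>\<^bsub>Poly I\<^esub> \<in> free_part x P" by (simp add: free_part_def coeff_at_zero)
    then show "free_part x P \<noteq> {}" by blast
    fix f assume f: "f \<in> free_part x P"
    then show "\<ominus>\<^bsub>Poly I\<^esub> f \<in> free_part x P" by (auto simp: free_part_def coeff_at_uminus)
    fix g assume "g \<in> free_part x P"
    with f show "f \<oplus>\<^bsub>Poly I\<^esub> g \<in> free_part x P" by (auto simp: free_part_def coeff_at_add P.a_closed)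
  qed
  fix f g assume f: "f \<in> free_part x P" and g: "g \<in> carrier (Poly I)"
  then show "f \<otimes>\<^bsub>Poly I\<^esub> g \<in> free_part x P" by (rule free_part_mult)
  then show "g \<otimes>\<^bsub>Poly I\<^esub> f \<in> free_part x P" using f g by (subst poly.m_comm) (auto simp: free_part_def)
qed

lemma free_part_mem_free:
  assumes "f \<in> carrier (Poly (I - {x}))" "f \<in> P"
  shows "f \<in> free_part x P"
  using assms sub_carrier[of "I - {x}"]
  by (auto simp: free_part_def coeff_at_free[OF assms(1) set_replicate_mset_subset'])

lemma free_part_shift: "f \<in> carrier (Poly I) \<Longrightarrow> f \<otimes>\<^bsub>Poly I\<^esub> indexed_var x \<in> free_part x P \<Longrightarrow> f \<in> free_part x P"
proof -
  assume fc: "f \<in> carrier (Poly I)" and f: "f \<otimes>\<^bsub>Poly I\<^esub> indexed_var x \<in> free_part x P"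
  have "xcoeff x k f \<in> P" for k
    using f unfolding free_part_def xcoeff_var_same(2)[OF fc, where k = k and x = x, symmetric] by blast
  then show ?thesis using fc by (simp add: free_part_def)
qed

lemma free_part_subset: "free_part x P \<subseteq> P"
proof -
  have "f \<in> P" if "f \<in> free_part x P" "\<forall>m. f m \<noteq> \<zero> \<longrightarrow> count m x < n" for f n
    using that
  proof (induct n arbitrary: f)
    case 0
    then have "f = \<zero>\<^bsub>Poly I\<^esub>" by (intro ext) (simp add: zero_app)
    then show ?case by simp
  next
    case (Suc n)
    have fc: "f \<in> carrier (Poly I)" and fP: "xcoeff x k f \<in> P" for k
      using Suc(2) unfolding free_part_def by blast+
    have "xcoeff x k (shift x f) \<in> P" for k unfolding xcoeff_shift by (rule fP)
    then have "shift x f \<in> free_part x P" using shift_closed[OF fc] by (simp add: free_part_def)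
    moreover have "\<forall>m. shift x f m \<noteq> \<zero> \<longrightarrow> count m x < n"
    proof (intro allI impI)
      fix m assume "shift x f m \<noteq> \<zero>"
      then have "count (add_mset x m) x < Suc n" using Suc(3) by (simp add: shift_app del: count_add_mset)
      then show "count m x < n" by simp
    qed
    ultimately have "shift x f \<in> P" by (rule Suc(1))
    then have "xcoeff x 0 f \<oplus>\<^bsub>Poly I\<^esub> shift x f \<otimes>\<^bsub>Poly I\<^esub> indexed_var x \<in> P"
      by (rule P.a_closed[OF fP P.I_r_closed[OF _ var_mem[OF x]]])
    then show ?case using shift_decomp[OF fc, of x] by (simp only:)
  qed
  moreover have "\<exists>n. \<forall>m. f m \<noteq> \<zero> \<longrightarrow> count m x < n" if "f \<in> free_part x P" for f
  proof -
    have "finite ((\<lambda>m. count m x) ` {m. f m \<noteq> \<zero>})" using that finite_support by (simp add: free_part_def)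
    then obtain n where "\<forall>k\<in>(\<lambda>m. count m x) ` {m. f m \<noteq> \<zero>}. k < n" by (auto simp: finite_nat_set_iff_bounded)
    then show ?thesis by blast
  qed
  ultimately show ?thesis by blast
qed

lemma free_part_not_mult:
  assumes "f \<in> carrier (Poly I)" "g \<in> carrier (Poly I)" "xcoeff x i f \<notin> P" "xcoeff x j g \<notin> P"
  shows "f \<otimes>\<^bsub>Poly I\<^esub> g \<notin> free_part x P"
  using assms
proof (induct "i + j" arbitrary: f g i j rule: less_induct)
  case less
  interpret F: ideal "free_part x P" "Poly I" by (rule free_part_ideal)
  have step: "shift x f \<otimes>\<^bsub>Poly I\<^esub> g \<in> free_part x P"
    if fg: "f \<in> carrier (Poly I)" "g \<in> carrier (Poly I)" and fgE: "f \<otimes>\<^bsub>Poly I\<^esub> g \<in> free_part x P"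
      and c: "xcoeff x 0 f \<in> P" for f g
  proof -
    let ?c = "xcoeff x 0 f" and ?s = "shift x f"
    have cc: "?c \<in> carrier (Poly I)" and sc: "?s \<in> carrier (Poly I)" using fg coeff_at_closed shift_closed by auto
    note xc = var_mem[OF x]
    have sxc: "?s \<otimes>\<^bsub>Poly I\<^esub> indexed_var x \<in> carrier (Poly I)" by (rule poly.m_closed[OF sc xc])
    have "?c \<in> free_part x P" by (rule free_part_mem_free[OF coeff_at_mem[OF fg(1)] c])
    then have cg: "?c \<otimes>\<^bsub>Poly I\<^esub> g \<in> free_part x P" using fg(2) by (rule free_part_mult)
    have "f \<otimes>\<^bsub>Poly I\<^esub> g = (?c \<oplus>\<^bsub>Poly I\<^esub> ?s \<otimes>\<^bsub>Poly I\<^esub> indexed_var x) \<otimes>\<^bsub>Poly I\<^esub> g"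
      using shift_decomp[OF fg(1), of x] by (rule arg_cong)
    also have "\<dots> = ?c \<otimes>\<^bsub>Poly I\<^esub> g \<oplus>\<^bsub>Poly I\<^esub> (?s \<otimes>\<^bsub>Poly I\<^esub> g) \<otimes>\<^bsub>Poly I\<^esub> indexed_var x"
      unfolding poly.l_distr[OF cc sxc fg(2)] poly.m_assoc[OF sc xc fg(2)] poly.m_assoc[OF sc fg(2) xc]
        poly.m_comm[OF xc fg(2)] ..
    finally have "f \<otimes>\<^bsub>Poly I\<^esub> g \<oplus>\<^bsub>Poly I\<^esub> \<ominus>\<^bsub>Poly I\<^esub> (?c \<otimes>\<^bsub>Poly I\<^esub> g) = (?s \<otimes>\<^bsub>Poly I\<^esub> g) \<otimes>\<^bsub>Poly I\<^esub> indexed_var x"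
      using poly.add_minus_cancel_left[OF poly.m_closed[OF cc fg(2)] poly.m_closed[OF poly.m_closed[OF sc fg(2)] xc]]
      by (simp only:)
    moreover have "f \<otimes>\<^bsub>Poly I\<^esub> g \<oplus>\<^bsub>Poly I\<^esub> \<ominus>\<^bsub>Poly I\<^esub> (?c \<otimes>\<^bsub>Poly I\<^esub> g) \<in> free_part x P"
      by (rule F.a_closed[OF fgE F.a_inv_closed[OF cg]])
    ultimately have "(?s \<otimes>\<^bsub>Poly I\<^esub> g) \<otimes>\<^bsub>Poly I\<^esub> indexed_var x \<in> free_part x P" by (simp only:)
    then show ?thesis by (rule free_part_shift[OF poly.m_closed[OF sc fg(2)]])
  qed
  show ?case
  proof
    assume E: "f \<otimes>\<^bsub>Poly I\<^esub> g \<in> free_part x P"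
    have gf: "g \<otimes>\<^bsub>Poly I\<^esub> f \<in> free_part x P" using E unfolding poly.m_comm[OF less(2,3)] .
    consider (f) "xcoeff x 0 f \<in> P" | (g) "xcoeff x 0 g \<in> P" | (n) "xcoeff x 0 f \<notin> P" "xcoeff x 0 g \<notin> P" by blast
    then show False
    proof cases
      case f
      then obtain i' where i: "i = Suc i'" using less(4) by (cases i) auto
      have "shift x f \<otimes>\<^bsub>Poly I\<^esub> g \<notin> free_part x P"
        by (rule less(1)[of i' j]) (use less(2-5) i shift_closed in \<open>simp_all add: xcoeff_shift\<close>)
      then show False using step[OF less(2,3) E f] by blast
    next
      case g
      then obtain j' where j: "j = Suc j'" using less(5) by (cases j) auto
      have "f \<otimes>\<^bsub>Poly I\<^esub> shift x g \<notin> free_part x P"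
        by (rule less(1)[of i j']) (use less(2-5) j shift_closed in \<open>simp_all add: xcoeff_shift\<close>)
      then show False using step[OF less(3,2) gf g] unfolding poly.m_comm[OF less(2) shift_closed[OF less(3)]] by blast
    next
      case n
      have "xcoeff x 0 (f \<otimes>\<^bsub>Poly I\<^esub> g) \<in> P" using E unfolding free_part_def by blast
      then show False using n P.I_prime[OF coeff_at_closed[OF less(2)] coeff_at_closed[OF less(3)]]
        unfolding xcoeff_0_mult[OF less(2,3)] by blast
    qed
  qed
qed

lemma free_part_prime: "primeideal (free_part x P) (Poly I)"
proof (rule primeidealI[OF free_part_ideal poly.is_cring])
  have "\<one>\<^bsub>Poly I\<^esub> \<notin> free_part x P" using free_part_subset P.one_notin by blast
  then show "carrier (Poly I) \<noteq> free_part x P" by blast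
  fix f g assume fg: "f \<in> carrier (Poly I)" "g \<in> carrier (Poly I)" "f \<otimes>\<^bsub>Poly I\<^esub> g \<in> free_part x P"
  show "f \<in> free_part x P \<or> g \<in> free_part x P"
  proof (rule ccontr)
    assume "\<not> ?thesis"
    then obtain i j where "xcoeff x i f \<notin> P" "xcoeff x j g \<notin> P" using fg(1,2) unfolding free_part_def by blast
    from free_part_not_mult[OF fg(1,2) this] fg(3) show False by blast
  qed
qed

end

text \<open>If modulo \<open>P\<close> every indeterminate in \<open>C\<close> is a fraction of polynomials free of \<open>C\<close>, then
  removing these indeterminates one at a time gives a chain of primes below \<open>P\<close>.\<close>

lemma prime_chain_below:
  assumes "finite C" "C \<subseteq> I" "primeideal P (Poly I)"
    and "\<Delta> \<in> carrier (Poly (I - C))" "\<Delta> \<notin> P"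
    and "\<And>c. c \<in> C \<Longrightarrow> \<exists>g\<in>carrier (Poly (I - C)). \<Delta> \<otimes>\<^bsub>Poly I\<^esub> indexed_var c \<oplus>\<^bsub>Poly I\<^esub> g \<in> P"
  shows "\<exists>Q. (\<forall>i\<le>card C. primeideal (Q i) (Poly I) \<and> Q i \<subseteq> P) \<and> (\<forall>i<card C. Q i \<subset> Q (Suc i))"
  using assms
proof (induct C arbitrary: P rule: finite_induct)
  case empty
  then show ?case by (intro exI[of _ "\<lambda>_. P"]) simp
next
  case (insert c C)
  interpret P: primeideal P "Poly I" by (rule insert(5))
  have c: "c \<in> I" using insert by simp
  have sub: "carrier (Poly (I - insert c C)) \<subseteq> carrier (Poly (I - {c}))"
    "carrier (Poly (I - insert c C)) \<subseteq> carrier (Poly (I - C))"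
    "carrier (Poly (I - insert c C)) \<subseteq> carrier (Poly I)"
    by (simp_all add: poly_sel) (intro pset_mono; blast)+
  let ?P = "free_part c P"
  note below = free_part_subset[OF insert(5) c]
  have \<Delta>: "\<Delta> \<notin> ?P" "\<Delta> \<in> carrier (Poly (I - C))" using below insert sub by auto
  have rel: "\<exists>g\<in>carrier (Poly (I - C)). \<Delta> \<otimes>\<^bsub>Poly I\<^esub> indexed_var d \<oplus>\<^bsub>Poly I\<^esub> g \<in> ?P" if d: "d \<in> C" for d
  proof -
    obtain g where g: "g \<in> carrier (Poly (I - insert c C))" "\<Delta> \<otimes>\<^bsub>Poly I\<^esub> indexed_var d \<oplus>\<^bsub>Poly I\<^esub> g \<in> P"
      using insert(8)[of d] d by blast
    interpret S: subring "carrier (Poly (I - {c}))" "Poly I" by (rule sub_subring) blast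
    interpret J: poly_over R "I - {c}" ..
    have "indexed_var d \<in> carrier (Poly (I - {c}))" using d insert by (intro J.var_mem) auto
    then have "\<Delta> \<otimes>\<^bsub>Poly I\<^esub> indexed_var d \<oplus>\<^bsub>Poly I\<^esub> g \<in> carrier (Poly (I - {c}))"
      by (rule subringE(7)[OF S.subring_axioms subringE(6)[OF S.subring_axioms subsetD[OF sub(1) insert(6)]] subsetD[OF sub(1) g(1)]])
    from free_part_mem_free[OF insert(5) c this g(2)] show ?thesis using g(1) sub(2) by blast
  qed
  have "C \<subseteq> I" using insert(4) by blast
  obtain Q where Q: "\<forall>i\<le>card C. primeideal (Q i) (Poly I) \<and> Q i \<subseteq> ?P" "\<forall>i<card C. Q i \<subset> Q (Suc i)"
    using insert(3)[OF \<open>C \<subseteq> I\<close> free_part_prime[OF insert(5) c] \<Delta>(2,1) rel] by blast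
  obtain g where g: "g \<in> carrier (Poly (I - insert c C))" "\<Delta> \<otimes>\<^bsub>Poly I\<^esub> indexed_var c \<oplus>\<^bsub>Poly I\<^esub> g \<in> P"
    using insert(8)[of c] by blast
  have \<Delta>': "\<Delta> \<in> carrier (Poly (I - {c}))" "\<Delta> \<in> carrier (Poly I)" "g \<in> carrier (Poly (I - {c}))"
    using insert(6) g(1) sub by auto
  have "xcoeff c 1 (\<Delta> \<otimes>\<^bsub>Poly I\<^esub> indexed_var c \<oplus>\<^bsub>Poly I\<^esub> g) = \<Delta>"
    using \<Delta>'(2)
    by (simp add: coeff_at_add coeff_at_var_in[OF \<Delta>'(2)] coeff_at_free[OF \<Delta>'(1)] coeff_at_free[OF \<Delta>'(3)])
  then have "xcoeff c 1 (\<Delta> \<otimes>\<^bsub>Poly I\<^esub> indexed_var c \<oplus>\<^bsub>Poly I\<^esub> g) \<notin> P" using insert(7) by metis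
  then have "\<Delta> \<otimes>\<^bsub>Poly I\<^esub> indexed_var c \<oplus>\<^bsub>Poly I\<^esub> g \<notin> ?P" unfolding free_part_def by blast
  then have strict: "?P \<subset> P" using below g(2) by blast
  have card: "card (insert c C) = Suc (card C)" using insert by simp
  let ?Q = "\<lambda>i. if i \<le> card C then Q i else P"
  have "\<forall>i\<le>Suc (card C). primeideal (?Q i) (Poly I) \<and> ?Q i \<subseteq> P" using Q(1) strict insert(5) by auto
  moreover have "?Q i \<subset> ?Q (Suc i)" if "i < Suc (card C)" for i
  proof (cases "i < card C")
    case True
    then show ?thesis using Q(2) by simp
  next
    case False
    then have "i = card C" using that by simp
    then show ?thesis using Q(1) strict by auto
  qed
  ultimately show ?case unfolding card by (intro exI[of _ ?Q] conjI allI impI) simp_all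
qed

end

lemma primeideal_subset:
  assumes "primeideal q R"
  shows "q \<subseteq> carrier R"
  by (rule subsetI) (rule ideal.Icarr[OF primeideal.axioms(1)[OF assms]])

context cring
begin

lemma exists_minimal_prime:
  assumes "noetherian_ring R" "carrier R \<noteq> {\<zero>}"
  shows "\<exists>q. primeideal q R \<and> (\<forall>q'. primeideal q' R \<and> q' \<subseteq> q \<longrightarrow> q' = q)"
proof -
  let ?A = "{J. ideal J R \<and> \<one> \<notin> J}"
  have "\<exists>m\<in>?A. \<forall>J\<in>?A. m \<subseteq> J \<longrightarrow> J = m"
  proof (rule subset_Zorn_nonempty)
    have "{\<zero>} \<in> ?A" using zeroideal assms(2) one_zeroI carrier_one_not_zero by simp
    then show "?A \<noteq> {}" by blast
    fix C assume C: "C \<noteq> {}" "subset.chain ?A C"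
    then have "subset.chain {J. ideal J R} C" by (auto simp: subset.chain_def subset_chain_def)
    from noetherian_ring.ideal_chain_is_trivial[OF assms(1) C(1) this] have "\<Union>C \<in> C" .
    then show "\<Union>C \<in> ?A" using C(2) by (auto simp: subset.chain_def subset_chain_def)
  qed
  then obtain m where m: "ideal m R" "\<one> \<notin> m" "\<And>J. ideal J R \<Longrightarrow> \<one> \<notin> J \<Longrightarrow> m \<subseteq> J \<Longrightarrow> J = m" by blast
  have "maximalideal m R"
  proof (rule maximalidealI[OF m(1)])
    show "carrier R \<noteq> m" using m(2) by blast
    fix J assume J: "ideal J R" "m \<subseteq> J"
    show "J = m \<or> J = carrier R" using m(3)[OF J(1) _ J(2)] ideal.one_imp_carrier[OF J(1)] by blast
  qed
  then have prime: "primeideal m R" by (rule maximalideal_prime)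
  let ?B = "{carrier R - q | q. primeideal q R}"
  have "\<exists>s\<in>?B. \<forall>t\<in>?B. s \<subseteq> t \<longrightarrow> t = s"
  proof (rule subset_Zorn_nonempty)
    show "?B \<noteq> {}" using prime by blast
    fix C assume C: "C \<noteq> {}" "subset.chain ?B C"
    have C_sub: "\<exists>q. s = carrier R - q \<and> primeideal q R" if "s \<in> C" for s
      using C(2) that unfolding subset.chain_def subset_chain_def by blast
    have C_lin: "s \<subseteq> t \<or> t \<subseteq> s" if "s \<in> C" "t \<in> C" for s t
      using C(2) that unfolding subset.chain_def subset_chain_def by blast
    define S where "S = {q. primeideal q R \<and> carrier R - q \<in> C}"
    have S_ne: "S \<noteq> {}" using C(1) C_sub unfolding S_def by blast
    have S_lin: "q \<subseteq> q' \<or> q' \<subseteq> q" if "q \<in> S" "q' \<in> S" for q q'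
    proof -
      have "q \<subseteq> carrier R" "q' \<subseteq> carrier R" using that unfolding S_def by (auto dest: primeideal_subset)
      moreover have "carrier R - q \<subseteq> carrier R - q' \<or> carrier R - q' \<subseteq> carrier R - q"
        by (rule C_lin) (use that in \<open>simp_all add: S_def\<close>)
      ultimately show ?thesis by blast
    qed
    have id: "ideal (\<Inter>S) R"
      by (rule i_Intersect[OF _ S_ne]) (use primeideal.axioms(1) in \<open>auto simp: S_def\<close>)
    have "primeideal (\<Inter>S) R"
    proof (rule primeidealI[OF id is_cring])
      obtain r where r: "r \<in> S" using S_ne by blast
      then have "primeideal r R" by (simp add: S_def)
      then have "carrier R \<noteq> r" "r \<subseteq> carrier R" by (auto dest: primeideal.I_notcarr primeideal_subset)
      then show "carrier R \<noteq> \<Inter>S" using r by blast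
      fix a b assume ab: "a \<in> carrier R" "b \<in> carrier R" "a \<otimes> b \<in> \<Inter>S"
      show "a \<in> \<Inter>S \<or> b \<in> \<Inter>S"
      proof (rule ccontr)
        assume "\<not> ?thesis"
        then obtain q q' where q: "q \<in> S" "a \<notin> q" "q' \<in> S" "b \<notin> q'" by blast
        then obtain r where r: "r \<in> S" "a \<notin> r" "b \<notin> r" using S_lin[OF q(1,3)] by blast
        then have "primeideal r R" "a \<otimes> b \<in> r" using ab(3) unfolding S_def by blast+
        then show False using primeideal.I_prime[OF \<open>primeideal r R\<close> ab(1,2)] r(2,3) by blast
      qed
    qed
    moreover have "\<Union>C = carrier R - \<Inter>S"
    proof
      show "\<Union>C \<subseteq> carrier R - \<Inter>S" using C_sub unfolding S_def by fastforce
      show "carrier R - \<Inter>S \<subseteq> \<Union>C" unfolding S_def by blast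
    qed
    ultimately show "\<Union>C \<in> ?B" by blast
  qed
  then obtain s where s: "s \<in> ?B" "\<forall>t\<in>?B. s \<subseteq> t \<longrightarrow> t = s" by (elim bexE)
  from s(1) obtain q where q: "s = carrier R - q" "primeideal q R" by blast
  have "q' = q" if q': "primeideal q' R" "q' \<subseteq> q" for q'
  proof -
    have "carrier R - q' \<in> ?B" using q'(1) by blast
    moreover have "s \<subseteq> carrier R - q'" unfolding q(1) using q'(2) by blast
    ultimately have "carrier R - q' = s" using s(2) by blast
    then have "carrier R - q' = carrier R - q" by (simp only: q(1))
    then show ?thesis using primeideal_subset[OF q'(1)] primeideal_subset[OF q(2)] by blast
  qed
  then show ?thesis using q(2) by blast
qed

end

context poly_over
begin

definition coeff_ideal :: "'a set \<Rightarrow> ('c multiset \<Rightarrow> 'a) set"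
  where "coeff_ideal q = {f \<in> carrier (Poly I). \<forall>m. f m \<in> q}"

lemma const_coeff_hom: "(\<lambda>f. f {#}) \<in> Ring.ring_hom (Poly I) R"
proof (rule ring_hom_memI)
  fix f g assume fg: "f \<in> carrier (Poly I)" "g \<in> carrier (Poly I)"
  have "{a::'c multiset. a \<subseteq># {#}} = {{#}}" by auto
  then show "(f \<otimes>\<^bsub>Poly I\<^esub> g) {#} = f {#} \<otimes> g {#}"
    using fg coeff_closed by (simp add: poly_sel(4) indexed_mult_def)
qed (simp_all add: coeff_closed add_app poly_sel(3) const_app)

lemma coeff_ideal_prime:
  assumes "finite I" and q: "primeideal q R"
  shows "primeideal (coeff_ideal q) (Poly I)"
proof -
  interpret q: primeideal q R by (rule q)
  let ?B = "\<lambda>K. {f \<in> carrier (Poly I). \<forall>m. set_mset m \<subseteq> K \<longrightarrow> f m \<in> q}"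
  have "primeideal (?B K) (Poly I)" if "finite K" "K \<subseteq> I" for K
    using that
  proof (induct K rule: finite_induct)
    case empty
    have hom: "ring_hom_cring (Poly I) R (\<lambda>f. f {#})"
      by (intro ring_hom_cring.intro ring_hom_cring_axioms.intro const_coeff_hom poly.is_cring is_cring)
    have "?B {} = {f \<in> carrier (Poly I). f {#} \<in> q}" by auto
    then show ?case using ring_hom_cring.primeideal_vimage[OF hom q] by (simp only:)
  next
    case (insert x K)
    then have x: "x \<in> I" and prime: "primeideal (?B K) (Poly I)" by auto
    have "?B (insert x K) = free_part x (?B K)"
    proof
      show "?B (insert x K) \<subseteq> free_part x (?B K)"
      proof
        fix f assume f: "f \<in> ?B (insert x K)"
        have "xcoeff x k f m \<in> q" if "set_mset m \<subseteq> K" for k m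
        proof -
          have "set_mset (m + replicate_mset k x) \<subseteq> insert x K" using that by (auto dest: in_replicate_mset[THEN iffD1])
          then have "f (m + replicate_mset k x) \<in> q" using f by blast
          then show ?thesis by (simp add: coeff_at_app)
        qed
        then show "f \<in> free_part x (?B K)" using f coeff_at_closed unfolding free_part_def by blast
      qed
      show "free_part x (?B K) \<subseteq> ?B (insert x K)"
      proof
        fix f assume f: "f \<in> free_part x (?B K)"
        have "f m \<in> q" if m: "set_mset m \<subseteq> insert x K" for m
        proof -
          define m' where "m' = m - replicate_mset (count m x) x"
          have eq: "m' + replicate_mset (count m x) x = m"
            unfolding m'_def by (rule multiset_eqI) simp
          have "x \<notin># m'" by (simp add: m'_def not_in_iff)
          moreover have "set_mset m' \<subseteq> insert x K" using m by (auto simp: m'_def dest: in_diffD)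
          ultimately have "set_mset m' \<subseteq> K" by blast
          then have "xcoeff x (count m x) f m' \<in> q" using f unfolding free_part_def by blast
          then show ?thesis using \<open>x \<notin># m'\<close> by (simp add: coeff_at_app eq)
        qed
        then show "f \<in> ?B (insert x K)" using f unfolding free_part_def by blast
      qed
    qed
    then show ?case using free_part_prime[OF prime x] by (simp only:)
  qed
  from this[OF assms(1) subset_refl] have "primeideal (?B I) (Poly I)" .
  moreover have "?B I = coeff_ideal q"
  proof -
    have "f m \<in> q" if "f \<in> ?B I" for f m
      using that support_subset[of f m] q.zero_closed by (cases "f m = \<zero>") auto
    then show ?thesis unfolding coeff_ideal_def by blast
  qed
  ultimately show ?thesis by (simp only:)
qed

lemma const_mem_coeff_ideal:
  assumes "ideal q R" "k \<in> carrier R"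
  shows "indexed_const k \<in> coeff_ideal q \<longleftrightarrow> k \<in> q"
  using additive_subgroup.zero_closed[OF ideal.axioms(1)[OF assms(1)]] const_mem[OF assms(2)]
  by (auto simp: coeff_ideal_def const_app split: if_splits)

lemma coeff_ideal_subset:
  assumes q: "ideal q R" and A: "ideal A (Poly I)" and k: "\<And>k. k \<in> q \<Longrightarrow> indexed_const k \<in> A"
  shows "coeff_ideal q \<subseteq> A"
proof
  interpret q: ideal q R by (rule q)
  interpret A: ideal A "Poly I" by (rule A)
  fix f assume f: "f \<in> coeff_ideal q"
  then have fc: "f \<in> carrier (Poly I)" by (simp add: coeff_ideal_def)
  have "f \<in> indexed_pset I q"
    by (rule indexed_psetI) (use f finite_support[OF fc] support_subset[OF fc] in \<open>auto simp: coeff_ideal_def\<close>)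
  then show "f \<in> A"
  proof (induct rule: indexed_pset.induct)
    case (indexed_padd P Q)
    then have "P \<oplus>\<^bsub>Poly I\<^esub> Q \<in> A" by (intro A.a_closed)
    then show ?case by (simp add: poly_sel)
  next
    case (indexed_pmult P i)
    have "carrier_coeff P" using A.Icarr[OF indexed_pmult(2)] by (simp add: poly_sel pset_carrier_coeff[where I = I])
    then have "indexed_pmult P i = P \<otimes>\<^bsub>Poly I\<^esub> indexed_var i" by (simp add: poly_sel pmult_eq_mult_var)
    then show ?case using A.I_r_closed[OF indexed_pmult(2) var_mem[OF indexed_pmult(3)]] by simp
  qed (rule k)
qed

text \<open>The kernel of the evaluation that sends the indeterminates \<open>c\<close> in \<open>C\<close> to \<open>- g c / \<Delta>\<close>.\<close>

lemma section_prime: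
  assumes "finite I" "C \<subseteq> I" and q: "primeideal q R"
    and \<Delta>: "\<Delta> \<in> carrier (Poly (I - C))" "\<Delta> \<notin> coeff_ideal q"
    and g: "\<And>c. c \<in> C \<Longrightarrow> g c \<in> carrier (Poly (I - C))"
  obtains p where "primeideal p (Poly I)"
    "\<And>c. c \<in> C \<Longrightarrow> \<Delta> \<otimes>\<^bsub>Poly I\<^esub> indexed_var c \<oplus>\<^bsub>Poly I\<^esub> g c \<in> p"
    "\<And>f. f \<in> carrier (Poly (I - C)) \<Longrightarrow> f \<in> p \<longleftrightarrow> f \<in> coeff_ideal q"
proof -
  define Q where "Q = coeff_ideal q"
  have Q: "primeideal Q (Poly I)" unfolding Q_def by (rule coeff_ideal_prime[OF assms(1) q])
  interpret L: prime_localization "Poly I" Q by (rule prime_localization.intro[OF poly.is_cring Q])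
  interpret Loc: cring L.Loc by (rule L.Loc_cring)
  interpret J: poly_over R "I - C" ..
  have sub: "x \<in> carrier (Poly (I - C)) \<Longrightarrow> x \<in> carrier (Poly I)" for x using sub_carrier[of "I - C"] by blast
  have \<Delta>M: "\<Delta> \<in> carrier (Poly I) - Q" using \<Delta> sub by (simp add: Q_def)
  note oneM = L.M_one
  let ?one = "\<one>\<^bsub>Poly I\<^esub>"
  let ?v = "\<lambda>i. if i \<in> C then L.frac (\<ominus>\<^bsub>Poly I\<^esub> g i) \<Delta> else L.frac (indexed_var i) ?one"
  have v: "?v i \<in> carrier L.Loc" if "i \<in> I" for i
    using that var_mem[OF that] sub[OF g[of i]] \<Delta>M oneM by (auto intro!: L.frac_in_Loc)
  obtain h where h: "h \<in> Ring.ring_hom (Poly I) L.Loc"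
    "\<And>k. k \<in> carrier R \<Longrightarrow> h (indexed_const k) = ((\<lambda>a. L.frac a ?one) \<circ> indexed_const) k"
    "\<And>i. i \<in> I \<Longrightarrow> h (indexed_var i) = ?v i"
    by (rule eval_hom[where v = ?v, OF L.Loc_cring ring_hom_trans[OF const_hom L.frac_hom] v]) blast+
  have h_free: "h f = L.frac f ?one" if "f \<in> carrier (Poly (I - C))" for f
    using that
  proof (induct f rule: J.poly_induct)
    case (const k)
    then show ?case using h(2) by simp
  next
    case (add f f')
    have "f \<oplus>\<^bsub>Poly (I - C)\<^esub> f' = f \<oplus>\<^bsub>Poly I\<^esub> f'" by (simp add: poly_sel)
    then show ?case
      using add sub[OF add(1)] sub[OF add(2)] oneM
      by (simp only: ring_hom_add[OF h(1)] ring_hom_add[OF L.frac_hom])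
  next
    case (mult f i)
    then have i: "i \<in> I" "i \<notin> C" by auto
    have "f \<otimes>\<^bsub>Poly (I - C)\<^esub> indexed_var i = f \<otimes>\<^bsub>Poly I\<^esub> indexed_var i" by (simp add: poly_sel)
    moreover have "h (indexed_var i) = L.frac (indexed_var i) ?one" using h(3)[OF i(1)] i(2) by simp
    ultimately show ?case
      using mult(2) sub[OF mult(1)] var_mem[OF i(1)]
      by (simp only: ring_hom_mult[OF h(1)] ring_hom_mult[OF L.frac_hom])
  qed
  have disj: "Q \<inter> (carrier (Poly I) - Q) = {}" by blast
  let ?p = "{f \<in> carrier (Poly I). h f \<in> L.ext_ideal Q}"
  have hom: "ring_hom_cring (Poly I) L.Loc h"
    by (intro ring_hom_cring.intro ring_hom_cring_axioms.intro poly.is_cring L.Loc_cring h(1))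
  have 1: "primeideal ?p (Poly I)"
    by (rule ring_hom_cring.primeideal_vimage[OF hom L.ext_ideal_prime(1)[OF Q disj]])
  have 2: "\<Delta> \<otimes>\<^bsub>Poly I\<^esub> indexed_var c \<oplus>\<^bsub>Poly I\<^esub> g c \<in> ?p" if c: "c \<in> C" for c
  proof -
    have cI: "c \<in> I" using c assms(2) by blast
    note cl = sub[OF \<Delta>(1)] var_mem[OF cI] sub[OF g[OF c]]
    note ncl = poly.a_inv_closed[OF cl(3)]
    have dc: "\<Delta> \<otimes>\<^bsub>Poly I\<^esub> indexed_var c \<in> carrier (Poly I)" by (rule poly.m_closed[OF cl(1,2)])
    have hc: "h (indexed_var c) = L.frac (\<ominus>\<^bsub>Poly I\<^esub> g c) \<Delta>" using h(3)[OF cI] c by simp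
    have "h (\<Delta> \<otimes>\<^bsub>Poly I\<^esub> indexed_var c \<oplus>\<^bsub>Poly I\<^esub> g c)
      = L.frac \<Delta> ?one \<otimes>\<^bsub>L.Loc\<^esub> L.frac (\<ominus>\<^bsub>Poly I\<^esub> g c) \<Delta> \<oplus>\<^bsub>L.Loc\<^esub> L.frac (g c) ?one"
      by (simp only: ring_hom_add[OF h(1) dc cl(3)] ring_hom_mult[OF h(1) cl(1,2)] hc h_free[OF \<Delta>(1)] h_free[OF g[OF c]])
    also have "L.frac \<Delta> ?one \<otimes>\<^bsub>L.Loc\<^esub> L.frac (\<ominus>\<^bsub>Poly I\<^esub> g c) \<Delta>
      = L.frac (\<Delta> \<otimes>\<^bsub>Poly I\<^esub> \<ominus>\<^bsub>Poly I\<^esub> g c) (?one \<otimes>\<^bsub>Poly I\<^esub> \<Delta>)"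
      by (rule L.Loc_mult[OF cl(1) ncl oneM \<Delta>M])
    also have "\<dots> = L.frac (\<ominus>\<^bsub>Poly I\<^esub> g c) ?one"
      by (rule L.frac_eqI) (use cl ncl oneM \<Delta>M in \<open>simp_all add: poly.m_comm L.M_mult poly.l_one\<close>)
    also have "\<dots> \<oplus>\<^bsub>L.Loc\<^esub> L.frac (g c) ?one
      = L.frac (\<ominus>\<^bsub>Poly I\<^esub> g c \<otimes>\<^bsub>Poly I\<^esub> ?one \<oplus>\<^bsub>Poly I\<^esub> g c \<otimes>\<^bsub>Poly I\<^esub> ?one) (?one \<otimes>\<^bsub>Poly I\<^esub> ?one)"
      by (rule L.Loc_add[OF ncl cl(3) oneM oneM])
    also have "\<dots> = L.frac \<zero>\<^bsub>Poly I\<^esub> ?one" using cl ncl by (simp add: poly.l_neg)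
    also have "\<dots> \<in> L.ext_ideal Q" by (rule L.ext_idealI[OF _ oneM]) simp
    finally show ?thesis using poly.a_closed[OF dc cl(3)] by simp
  qed
  have 3: "f \<in> ?p \<longleftrightarrow> f \<in> coeff_ideal q" if "f \<in> carrier (Poly (I - C))" for f
    using L.ext_ideal_prime(2)[OF Q disj sub[OF that] oneM] sub[OF that] h_free[OF that] by (simp add: Q_def)
  show ?thesis by (rule that[OF 1 2 3])
qed

end

context poly_over
begin

definition deg_le :: "('c multiset \<Rightarrow> 'a) \<Rightarrow> nat \<Rightarrow> bool"
  where "deg_le f e \<longleftrightarrow> (\<forall>m. f m \<noteq> \<zero> \<longrightarrow> size m \<le> e)"

lemma deg_le_mono: "deg_le f d \<Longrightarrow> d \<le> e \<Longrightarrow> deg_le f e"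
  unfolding deg_le_def by (meson order_trans)

lemma deg_le_one: "deg_le \<one>\<^bsub>Poly I\<^esub> 0"
  by (auto simp: deg_le_def poly_sel(3) const_app)

lemma deg_le_mult:
  assumes f: "f \<in> carrier (Poly I)" "deg_le f d" and g: "g \<in> carrier (Poly I)" "deg_le g e"
  shows "deg_le (f \<otimes>\<^bsub>Poly I\<^esub> g) (d + e)"
  unfolding deg_le_def
proof (intro allI impI, rule ccontr)
  fix m assume m: "(f \<otimes>\<^bsub>Poly I\<^esub> g) m \<noteq> \<zero>" "\<not> size m \<le> d + e"
  have "f a \<otimes> g (m - a) = \<zero>" if a: "a \<subseteq># m" for a
  proof (cases "f a = \<zero>")
    case True
    then show ?thesis using coeff_closed[OF g(1)] by simp
  next
    case False
    then have "size a \<le> d" using f(2) by (simp add: deg_le_def)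
    moreover have "size m = size a + size (m - a)" using a by (simp add: size_Diff_submset size_mset_mono)
    ultimately have "\<not> size (m - a) \<le> e" using m(2) by linarith
    then have "g (m - a) = \<zero>" using g(2) unfolding deg_le_def by blast
    then show ?thesis using coeff_closed[OF f(1)] by simp
  qed
  then have "(\<Oplus>a\<in>{a. a \<subseteq># m}. f a \<otimes> g (m - a)) = \<zero>"
    by (intro add.finprod_one_eqI) blast
  then show False using m(1) by (simp add: poly_sel(4) indexed_mult_def)
qed

lemma deg_le_pow:
  assumes "f \<in> carrier (Poly I)" "deg_le f e"
  shows "deg_le (f [^]\<^bsub>Poly I\<^esub> k) (k * e)"
proof (induct k)
  case 0
  show ?case using deg_le_one by simp
next
  case (Suc k)
  have "deg_le (f [^]\<^bsub>Poly I\<^esub> k \<otimes>\<^bsub>Poly I\<^esub> f) (k * e + e)"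
    by (rule deg_le_mult[OF poly.nat_pow_closed[OF assms(1)] Suc assms])
  then show ?case by (simp add: add.commute)
qed

lemma deg_le_mono_list:
  assumes "\<And>f. f \<in> set xs \<Longrightarrow> f \<in> carrier (Poly I) \<and> deg_le f e" "\<beta> \<in> exps M (length xs)"
  shows "deg_le (poly.mono_list xs \<beta>) (length xs * (M * e))"
  using assms
proof (induct xs arbitrary: \<beta>)
  case Nil
  show ?case using deg_le_one by simp
next
  case (Cons x xs)
  then obtain b \<beta>' where \<beta>: "\<beta> = b # \<beta>'" "b \<le> M" "\<beta>' \<in> exps M (length xs)"
    by (auto simp: exps_Suc)
  have x: "x \<in> carrier (Poly I)" "deg_le x e" and xs: "set xs \<subseteq> carrier (Poly I)" using Cons(2) by auto
  have "deg_le (poly.mono_list xs \<beta>') (length xs * (M * e))" by (rule Cons(1)[OF Cons(2) \<beta>(3)]) simp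
  then have "deg_le (x [^]\<^bsub>Poly I\<^esub> b \<otimes>\<^bsub>Poly I\<^esub> poly.mono_list xs \<beta>') (b * e + length xs * (M * e))"
    by (rule deg_le_mult[OF poly.nat_pow_closed[OF x(1)] deg_le_pow[OF x] poly.mono_list_closed[OF xs]])
  then have "deg_le (x [^]\<^bsub>Poly I\<^esub> b \<otimes>\<^bsub>Poly I\<^esub> poly.mono_list xs \<beta>') (length (x # xs) * (M * e))"
    by (rule deg_le_mono) (use \<beta>(2) in simp)
  then show ?case by (simp add: \<beta>(1))
qed

lemma card_bounded_multisets:
  fixes C :: "'d set"
  assumes "finite C"
  shows "finite {m. set_mset m \<subseteq> C \<and> size m \<le> L}" "card {m. set_mset m \<subseteq> C \<and> size m \<le> L} \<le> Suc L ^ card C"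
proof -
  let ?K = "{m. set_mset m \<subseteq> C \<and> size m \<le> L}" and ?F = "\<lambda>m. restrict (count m) C"
  have inj: "inj_on ?F ?K"
  proof (rule inj_onI)
    fix m n assume mn: "m \<in> ?K" "n \<in> ?K" "?F m = ?F n"
    show "m = n"
    proof (rule multiset_eqI)
      fix c show "count m c = count n c"
      proof (cases "c \<in> C")
        case True
        then show ?thesis using fun_cong[OF mn(3), of c] by simp
      next
        case False
        then have "c \<notin># m" "c \<notin># n" using mn by auto
        then show ?thesis by (simp add: not_in_iff)
      qed
    qed
  qed
  have img: "?F ` ?K \<subseteq> C \<rightarrow>\<^sub>E {..L}"
  proof
    fix F assume "F \<in> ?F ` ?K"
    then obtain m where m: "m \<in> ?K" "F = ?F m" by blast
    have "count m c \<le> L" for c using m(1) count_le_size[of m c] by simp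
    then show "F \<in> C \<rightarrow>\<^sub>E {..L}" using m(2) by auto
  qed
  have fin: "finite (C \<rightarrow>\<^sub>E {..L})" by (rule finite_PiE) (use assms in auto)
  show "finite ?K" by (rule inj_on_finite[OF inj img fin])
  have "card ?K \<le> card (C \<rightarrow>\<^sub>E {..L})" by (rule card_inj_on_le[OF inj img fin])
  also have "\<dots> = Suc L ^ card C" using assms by (simp add: card_PiE)
  finally show "card ?K \<le> Suc L ^ card C" .
qed

text \<open>Modulo \<open>q\<close> the elements \<open>x\<^sub>i \<in> P (i + 1) - P i\<close> are algebraically dependent over the
  polynomials free of \<open>C\<close>, because they are more numerous than \<open>C\<close>.\<close>

lemma no_long_chain:
  assumes fin: "finite I" and C: "C \<subseteq> I" and q: "primeideal q R"
    and minimal: "\<And>q'. primeideal q' R \<Longrightarrow> q' \<subseteq> q \<Longrightarrow> q' = q"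
    and p: "\<And>f. f \<in> carrier (Poly (I - C)) \<Longrightarrow> f \<in> p \<Longrightarrow> f \<in> coeff_ideal q"
    and P: "\<And>i. i \<le> Suc (card C) \<Longrightarrow> primeideal (P i) (Poly I) \<and> P i \<subseteq> p"
    and strict: "\<And>i. i < Suc (card C) \<Longrightarrow> P i \<subset> P (Suc i)"
  shows False
proof -
  interpret q: primeideal q R by (rule q)
  interpret J: poly_over R "I - C" ..
  have sub: "x \<in> carrier (Poly (I - C)) \<Longrightarrow> x \<in> carrier (Poly I)" for x using sub_carrier[of "I - C"] by blast
  have finC: "finite C" using fin C by (rule rev_finite_subset)
  let ?d = "card C"
  let ?N = "Suc ?d"
  have "\<exists>x. x \<in> P (Suc i) - P i" if "i < ?N" for i using strict[OF that] by blast
  then obtain x where x: "\<And>i. i < ?N \<Longrightarrow> x i \<in> P (Suc i) - P i" by metis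
  define xs where "xs = map x [0..<?N]"
  have len: "length xs = ?N" by (simp add: xs_def)
  have xs_nth: "xs ! i \<in> P (Suc i) - P i" if "i < length xs" for i using x[of i] that by (simp add: xs_def del: upt_Suc)
  have xs_sub: "set xs \<subseteq> carrier (Poly I)"
  proof
    fix f assume "f \<in> set xs"
    then obtain i where i: "i < length xs" "f = xs ! i" by (auto simp: in_set_conv_nth)
    have "primeideal (P (Suc i)) (Poly I)" using P[of "Suc i"] i(1) len by simp
    then show "f \<in> carrier (Poly I)" using primeideal_subset xs_nth[OF i(1)] i(2) by blast
  qed
  have "finite (\<Union>f\<in>set xs. size ` {m. f m \<noteq> \<zero>})" using xs_sub finite_support by auto
  then obtain e where e: "\<forall>k\<in>(\<Union>f\<in>set xs. size ` {m. f m \<noteq> \<zero>}). k < e"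
    unfolding finite_nat_set_iff_bounded by blast
  have e_xs: "f \<in> carrier (Poly I) \<and> deg_le f e" if "f \<in> set xs" for f
  proof
    show "f \<in> carrier (Poly I)" using xs_sub that by blast
    show "deg_le f e" unfolding deg_le_def
    proof (intro allI impI)
      fix m assume "f m \<noteq> \<zero>"
      then have "size m \<in> (\<Union>f\<in>set xs. size ` {m. f m \<noteq> \<zero>})" using that by blast
      then show "size m \<le> e" using e by (meson less_imp_le)
    qed
  qed
  define a where "a = ?N * e + 1"
  define M where "M = a ^ ?d"
  define L where "L = ?N * (M * e)"
  let ?K = "{m. set_mset m \<subseteq> C \<and> size m \<le> L}"
  let ?mon = "\<lambda>\<beta>. poly.mono_list xs \<beta>"
  have mon_closed: "?mon \<beta> \<in> carrier (Poly I)" for \<beta> by (rule poly.mono_list_closed[OF xs_sub])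
  have mon_deg: "deg_le (?mon \<beta>) L" if "\<beta> \<in> exps M ?N" for \<beta>
    using deg_le_mono_list[OF e_xs, of xs \<beta> M] that unfolding len L_def by simp
  have "card ?K < card (exps M ?N)"
  proof -
    have "Suc L \<le> a * Suc M" by (simp add: a_def L_def algebra_simps)
    then have "Suc L ^ ?d \<le> (a * Suc M) ^ ?d" by (rule power_mono) simp
    also have "\<dots> = M * Suc M ^ ?d" by (simp only: power_mult_distrib M_def)
    also have "\<dots> < Suc M * Suc M ^ ?d" by simp
    also have "\<dots> = card (exps M ?N)" by (simp add: card_exps)
    finally show ?thesis using card_bounded_multisets(2)[OF finC, of L] by linarith
  qed
  have finJ: "finite (I - C)" using fin by simp
  define u where "u = (\<lambda>\<beta> m. coeff_at C m (?mon \<beta>))"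
  have u: "u \<beta> m \<in> carrier (Poly (I - C))" for \<beta> m unfolding u_def by (rule coeff_at_mem[OF mon_closed])
  obtain v where v: "\<And>\<beta>. \<beta> \<in> exps M ?N \<Longrightarrow> v \<beta> \<in> carrier (Poly (I - C))"
    "\<exists>\<beta>\<in>exps M ?N. v \<beta> \<notin> J.coeff_ideal q"
    "\<And>m. m \<in> ?K \<Longrightarrow> finsum (Poly (I - C)) (\<lambda>\<beta>. v \<beta> \<otimes>\<^bsub>Poly (I - C)\<^esub> u \<beta> m) (exps M ?N) \<in> J.coeff_ideal q"
    using primeideal.dependent_mod[OF J.coeff_ideal_prime[OF finJ q] card_bounded_multisets(1)[OF finC] finite_exps
        \<open>card ?K < card (exps M ?N)\<close>, of u] u by blast
  have JI: "f \<in> J.coeff_ideal q \<longleftrightarrow> f \<in> coeff_ideal q" if "f \<in> carrier (Poly (I - C))" for f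
    using that sub[OF that] by (simp add: J.coeff_ideal_def coeff_ideal_def)
  let ?F = "finsum (Poly I) (\<lambda>\<beta>. v \<beta> \<otimes>\<^bsub>Poly I\<^esub> ?mon \<beta>) (exps M ?N)"
  have vmon: "(\<lambda>\<beta>. v \<beta> \<otimes>\<^bsub>Poly I\<^esub> ?mon \<beta>) \<in> exps M ?N \<rightarrow> carrier (Poly I)"
    using v(1) sub mon_closed by (intro funcsetI poly.m_closed) blast+
  have "?F n \<in> q" for n
  proof -
    define m where "m = filter_mset (\<lambda>c. c \<in> C) n"
    define n' where "n' = filter_mset (\<lambda>c. c \<notin> C) n"
    have n: "n = n' + m" unfolding m_def n'_def by (metis multiset_partition union_commute)
    have m: "set_mset m \<subseteq> C" and n': "set_mset n' \<inter> C = {}" by (auto simp: m_def n'_def)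
    have summand: "(v \<beta> \<otimes>\<^bsub>Poly I\<^esub> ?mon \<beta>) n = (v \<beta> \<otimes>\<^bsub>Poly (I - C)\<^esub> u \<beta> m) n'" if "\<beta> \<in> exps M ?N" for \<beta>
    proof -
      have "(v \<beta> \<otimes>\<^bsub>Poly I\<^esub> ?mon \<beta>) n = coeff_at C m (?mon \<beta> \<otimes>\<^bsub>Poly I\<^esub> v \<beta>) n'"
        using n' by (simp add: coeff_at_app n[symmetric] poly.m_comm[OF mon_closed sub[OF v(1)[OF that]]])
      also have "\<dots> = (u \<beta> m \<otimes>\<^bsub>Poly I\<^esub> v \<beta>) n'"
        unfolding u_def by (simp only: coeff_at_mult_free[OF v(1)[OF that] mon_closed m])
      also have "u \<beta> m \<otimes>\<^bsub>Poly I\<^esub> v \<beta> = v \<beta> \<otimes>\<^bsub>Poly I\<^esub> u \<beta> m" by (rule poly.m_comm[OF sub[OF u] sub[OF v(1)[OF that]]])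
      finally show ?thesis by (simp add: poly_sel(4))
    qed
    have "?F n = (\<Oplus>\<beta>\<in>exps M ?N. (v \<beta> \<otimes>\<^bsub>Poly I\<^esub> ?mon \<beta>) n)" by (rule finsum_app[OF vmon])
    also have "\<dots> = (\<Oplus>\<beta>\<in>exps M ?N. (v \<beta> \<otimes>\<^bsub>Poly (I - C)\<^esub> u \<beta> m) n')"
      by (rule finsum_cong') (use summand v(1) u in \<open>auto intro!: J.coeff_closed J.poly.m_closed\<close>)
    also have "\<dots> \<in> q"
    proof (cases "m \<in> ?K")
      case True
      have "(\<Oplus>\<beta>\<in>exps M ?N. (v \<beta> \<otimes>\<^bsub>Poly (I - C)\<^esub> u \<beta> m) n')
        = finsum (Poly (I - C)) (\<lambda>\<beta>. v \<beta> \<otimes>\<^bsub>Poly (I - C)\<^esub> u \<beta> m) (exps M ?N) n'"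
        by (rule J.finsum_app[symmetric]) (use v(1) u in \<open>intro funcsetI J.poly.m_closed; simp\<close>)
      then show ?thesis using v(3)[OF True] by (simp add: J.coeff_ideal_def)
    next
      case False
      then have size: "\<not> size m \<le> L" using m by simp
      have "u \<beta> m = \<zero>\<^bsub>Poly (I - C)\<^esub>" if "\<beta> \<in> exps M ?N" for \<beta>
      proof (rule ext)
        fix k
        have "?mon \<beta> (k + m) = \<zero>" using mon_deg[OF that] size unfolding deg_le_def by (metis size_union add_leE)
        then show "u \<beta> m k = \<zero>\<^bsub>Poly (I - C)\<^esub> k" by (simp add: u_def coeff_at_app J.zero_app)
      qed
      then have "(v \<beta> \<otimes>\<^bsub>Poly (I - C)\<^esub> u \<beta> m) n' = \<zero>" if "\<beta> \<in> exps M ?N" for \<beta>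
        using that v(1) by (simp add: J.zero_app)
      then have "(\<Oplus>\<beta>\<in>exps M ?N. (v \<beta> \<otimes>\<^bsub>Poly (I - C)\<^esub> u \<beta> m) n') = \<zero>" by (rule add.finprod_one_eqI)
      then show ?thesis by simp
    qed
    finally show ?thesis .
  qed
  then have F: "?F \<in> coeff_ideal q"
    unfolding coeff_ideal_def using poly.finsum_closed[OF vmon] by blast
  have P0: "primeideal (P 0) (Poly I)" "P 0 \<subseteq> p" using P[of 0] by auto
  have hom: "ring_hom_cring R (Poly I) indexed_const"
    by (intro ring_hom_cring.intro ring_hom_cring_axioms.intro poly.is_cring is_cring const_hom)
  have c_sub: "{k \<in> carrier R. indexed_const k \<in> P 0} \<subseteq> q"
  proof
    fix k assume k: "k \<in> {k \<in> carrier R. indexed_const k \<in> P 0}"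
    then have "indexed_const k \<in> p" "indexed_const k \<in> carrier (Poly (I - C))" using P0(2) J.const_mem by blast+
    then have "indexed_const k \<in> coeff_ideal q" by (intro p)
    then show "k \<in> q" using const_mem_coeff_ideal[OF q.is_ideal] k by blast
  qed
  have "{k \<in> carrier R. indexed_const k \<in> P 0} = q"
    by (rule minimal[OF ring_hom_cring.primeideal_vimage[OF hom P0(1)] c_sub])
  then have qP: "coeff_ideal q \<subseteq> P 0"
    by (intro coeff_ideal_subset[OF q.is_ideal primeideal.axioms(1)[OF P0(1)]]) blast
  have "\<forall>\<beta>\<in>exps M (length xs). v \<beta> \<in> P 0"
  proof (rule poly.prime_chain_relation)
    show "primeideal (P i) (Poly I)" if "i \<le> length xs" for i using P[of i] that len by simp
    show "P i \<subseteq> P (Suc i)" if "i < length xs" for i using strict[of i] that len by auto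
    show "xs ! i \<in> P (Suc i) - P i" if "i < length xs" for i by (rule xs_nth[OF that])
    show "finsum (Poly I) (\<lambda>\<beta>. v \<beta> \<otimes>\<^bsub>Poly I\<^esub> ?mon \<beta>) (exps M (length xs)) \<in> P 0"
      unfolding len using F qP by blast
    fix \<beta> assume "\<beta> \<in> exps M (length xs)"
    then have v\<beta>: "v \<beta> \<in> carrier (Poly (I - C))" using v(1) len by simp
    have "v \<beta> \<in> P 0" if "v \<beta> \<in> P (length xs)"
      using that P[of "length xs"] p[OF v\<beta>] qP unfolding len by blast
    then show "v \<beta> \<in> carrier (Poly I) \<and> (v \<beta> \<in> P 0 \<or> v \<beta> \<notin> P (length xs))" using sub[OF v\<beta>] by blast
  qed
  then have "v \<beta> \<in> J.coeff_ideal q" if "\<beta> \<in> exps M ?N" for \<beta>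
    using that p[OF v(1)[OF that]] P0(2) unfolding len JI[OF v(1)[OF that]] by blast
  then show False using v(2) by blast
qed

definition pd :: "'c \<Rightarrow> ('c multiset \<Rightarrow> 'a) \<Rightarrow> ('c multiset \<Rightarrow> 'a)"
  where "pd x f = (\<lambda>m. [Suc (count m x)] \<cdot> f (add_mset x m))"

lemma pd_app: "pd x f m = [Suc (count m x)] \<cdot> f (add_mset x m)"
  by (simp add: pd_def)

lemma pd_closed:
  assumes f: "f \<in> carrier (Poly I)"
  shows "pd x f \<in> carrier (Poly I)"
proof (rule carrier_memI)
  have *: "pd x f m \<noteq> \<zero> \<Longrightarrow> shift x f m \<noteq> \<zero>" for m by (auto simp: pd_app shift_app)
  show "finite {m. pd x f m \<noteq> \<zero>}"
    by (rule finite_subset[OF _ finite_support[OF shift_closed[OF f, of x]]]) (use * in blast)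
  show "pd x f m \<in> carrier R" for m using coeff_closed[OF f] by (simp add: pd_app)
  show "set_mset m \<subseteq> I" if "pd x f m \<noteq> \<zero>" for m by (rule support_subset[OF shift_closed[OF f] *[OF that]])
qed

lemma pd_add:
  assumes "f \<in> carrier (Poly I)" "g \<in> carrier (Poly I)"
  shows "pd x (f \<oplus>\<^bsub>Poly I\<^esub> g) = pd x f \<oplus>\<^bsub>Poly I\<^esub> pd x g"
  by (rule ext, simp only: pd_app add_app, rule add.nat_pow_distrib)
    (rule coeff_closed[OF assms(1)], rule coeff_closed[OF assms(2)])

lemma pd_free:
  assumes "f \<in> carrier (Poly (I - {x}))"
  shows "pd x f = \<zero>\<^bsub>Poly I\<^esub>"
proof (rule ext)
  interpret J: poly_over R "I - {x}" ..
  fix m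
  have "f (add_mset x m) = \<zero>" using J.support_subset[OF assms, of "add_mset x m"] by auto
  then show "pd x f m = \<zero>\<^bsub>Poly I\<^esub> m" by (simp add: pd_app zero_app)
qed

lemma pd_const: "k \<in> carrier R \<Longrightarrow> pd x (indexed_const k) = \<zero>\<^bsub>Poly I\<^esub>"
  by (rule ext) (simp add: pd_app const_app zero_app)

lemma pd_mult_var:
  assumes f: "f \<in> carrier (Poly I)" and y: "y \<in> I"
  shows "pd x (f \<otimes>\<^bsub>Poly I\<^esub> indexed_var y)
    = pd x f \<otimes>\<^bsub>Poly I\<^esub> indexed_var y \<oplus>\<^bsub>Poly I\<^esub> (if x = y then f else \<zero>\<^bsub>Poly I\<^esub>)"
proof (rule ext)
  fix m
  note c = coeff_closed[OF f]
  show "pd x (f \<otimes>\<^bsub>Poly I\<^esub> indexed_var y) m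
    = (pd x f \<otimes>\<^bsub>Poly I\<^esub> indexed_var y \<oplus>\<^bsub>Poly I\<^esub> (if x = y then f else \<zero>\<^bsub>Poly I\<^esub>)) m"
  proof (cases "x = y")
    case True
    show ?thesis
    proof (cases "y \<in># m")
      case y: True
      have "add_mset y (m - {#y#}) = m" using y by simp
      moreover have "Suc (count (m - {#y#}) y) = count m y" using y by (simp add: Suc_diff_le)
      ultimately show ?thesis
        using True y c[of m] by (simp add: pd_app add_app var_mult_app[OF f] var_mult_app[OF pd_closed[OF f]])
    next
      case y: False
      then have "count m y = 0" by (simp add: not_in_iff)
      then show ?thesis
        using True y c[of m] by (simp add: pd_app add_app var_mult_app[OF f] var_mult_app[OF pd_closed[OF f]])
    qed
  next
    case False
    show ?thesis
    proof (cases "y \<in># m")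
      case y: True
      have "add_mset x m - {#y#} = add_mset x (m - {#y#})" using y False by simp
      then show ?thesis
        using False y c by (simp add: pd_app add_app zero_app var_mult_app[OF f] var_mult_app[OF pd_closed[OF f]])
    next
      case y: False
      then show ?thesis
        using False c by (simp add: pd_app add_app zero_app var_mult_app[OF f] var_mult_app[OF pd_closed[OF f]])
    qed
  qed
qed

lemma pd_mult:
  assumes f: "f \<in> carrier (Poly I)" and g: "g \<in> carrier (Poly I)"
  shows "pd x (f \<otimes>\<^bsub>Poly I\<^esub> g) = pd x f \<otimes>\<^bsub>Poly I\<^esub> g \<oplus>\<^bsub>Poly I\<^esub> f \<otimes>\<^bsub>Poly I\<^esub> pd x g"
  using g
proof (induct g rule: poly_induct)
  note pf = pd_closed[OF f]
  {
    case (const k)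
    have "pd x (f \<otimes>\<^bsub>Poly I\<^esub> indexed_const k) = pd x f \<otimes>\<^bsub>Poly I\<^esub> indexed_const k"
    proof (rule ext)
      fix m
      show "pd x (f \<otimes>\<^bsub>Poly I\<^esub> indexed_const k) m = (pd x f \<otimes>\<^bsub>Poly I\<^esub> indexed_const k) m"
        unfolding mult_const_app[OF pf const] pd_app mult_const_app[OF f const]
        by (rule add_pow_ldistr[symmetric]) (use coeff_closed[OF f] const in auto)
    qed
    then show ?case using f pf const_mem[OF const] by (simp add: pd_const[OF const])
  next
    case (add g h)
    note cl = f pf add(1,2) pd_closed[OF add(1), of x] pd_closed[OF add(2), of x]
    have "pd x (f \<otimes>\<^bsub>Poly I\<^esub> (g \<oplus>\<^bsub>Poly I\<^esub> h)) = pd x (f \<otimes>\<^bsub>Poly I\<^esub> g) \<oplus>\<^bsub>Poly I\<^esub> pd x (f \<otimes>\<^bsub>Poly I\<^esub> h)"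
      using cl by (simp add: poly.r_distr pd_add)
    then show ?case unfolding add(3,4) using cl by (simp add: poly.r_distr pd_add poly.a_ac)
  next
    case (mult g y)
    note v = var_mem[OF mult(3)]
    note cl = f pf mult(1) pd_closed[OF mult(1), of x] v
    have eq: "f \<otimes>\<^bsub>Poly I\<^esub> (g \<otimes>\<^bsub>Poly I\<^esub> indexed_var y) = (f \<otimes>\<^bsub>Poly I\<^esub> g) \<otimes>\<^bsub>Poly I\<^esub> indexed_var y"
      by (rule poly.m_assoc[symmetric, OF f mult(1) v])
    show ?case
      unfolding eq pd_mult_var[OF poly.m_closed[OF f mult(1)] mult(3)] pd_mult_var[OF mult(1,3)] mult(2)
      using cl by (cases "x = y") (simp_all add: poly.r_distr poly.l_distr poly.m_assoc poly.a_assoc)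
  }
qed

lemma pd_var_add_free:
  assumes "\<Delta> \<in> carrier (Poly (I - {x}))" "g \<in> carrier (Poly (I - {x}))" "x \<in> I"
  shows "pd x (\<Delta> \<otimes>\<^bsub>Poly I\<^esub> indexed_var x \<oplus>\<^bsub>Poly I\<^esub> g) = \<Delta>"
proof -
  have cl: "\<Delta> \<in> carrier (Poly I)" "g \<in> carrier (Poly I)" using assms(1,2) sub_carrier[of "I - {x}"] by blast+
  note v = var_mem[OF assms(3)]
  show ?thesis
    unfolding pd_add[OF poly.m_closed[OF cl(1) v] cl(2)] pd_mult_var[OF cl(1) assms(3)] pd_free[OF assms(1)] pd_free[OF assms(2)]
    using cl v by simp
qed

end

lemma (in prime_localization) min_gens_loc_at_ge:
  assumes I: "ideal I R" and W: "finite W"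
    and closed: "\<And>w f. w \<in> W \<Longrightarrow> f \<in> I \<Longrightarrow> \<phi> w f \<in> carrier R"
    and add: "\<And>w f g. w \<in> W \<Longrightarrow> f \<in> I \<Longrightarrow> g \<in> I \<Longrightarrow> \<phi> w (f \<oplus> g) = \<phi> w f \<oplus> \<phi> w g"
    and scale: "\<And>w u f. w \<in> W \<Longrightarrow> u \<in> carrier R \<Longrightarrow> f \<in> I \<Longrightarrow> \<exists>e\<in>p. \<phi> w (u \<otimes> f) = u \<otimes> \<phi> w f \<oplus> e"
    and h: "\<And>w. w \<in> W \<Longrightarrow> h w \<in> I"
    and diag: "\<And>w. w \<in> W \<Longrightarrow> \<phi> w (h w) \<notin> p"
    and off_diag: "\<And>w w'. w \<in> W \<Longrightarrow> w' \<in> W \<Longrightarrow> w \<noteq> w' \<Longrightarrow> \<phi> w (h w') \<in> p"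
  shows "enat (card W) \<le> min_gens (loc_at R p) (ideal_at R p I)"
proof (rule ccontr)
  interpret I: ideal I R by (rule I)
  assume "\<not> enat (card W) \<le> min_gens (loc_at R p) (ideal_at R p I)"
  then have "min_gens (loc_at R p) (ideal_at R p I) < enat (card W)" by simp
  then obtain k where k: "min_gens (loc_at R p) (ideal_at R p I) = enat k" "k < card W"
    by (cases "min_gens (loc_at R p) (ideal_at R p I)") auto
  then have "min_gens (loc_at R p) (ideal_at R p I) \<le> enat k" by simp
  from min_gens_loc_at_obtain[OF I this] obtain B where
    B: "finite B" "card B \<le> k" "B \<subseteq> I" and s: "\<And>f. f \<in> I \<Longrightarrow> \<exists>s\<in>carrier R - p. s \<otimes> f \<in> Idl B"
    by blast
  have "card B < card W" using B(2) k(2) by simp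
  then obtain v where v: "\<forall>w\<in>W. v w \<in> carrier R" "\<exists>w\<in>W. v w \<notin> p" "\<forall>b\<in>B. (\<Oplus>w\<in>W. v w \<otimes> \<phi> w b) \<in> p"
    using dependent_mod[OF B(1) W, of \<phi>] closed B(3) by blast
  let ?\<Lambda> = "\<lambda>f. \<Oplus>w\<in>W. v w \<otimes> \<phi> w f"
  have cl: "(\<lambda>w. v w \<otimes> \<phi> w f) \<in> W \<rightarrow> carrier R" if "f \<in> I" for f
    by (rule funcsetI, rule m_closed) (use v(1) in blast, rule closed[OF _ that])
  have \<Lambda>_closed: "?\<Lambda> f \<in> carrier R" if "f \<in> I" for f using finsum_closed[OF cl[OF that]] .
  have \<Lambda>_add: "?\<Lambda> (f \<oplus> g) = ?\<Lambda> f \<oplus> ?\<Lambda> g" if "f \<in> I" "g \<in> I" for f g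
  proof -
    have "?\<Lambda> (f \<oplus> g) = (\<Oplus>w\<in>W. v w \<otimes> \<phi> w f \<oplus> v w \<otimes> \<phi> w g)"
    proof (rule finsum_cong'[OF refl])
      show "(\<lambda>w. v w \<otimes> \<phi> w f \<oplus> v w \<otimes> \<phi> w g) \<in> W \<rightarrow> carrier R"
        by (rule funcsetI, rule add.m_closed) (rule funcset_mem[OF cl[OF that(1)]], assumption,
          rule funcset_mem[OF cl[OF that(2)]], assumption)
      fix w assume w: "w \<in> W"
      have "v w \<in> carrier R" using v(1) w by blast
      then show "v w \<otimes> \<phi> w (f \<oplus> g) = v w \<otimes> \<phi> w f \<oplus> v w \<otimes> \<phi> w g"
        unfolding add[OF w that] by (rule r_distr[OF closed[OF w that(1)] closed[OF w that(2)]])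
    qed
    then show ?thesis unfolding finsum_addf[OF cl[OF that(1)] cl[OF that(2)]] .
  qed
  have \<Lambda>_scale: "\<exists>e\<in>p. ?\<Lambda> (u \<otimes> f) = u \<otimes> ?\<Lambda> f \<oplus> e" if u: "u \<in> carrier R" and f: "f \<in> I" for u f
  proof -
    have "\<forall>w\<in>W. \<exists>e. e \<in> p \<and> \<phi> w (u \<otimes> f) = u \<otimes> \<phi> w f \<oplus> e" using scale[OF _ u f] by blast
    then obtain e where e: "\<And>w. w \<in> W \<Longrightarrow> e w \<in> p" "\<And>w. w \<in> W \<Longrightarrow> \<phi> w (u \<otimes> f) = u \<otimes> \<phi> w f \<oplus> e w"
      by (metis bchoice)
    have ve: "v w \<otimes> e w \<in> p" if "w \<in> W" for w using I_l_closed[OF e(1)[OF that]] v(1) that by simp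
    have c1: "(\<lambda>w. u \<otimes> (v w \<otimes> \<phi> w f)) \<in> W \<rightarrow> carrier R"
      by (rule funcsetI, rule m_closed[OF u], rule m_closed) (use v(1) in blast, rule closed[OF _ f])
    have c2: "(\<lambda>w. v w \<otimes> e w) \<in> W \<rightarrow> carrier R" by (rule funcsetI, rule Icarr, rule ve)
    have "?\<Lambda> (u \<otimes> f) = (\<Oplus>w\<in>W. u \<otimes> (v w \<otimes> \<phi> w f) \<oplus> v w \<otimes> e w)"
    proof (rule finsum_cong'[OF refl])
      show "(\<lambda>w. u \<otimes> (v w \<otimes> \<phi> w f) \<oplus> v w \<otimes> e w) \<in> W \<rightarrow> carrier R" 
        by (rule funcsetI, rule add.m_closed) (rule funcset_mem[OF c1], assumption, rule funcset_mem[OF c2], assumption)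
      fix w assume w: "w \<in> W"
      have "v w \<in> carrier R" using v(1) w by blast
      with closed[OF w f] Icarr[OF e(1)[OF w]]
      show "v w \<otimes> \<phi> w (u \<otimes> f) = u \<otimes> (v w \<otimes> \<phi> w f) \<oplus> v w \<otimes> e w"
        using u by (simp add: e(2)[OF w] r_distr m_lcomm)
    qed
    also have "\<dots> = (\<Oplus>w\<in>W. u \<otimes> (v w \<otimes> \<phi> w f)) \<oplus> (\<Oplus>w\<in>W. v w \<otimes> e w)" by (rule finsum_addf[OF c1 c2])
    also have "(\<Oplus>w\<in>W. u \<otimes> (v w \<otimes> \<phi> w f)) = u \<otimes> ?\<Lambda> f" by (rule finsum_rdistr[OF W u cl[OF f], symmetric])
    finally show ?thesis using finsum_mem[of W "\<lambda>w. v w \<otimes> e w"] ve by blast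
  qed
  have \<Lambda>_mem: "?\<Lambda> (u \<otimes> f) \<in> p \<longleftrightarrow> u \<otimes> ?\<Lambda> f \<in> p" if u: "u \<in> carrier R" and f: "f \<in> I" for u f
  proof -
    obtain e where e: "e \<in> p" "?\<Lambda> (u \<otimes> f) = u \<otimes> ?\<Lambda> f \<oplus> e" using \<Lambda>_scale[OF u f] by blast
    show ?thesis
    proof
      show "?\<Lambda> (u \<otimes> f) \<in> p" if "u \<otimes> ?\<Lambda> f \<in> p" unfolding e(2) by (rule additive_subgroup.a_closed[OF additive_subgroup_axioms that e(1)])
      assume "?\<Lambda> (u \<otimes> f) \<in> p"
      then have "u \<otimes> ?\<Lambda> f \<oplus> e \<in> p" by (simp only: e(2))
      then show "u \<otimes> ?\<Lambda> f \<in> p" by (rule add_mem_left[OF m_closed[OF u \<Lambda>_closed[OF f]] e(1)])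
    qed
  qed
  let ?K = "{f \<in> I. ?\<Lambda> f \<in> p}"
  have K_scale: "u \<otimes> f \<in> ?K" if "u \<in> carrier R" "f \<in> ?K" for u f
    using that \<Lambda>_mem[of u f] I_l_closed[of "?\<Lambda> f" u] I.I_l_closed[of f u] by simp
  have "ideal ?K R"
  proof (rule idealI[OF ring_axioms])
    show "subgroup ?K (add_monoid R)"
    proof (rule add.subgroupI)
      show "?K \<subseteq> carrier R" using I.Icarr by blast
      have "?\<Lambda> (\<zero> \<otimes> \<zero>) \<in> p" unfolding \<Lambda>_mem[OF I.Icarr[OF I.zero_closed] I.zero_closed]
        by (rule I_r_closed[OF zero_closed \<Lambda>_closed[OF I.zero_closed]])
      then have "\<zero> \<in> ?K" using I.zero_closed by simp
      then show "?K \<noteq> {}" by blast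
      show "\<ominus> f \<in> ?K" if "f \<in> ?K" for f
      proof -
        have "f \<in> carrier R" using that I.Icarr by blast
        then have "\<ominus> f = \<ominus> \<one> \<otimes> f" by (simp add: l_minus)
        moreover have "\<ominus> \<one> \<otimes> f \<in> ?K" by (rule K_scale[OF _ that]) simp
        ultimately show ?thesis by simp
      qed
      show "f \<oplus> g \<in> ?K" if "f \<in> ?K" "g \<in> ?K" for f g
        using that \<Lambda>_add[of f g] additive_subgroup.a_closed[OF additive_subgroup_axioms, of "?\<Lambda> f" "?\<Lambda> g"] I.a_closed[of f g] by simp
    qed
    show "u \<otimes> f \<in> ?K" if "f \<in> ?K" "u \<in> carrier R" for f u by (rule K_scale[OF that(2,1)])
    then show "f \<otimes> u \<in> ?K" if "f \<in> ?K" "u \<in> carrier R" for f u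
    proof -
      have "f \<in> carrier R" using that(1) I.Icarr by blast
      then have "f \<otimes> u = u \<otimes> f" using that(2) by (rule m_comm)
      then show ?thesis using K_scale[OF that(2,1)] by (simp only:)
    qed
  qed
  then have BK: "Idl B \<subseteq> ?K" by (rule genideal_minimal) (use B(3) v(3) in blast)
  obtain w where w: "w \<in> W" "v w \<notin> p" using v(2) by blast
  obtain s where s: "s \<in> carrier R - p" "s \<otimes> h w \<in> Idl B" using s[OF h[OF w(1)]] by blast
  have "s \<otimes> ?\<Lambda> (h w) \<in> p" using s BK \<Lambda>_mem[OF _ h[OF w(1)], of s] by blast
  then have mem: "?\<Lambda> (h w) \<in> p" using s(1) mult_mem_iff[OF _ \<Lambda>_closed[OF h[OF w(1)]]] by blast
  let ?rest = "\<Oplus>x\<in>W - {w}. v x \<otimes> \<phi> x (h w)"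
  have wc: "v w \<in> carrier R" "\<phi> w (h w) \<in> carrier R" using v(1) closed[OF w(1) h[OF w(1)]] w(1) by auto
  have "?\<Lambda> (h w) = (\<Oplus>x\<in>insert w (W - {w}). v x \<otimes> \<phi> x (h w))" using w(1) by (simp only: insert_Diff)
  also have "\<dots> = v w \<otimes> \<phi> w (h w) \<oplus> ?rest"
  proof (rule finsum_insert)
    show "(\<lambda>x. v x \<otimes> \<phi> x (h w)) \<in> W - {w} \<rightarrow> carrier R"
      by (rule funcsetI, rule funcset_mem[OF cl[OF h[OF w(1)]]]) simp
    show "v w \<otimes> \<phi> w (h w) \<in> carrier R" by (rule m_closed[OF wc])
  qed (use W in simp_all)
  finally have eq: "?\<Lambda> (h w) = v w \<otimes> \<phi> w (h w) \<oplus> ?rest" .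
  have "?rest \<in> p"
  proof (rule finsum_mem)
    fix x assume "x \<in> W - {w}"
    then show "v x \<otimes> \<phi> x (h w) \<in> p" using I_l_closed[OF off_diag[of x w]] v(1) w(1) by blast
  qed
  then have "v w \<otimes> \<phi> w (h w) \<in> p"
    by (rule add_mem_left[OF m_closed[OF wc] _ mem[unfolded eq]])
  then show False using mult_mem_iff[OF wc] w(2) diag[OF w(1)] by blast
qed

locale generic_symmetric = cring R for R (structure) + fixes n :: nat
begin

sublocale poly_over R "sym_indices n" ..

definition gmat :: "nat \<Rightarrow> nat \<Rightarrow> (nat \<times> nat) multiset \<Rightarrow> 'a"
  where "gmat i j = (if i < n \<and> j < n then generic_sym_matrix R i j else \<zero>\<^bsub>Poly (sym_indices n)\<^esub>)"

lemma gmat_var: "i < n \<Longrightarrow> j < n \<Longrightarrow> gmat i j = indexed_var (min i j, max i j)"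
  by (simp add: gmat_def generic_sym_matrix_def)

sublocale mat: sym_matrix "Poly (sym_indices n)" gmat
proof
  fix i j
  show "gmat i j \<in> carrier (Poly (sym_indices n))"
    using var_mem[of "(min i j, max i j)"] by (simp add: gmat_def generic_sym_matrix_def) (simp add: sym_indices_def)
  show "gmat i j = gmat j i" by (simp add: gmat_def generic_sym_matrix_def min.commute max.commute)
qed

lemma minors_eq: "minors (Poly (sym_indices n)) n t (generic_sym_matrix R)
    = {mat.minor t f g | f g. f \<in> selections t n \<and> g \<in> selections t n}"
proof -
  have eq: "mat_det (Poly (sym_indices n)) t (\<lambda>i j. generic_sym_matrix R (f i) (g j)) = mat.minor t f g"
    if "f \<in> selections t n" "g \<in> selections t n" for f g
  proof -
    have f: "f i < n" if "i < t" for i using \<open>f \<in> selections t n\<close> that by (auto simp: selections_def)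
    have g: "g i < n" if "i < t" for i using \<open>g \<in> selections t n\<close> that by (auto simp: selections_def)
    have gm: "gmat (f i) (g (\<sigma> i)) = generic_sym_matrix R (f i) (g (\<sigma> i))" if "\<sigma> permutes {..<t}" "i < t" for \<sigma> i
      using f[OF that(2)] g[of "\<sigma> i"] permutes_in_image[OF that(1), of i] that(2) by (simp add: gmat_def)
    have m: "gmat i j \<in> carrier (Poly (sym_indices n))" for i j by (rule mat.A_closed)
    show ?thesis
      unfolding mat.minor_def mat_det_def
    proof (rule poly.finsum_cong'[OF refl])
      show "(\<lambda>\<sigma>. [sign \<sigma>] \<cdot>\<^bsub>Poly (sym_indices n)\<^esub> (\<Otimes>\<^bsub>Poly (sym_indices n)\<^esub>i\<in>{..<t}. gmat (f i) (g (\<sigma> i))))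
        \<in> {\<sigma>. \<sigma> permutes {..<t}} \<rightarrow> carrier (Poly (sym_indices n))"
        using m by (intro funcsetI poly.add.int_pow_closed poly.finprod_closed)
      fix \<sigma> assume \<sigma>: "\<sigma> \<in> {\<sigma>. \<sigma> permutes {..<t}}"
      have "(\<Otimes>\<^bsub>Poly (sym_indices n)\<^esub>i\<in>{..<t}. generic_sym_matrix R (f i) (g (\<sigma> i)))
        = (\<Otimes>\<^bsub>Poly (sym_indices n)\<^esub>i\<in>{..<t}. gmat (f i) (g (\<sigma> i)))"
        by (rule poly.finprod_cong'[OF refl]) (use m gm \<sigma> in auto)
      then show "[sign \<sigma>] \<cdot>\<^bsub>Poly (sym_indices n)\<^esub> (\<Otimes>\<^bsub>Poly (sym_indices n)\<^esub>i\<in>{..<t}. generic_sym_matrix R (f i) (g (\<sigma> i)))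
        = [sign \<sigma>] \<cdot>\<^bsub>Poly (sym_indices n)\<^esub> (\<Otimes>\<^bsub>Poly (sym_indices n)\<^esub>i\<in>{..<t}. gmat (f i) (g (\<sigma> i)))" by (simp only:)
    qed
  qed
  show ?thesis
    unfolding minors_def
  proof (rule Collect_cong)
    fix y
    show "(\<exists>f g. y = mat_det (Poly (sym_indices n)) t (\<lambda>i j. generic_sym_matrix R (f i) (g j))
        \<and> f \<in> selections t n \<and> g \<in> selections t n)
      \<longleftrightarrow> (\<exists>f g. y = mat.minor t f g \<and> f \<in> selections t n \<and> g \<in> selections t n)"
    proof
      assume "\<exists>f g. y = mat_det (Poly (sym_indices n)) t (\<lambda>i j. generic_sym_matrix R (f i) (g j))
        \<and> f \<in> selections t n \<and> g \<in> selections t n"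
      then obtain f g where fg: "f \<in> selections t n" "g \<in> selections t n"
        and y: "y = mat_det (Poly (sym_indices n)) t (\<lambda>i j. generic_sym_matrix R (f i) (g j))" by blast
      show "\<exists>f g. y = mat.minor t f g \<and> f \<in> selections t n \<and> g \<in> selections t n"
        by (rule exI[of _ f], rule exI[of _ g]) (simp only: y eq[OF fg] fg)
    next
      assume "\<exists>f g. y = mat.minor t f g \<and> f \<in> selections t n \<and> g \<in> selections t n"
      then obtain f g where fg: "f \<in> selections t n" "g \<in> selections t n" and y: "y = mat.minor t f g" by blast
      show "\<exists>f g. y = mat_det (Poly (sym_indices n)) t (\<lambda>i j. generic_sym_matrix R (f i) (g j))
        \<and> f \<in> selections t n \<and> g \<in> selections t n"
        by (rule exI[of _ f], rule exI[of _ g]) (simp only: y eq[OF fg] fg)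
    qed
  qed
qed

abbreviation minor_idl :: "nat \<Rightarrow> ((nat \<times> nat) multiset \<Rightarrow> 'a) set"
  where "minor_idl t \<equiv> minor_ideal (Poly (sym_indices n)) n t (generic_sym_matrix R)"

lemma minors_sub: "minors (Poly (sym_indices n)) n t (generic_sym_matrix R) \<subseteq> carrier (Poly (sym_indices n))"
  unfolding minors_eq using mat.minor_closed by blast

lemma minor_idl_ideal: "ideal (minor_idl t) (Poly (sym_indices n))"
  unfolding minor_ideal_def by (rule poly.genideal_ideal[OF minors_sub])

lemma minor_mem_minor_idl:
  assumes "f ` {..<t} \<subseteq> {..<n}" "g ` {..<t} \<subseteq> {..<n}"
  shows "mat.minor t f g \<in> minor_idl t"
proof (rule mat.minor_mem_of_selections[OF minor_idl_ideal _ assms])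
  fix s s' assume "s \<in> selections t n" "s' \<in> selections t n"
  then have "mat.minor t s s' \<in> minors (Poly (sym_indices n)) n t (generic_sym_matrix R)"
    unfolding minors_eq by blast
  then show "mat.minor t s s' \<in> minor_idl t" unfolding minor_ideal_def by (rule subsetD[OF poly.genideal_self[OF minors_sub]])
qed

lemma minor_idl_subset:
  assumes "ideal J (Poly (sym_indices n))"
    and "\<And>f g. f ` {..<t} \<subseteq> {..<n} \<Longrightarrow> g ` {..<t} \<subseteq> {..<n} \<Longrightarrow> mat.minor t f g \<in> J"
  shows "minor_idl t \<subseteq> J"
  unfolding minor_ideal_def
  by (rule poly.genideal_minimal[OF assms(1)]) (use assms(2) in \<open>auto simp: minors_eq selections_def\<close>)

end

lemma card_le_pairs:
  fixes U :: "'c :: linorder set"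
  assumes "finite U"
  shows "finite {(i, j). i \<in> U \<and> j \<in> U \<and> i \<le> j}"
    and "card {(i, j). i \<in> U \<and> j \<in> U \<and> i \<le> j} = (card U + 1) choose 2"
proof -
  have fin: "finite {(i, j). i \<in> A \<and> j \<in> A \<and> i \<le> j}" if "finite A" for A :: "'c set"
    by (rule finite_subset[of _ "A \<times> A"]) (use that in auto)
  from fin[OF assms] show "finite {(i, j). i \<in> U \<and> j \<in> U \<and> i \<le> j}" .
  show "card {(i, j). i \<in> U \<and> j \<in> U \<and> i \<le> j} = (card U + 1) choose 2"
    using assms
  proof (induct U rule: finite_linorder_max_induct)
    case empty
    then show ?case by simp
  next
    case (insert b A)
    have bA: "b \<notin> A" using insert(2) by auto
    let ?N = "(\<lambda>i. (i, b)) ` insert b A"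
    have eq: "{(i, j). i \<in> insert b A \<and> j \<in> insert b A \<and> i \<le> j} = {(i, j). i \<in> A \<and> j \<in> A \<and> i \<le> j} \<union> ?N"
      using insert(2) by fastforce
    have "card ?N = card A + 1" using insert(1) bA by (subst card_image) (auto simp: inj_on_def)
    moreover have "{(i, j). i \<in> A \<and> j \<in> A \<and> i \<le> j} \<inter> ?N = {}" using bA by auto
    ultimately show ?case
      unfolding eq using card_Un_disjoint[OF fin[OF insert(1)], of ?N] insert(1,3) bA
      by (simp add: numeral_2_eq_2)
  qed
qed

lemma strict_mono_on_add_le:
  fixes s :: "nat \<Rightarrow> nat"
  assumes "strict_mono_on {..<m} s"
  shows "a + k < m \<Longrightarrow> s a + k \<le> s (a + k)"
proof (induct k)
  case (Suc k)
  then have "s (a + k) < s (a + Suc k)" using strict_mono_onD[OF assms, of "a + k" "a + Suc k"] by simp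
  then show ?case using Suc by simp
qed simp

lemma selections_full:
  assumes "s \<in> selections n n" "a < n"
  shows "s a = a"
proof -
  have s: "strict_mono_on {..<n} s" "s ` {..<n} \<subseteq> {..<n}" using assms(1) by (auto simp: selections_def)
  have "s 0 + a \<le> s (0 + a)" by (rule strict_mono_on_add_le[OF s(1)]) (use assms(2) in simp)
  moreover have "s a + (n - 1 - a) \<le> s (a + (n - 1 - a))"
    by (rule strict_mono_on_add_le[OF s(1)]) (use assms(2) in simp)
  moreover have "s (n - 1) < n" using s(2) assms(2) by (simp add: image_subset_iff)
  ultimately show ?thesis using assms(2) by simp
qed

lemma selections_corank_one:
  assumes "s \<in> selections (n - 1) n" "0 < n"
  obtains i where "i < n" "\<And>a. a < n - 1 \<Longrightarrow> s a = insert_index i a"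
proof -
  have s: "strict_mono_on {..<n - 1} s" "s ` {..<n - 1} \<subseteq> {..<n}" using assms(1) by (auto simp: selections_def)
  have lower: "a \<le> s a" if "a < n - 1" for a using strict_mono_on_add_le[OF s(1), of 0 a] that by simp
  have upper: "s a \<le> Suc a" if a: "a < n - 1" for a
  proof -
    have "s a + (n - 2 - a) \<le> s (a + (n - 2 - a))"
      by (rule strict_mono_on_add_le[OF s(1)]) (use a in simp)
    moreover have "s (n - 2) < n" using s(2) a by (auto simp: image_subset_iff)
    ultimately show ?thesis using a by simp
  qed
  define i where "i = (LEAST a. a = n - 1 \<or> s a \<noteq> a)"
  have i: "i = n - 1 \<or> s i \<noteq> i" unfolding i_def by (rule LeastI[of _ "n - 1"]) simp
  have "i \<le> n - 1" unfolding i_def by (rule Least_le) simp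
  have below: "s a = a" if "a < i" for a using not_less_Least[OF that[unfolded i_def]] by simp
  have "s a = insert_index i a" if a: "a < n - 1" for a
  proof (cases "a < i")
    case True
    then show ?thesis using below by (simp add: insert_index_def)
  next
    case False
    then have "s i \<noteq> i" "i < n - 1" using i a by auto
    then have "Suc i \<le> s i" using lower[of i] by simp
    moreover have "s i + (a - i) \<le> s (i + (a - i))"
      by (rule strict_mono_on_add_le[OF s(1)]) (use a False in simp)
    ultimately have "s a = Suc a" using upper[OF a] False by simp
    then show ?thesis using False by (simp add: insert_index_def)
  qed
  then show thesis using that[of i] \<open>i \<le> n - 1\<close> assms(2) by simp
qed

lemma image_fun_upd_lessThan_Suc:
  "f ` {..<r} \<subseteq> {..<n} \<Longrightarrow> i < (n::nat) \<Longrightarrow> (f(r := i)) ` {..<Suc r} \<subseteq> {..<n}"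
  by (simp add: image_subset_iff)

lemma not_inj_on_fun_upd:
  assumes "i \<in> f ` {..<r}"
  shows "\<not> inj_on (f(r := i)) {..<Suc r}"
proof
  assume inj: "inj_on (f(r := i)) {..<Suc r}"
  obtain a where a: "a < r" "i = f a" using assms by auto
  then have "(f(r := i)) a = (f(r := i)) r" by simp
  then have "a = r" by (rule inj_onD[OF inj]) (use a in auto)
  then show False using a by simp
qed

lemma (in cring) colon_ideal:
  assumes "ideal J R" "s \<in> carrier R"
  shows "ideal {f \<in> carrier R. s \<otimes> f \<in> J} R"
proof -
  interpret J: ideal J R by (rule assms(1))
  let ?K = "{f \<in> carrier R. s \<otimes> f \<in> J}"
  have scale: "u \<otimes> f \<in> ?K" if "u \<in> carrier R" "f \<in> ?K" for u f
    using that assms(2) J.I_l_closed[of "s \<otimes> f" u] by (simp add: m_lcomm)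
  show ?thesis
  proof (rule idealI[OF ring_axioms])
    show "subgroup ?K (add_monoid R)"
    proof (rule add.subgroupI)
      have "\<zero> \<in> ?K" using assms(2) by simp
      then show "?K \<noteq> {}" by blast
      show "\<ominus> f \<in> ?K" if "f \<in> ?K" for f
        using scale[OF _ that, of "\<ominus> \<one>"] that by (simp add: l_minus)
      show "f \<oplus> g \<in> ?K" if "f \<in> ?K" "g \<in> ?K" for f g using that assms(2) by (simp add: r_distr J.a_closed)
    qed auto
    show "u \<otimes> f \<in> ?K" if "f \<in> ?K" "u \<in> carrier R" for f u by (rule scale[OF that(2,1)])
    show "f \<otimes> u \<in> ?K" if "f \<in> ?K" "u \<in> carrier R" for f u
      using scale[OF that(2,1)] m_comm[of f u] that by simp
  qed
qed

context generic_symmetric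
begin

abbreviation SX :: "((nat \<times> nat) multiset \<Rightarrow> 'a) ring" where "SX \<equiv> Poly (sym_indices n)"

definition outside :: "(nat \<Rightarrow> nat) \<Rightarrow> nat \<Rightarrow> (nat \<times> nat) set"
  where "outside f r = {(i, j). i \<in> {..<n} - f ` {..<r} \<and> j \<in> {..<n} - f ` {..<r} \<and> i \<le> j}"

definition principal_rank :: "((nat \<times> nat) multiset \<Rightarrow> 'a) set \<Rightarrow> nat \<Rightarrow> (nat \<Rightarrow> nat) \<Rightarrow> bool"
  where "principal_rank p r f \<longleftrightarrow> f ` {..<r} \<subseteq> {..<n} \<and> mat.minor r f f \<notin> p \<and>
    (\<forall>i<n. \<forall>j<n. mat.minor (Suc r) (f(r := i)) (f(r := j)) \<in> p)"

lemma finite_sym_indices: "finite (sym_indices n)"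
  by (rule finite_subset[of _ "{..<n} \<times> {..<n}"]) (auto simp: sym_indices_def)

lemma outside_sub: "outside f r \<subseteq> sym_indices n"
  by (auto simp: outside_def sym_indices_def)

lemma finite_outside: "finite (outside f r)"
  by (rule finite_subset[OF outside_sub finite_sym_indices])

lemma card_outside:
  assumes "inj_on f {..<r}" "f ` {..<r} \<subseteq> {..<n}"
  shows "card (outside f r) = (n - r + 1) choose 2"
proof -
  have "card ({..<n} - f ` {..<r}) = n - r"
    using assms by (simp add: card_Diff_subset card_image)
  then show ?thesis unfolding outside_def by (subst card_le_pairs(2)) simp_all
qed

lemma gmat_free:
  assumes "i < n" "j < n" "(min i j, max i j) \<notin> C"
  shows "gmat i j \<in> carrier (Poly (sym_indices n - C))"
proof -
  interpret J: poly_over R "sym_indices n - C" ..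
  show ?thesis unfolding gmat_var[OF assms(1,2)]
    by (rule J.var_mem) (use assms in \<open>auto simp: sym_indices_def min_def max_def\<close>)
qed

lemma minor_free:
  assumes "f ` {..<t} \<subseteq> {..<n}" "g ` {..<t} \<subseteq> {..<n}"
    and "\<And>a b. a < t \<Longrightarrow> b < t \<Longrightarrow> (min (f a) (g b), max (f a) (g b)) \<notin> C"
  shows "mat.minor t f g \<in> carrier (Poly (sym_indices n - C))"
  by (rule mat.minor_mem_subring[OF sub_subring], blast, rule gmat_free) (use assms in auto)

lemma bordered_minor_eq:
  assumes f: "f ` {..<r} \<subseteq> {..<n}" and ij: "(i, j) \<in> outside f r"
  obtains g where "g \<in> carrier (Poly (sym_indices n - outside f r))"
    "mat.minor (Suc r) (f(r := i)) (f(r := j)) = mat.minor r f f \<otimes>\<^bsub>SX\<^esub> indexed_var (i, j) \<oplus>\<^bsub>SX\<^esub> g"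
proof -
  have ij': "i < n" "j < n" "i \<le> j" using ij by (auto simp: outside_def)
  have fa: "f a < n" if "a < r" for a using f that by auto
  have free: "gmat k l \<in> carrier (Poly (sym_indices n - outside f r))"
    if "k < n" "l < n" "k \<in> f ` {..<r} \<or> l \<in> f ` {..<r}" for k l
    by (rule gmat_free[OF that(1,2)]) (use that(3) in \<open>auto simp: outside_def min_def max_def\<close>)
  obtain g where "g \<in> carrier (Poly (sym_indices n - outside f r))"
    "mat.minor (Suc r) (f(r := i)) (f(r := j)) = mat.minor r f f \<otimes>\<^bsub>SX\<^esub> gmat i j \<oplus>\<^bsub>SX\<^esub> g"
    by (rule mat.minor_last_row[OF sub_subring, of "sym_indices n - outside f r" r f f j i])
      (use free fa ij' in auto)
  then show thesis using that gmat_var[OF ij'(1,2)] ij'(3) by (simp add: min_def max_def)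
qed

lemma principal_minor_free:
  assumes "f ` {..<r} \<subseteq> {..<n}"
  shows "mat.minor r f f \<in> carrier (Poly (sym_indices n - outside f r))"
  by (rule minor_free[OF assms assms]) (auto simp: outside_def min_def max_def)

lemma minor_0: "mat.minor 0 f g = \<one>\<^bsub>SX\<^esub>"
proof -
  have "{\<sigma>. \<sigma> permutes {..<0::nat}} = {id}" by auto
  then show ?thesis by (simp add: mat.minor_def mat_det_def poly.add_pow_int_one)
qed

lemma principal_rank_exists:
  assumes p: "primeideal p SX" and t: "minor_idl t \<subseteq> p"
  obtains r f where "r < t" "principal_rank p r f"
proof -
  interpret p: primeideal p SX by (rule p)
  define Q where "Q r \<longleftrightarrow> (\<exists>f. f ` {..<r} \<subseteq> {..<n} \<and> mat.minor r f f \<notin> p)" for r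
  have Q0: "Q 0" unfolding Q_def minor_0 using p.one_notin by auto
  have Qt: "\<not> Q t" unfolding Q_def using minor_mem_minor_idl t by blast
  have "t \<noteq> 0" using Q0 Qt by (rule_tac notI) simp
  then have ne: "{r. r < t \<and> Q r} \<noteq> {}" using Q0 by auto
  have fin: "finite {r. r < t \<and> Q r}" by simp
  define r where "r = Max {r. r < t \<and> Q r}"
  have r: "r < t" "Q r" using Max_in[OF fin ne] by (auto simp: r_def)
  have max: "\<not> Q r'" if "r < r'" "r' \<le> t" for r'
  proof
    assume "Q r'"
    then have "r' \<noteq> t" using Qt by auto
    then have "r' \<in> {r. r < t \<and> Q r}" using that \<open>Q r'\<close> by simp
    then have "r' \<le> r" unfolding r_def by (rule Max_ge[OF fin])
    then show False using that by simp
  qed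
  obtain f where f: "f ` {..<r} \<subseteq> {..<n}" "mat.minor r f f \<notin> p" using r(2) Q_def by auto
  note up = image_fun_upd_lessThan_Suc[OF f(1)]
  have "mat.minor (Suc r) (f(r := i)) (f(r := j)) \<in> p" if ij: "i < n" "j < n" for i j
  proof (cases "Suc r = t")
    case True
    then show ?thesis using minor_mem_minor_idl[OF up[OF ij(1)] up[OF ij(2)]] t by blast
  next
    case False
    then have "\<not> Q (Suc r)" "\<not> Q (Suc (Suc r))" using max[of "Suc r"] max[of "Suc (Suc r)"] r(1) by auto
    then have "mat.minor (Suc r) (f(r := i)) (f(r := i)) \<in> p"
      "mat.minor (Suc (Suc r)) (f(r := i, Suc r := j)) (f(r := i, Suc r := j)) \<in> p"
      unfolding Q_def using up[OF ij(1)] image_fun_upd_lessThan_Suc[OF up[OF ij(1)] ij(2)] by blast+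
    then show ?thesis by (rule mat.bordered_minor_mem_of_principal[OF p f(2)])
  qed
  then show thesis using that[OF r(1), of f] f by (simp add: principal_rank_def)
qed

context
  fixes p r f
  assumes p: "primeideal p SX" and rank: "principal_rank p r f"
begin

interpretation p: prime_localization SX p
  by (rule prime_localization.intro[OF poly.is_cring p])

lemma rank_facts:
  shows rank_image: "f ` {..<r} \<subseteq> {..<n}" and rank_notin: "mat.minor r f f \<notin> p"
    and rank_bordered: "\<And>i j. i < n \<Longrightarrow> j < n \<Longrightarrow> mat.minor (Suc r) (f(r := i)) (f(r := j)) \<in> p"
  using rank unfolding principal_rank_def by blast+

lemma rank_inj: "inj_on f {..<r}"
proof (rule ccontr)
  assume "\<not> inj_on f {..<r}"
  then have "mat.minor r f f = \<zero>\<^bsub>SX\<^esub>" using mat.minor_noninj by blast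
  then show False using rank_notin additive_subgroup.zero_closed[OF ideal.axioms(1)[OF primeideal.axioms(1)[OF p]]]
    by simp
qed

lemma rank_pow: "mat.minor r f f [^]\<^bsub>SX\<^esub> (k::nat) \<in> carrier SX - p"
  using primeideal.pow_mem[OF p mat.minor_closed, of r f f k] rank_notin mat.minor_closed
    poly.nat_pow_closed by blast

lemma rank_pow_pow: "(mat.minor r f f [^]\<^bsub>SX\<^esub> (k::nat)) [^]\<^bsub>SX\<^esub> (l::nat) \<in> carrier SX - p"
  using rank_pow[of "k * l"] poly.nat_pow_pow[OF mat.minor_closed, of r f f k l] by simp

lemma krull_dim_ge: "enat ((n - r + 1) choose 2) \<le> krull_dim (loc_at SX p)"
proof -
  have "\<exists>g\<in>carrier (Poly (sym_indices n - outside f r)).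
      mat.minor r f f \<otimes>\<^bsub>SX\<^esub> indexed_var c \<oplus>\<^bsub>SX\<^esub> g \<in> p" if "c \<in> outside f r" for c
  proof -
    obtain i j where c: "c = (i, j)" by (cases c)
    have mem: "(i, j) \<in> outside f r" using that by (simp only: c)
    then have ij: "i < n" "j < n" by (auto simp: outside_def)
    obtain g where "g \<in> carrier (Poly (sym_indices n - outside f r))"
      "mat.minor (Suc r) (f(r := i)) (f(r := j)) = mat.minor r f f \<otimes>\<^bsub>SX\<^esub> indexed_var (i, j) \<oplus>\<^bsub>SX\<^esub> g"
      by (rule bordered_minor_eq[OF rank_image mem])
    then show ?thesis using rank_bordered[OF ij] unfolding c by (intro bexI[of _ g]) simp_all
  qed
  then obtain P where P: "\<forall>i\<le>card (outside f r). primeideal (P i) SX \<and> P i \<subseteq> p"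
    "\<forall>i<card (outside f r). P i \<subset> P (Suc i)"
    using prime_chain_below[OF finite_outside outside_sub p principal_minor_free[OF rank_image] rank_notin] by blast
  have "enat (card (outside f r)) \<le> krull_dim (loc_at SX p)"
    by (rule p.krull_dim_loc_at_ge[of _ P]) (use P in auto)
  then show ?thesis by (simp only: card_outside[OF rank_inj rank_image])
qed

lemma min_gens_le:
  assumes g: "\<And>i j. (i, j) \<in> outside f r \<Longrightarrow> g i j \<in> minor_idl t" and s: "s \<in> carrier SX - p"
    and h: "\<And>a b J. a \<in> selections t n \<Longrightarrow> b \<in> selections t n \<Longrightarrow> ideal J SX
      \<Longrightarrow> (\<And>i j. (i, j) \<in> outside f r \<Longrightarrow> g i j \<in> J) \<Longrightarrow> s \<otimes>\<^bsub>SX\<^esub> mat.minor t a b \<in> J"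
  shows "min_gens (loc_at SX p) (ideal_at SX p (minor_idl t)) \<le> enat ((n - r + 1) choose 2)"
proof -
  define B where "B = (\<lambda>(i, j). g i j) ` outside f r"
  have fB: "finite B" unfolding B_def by (rule finite_imageI[OF finite_outside])
  have BI: "B \<subseteq> minor_idl t" using g by (auto simp: B_def)
  have Bc: "B \<subseteq> carrier SX" using BI ideal.Icarr[OF minor_idl_ideal] by blast
  let ?K = "{h \<in> carrier SX. s \<otimes>\<^bsub>SX\<^esub> h \<in> Idl\<^bsub>SX\<^esub> B}"
  have K: "ideal ?K SX" by (rule poly.colon_ideal[OF poly.genideal_ideal[OF Bc]]) (use s in blast)
  have "minor_idl t \<subseteq> ?K"
    unfolding minor_ideal_def
  proof (rule poly.genideal_minimal[OF K], rule subsetI)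
    fix x assume "x \<in> minors SX n t (generic_sym_matrix R)"
    then obtain a b where ab: "x = mat.minor t a b" "a \<in> selections t n" "b \<in> selections t n"
      unfolding minors_eq by blast
    have "s \<otimes>\<^bsub>SX\<^esub> mat.minor t a b \<in> Idl\<^bsub>SX\<^esub> B"
    proof (rule h[OF ab(2,3) poly.genideal_ideal[OF Bc]])
      fix i j assume "(i, j) \<in> outside f r"
      then have "g i j \<in> B" unfolding B_def by (intro image_eqI[of _ _ "(i, j)"]) simp_all
      then show "g i j \<in> Idl\<^bsub>SX\<^esub> B" using poly.genideal_self[OF Bc] by blast
    qed
    then show "x \<in> ?K" using mat.minor_closed by (simp add: ab(1))
  qed
  then have "min_gens (loc_at SX p) (ideal_at SX p (minor_idl t)) \<le> enat (card B)"
    using s by (intro p.min_gens_loc_at_le[OF minor_idl_ideal fB BI]) blast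
  also have "card B \<le> card (outside f r)" unfolding B_def by (rule card_image_le[OF finite_outside])
  finally show ?thesis by (simp add: card_outside[OF rank_inj rank_image])
qed

lemma min_gens_le_Suc: "min_gens (loc_at SX p) (ideal_at SX p (minor_idl (Suc r))) \<le> enat ((n - r + 1) choose 2)"
proof (rule min_gens_le)
  fix i j assume "(i, j) \<in> outside f r"
  then have "i < n" "j < n" by (auto simp: outside_def)
  then show "mat.minor (Suc r) (f(r := i)) (f(r := j)) \<in> minor_idl (Suc r)"
    using minor_mem_minor_idl image_fun_upd_lessThan_Suc[OF rank_image] by simp
next
  show "(mat.minor r f f [^]\<^bsub>SX\<^esub> (2::nat)) [^]\<^bsub>SX\<^esub> Suc r \<in> carrier SX - p" by (rule rank_pow_pow)
next
  fix a b J
  assume a: "a \<in> selections (Suc r) n" and b: "b \<in> selections (Suc r) n" and J: "ideal J SX"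
    and gen: "\<And>i j. (i, j) \<in> outside f r \<Longrightarrow> mat.minor (Suc r) (f(r := i)) (f(r := j)) \<in> J"
  have zero: "\<zero>\<^bsub>SX\<^esub> \<in> J" by (rule additive_subgroup.zero_closed[OF ideal.axioms(1)[OF J]])
  have border: "mat.minor (Suc r) (f(r := i)) (f(r := j)) \<in> J" if ij: "i < n" "j < n" for i j
  proof (cases "i \<in> f ` {..<r} \<or> j \<in> f ` {..<r}")
    case True
    then have "\<not> inj_on (f(r := i)) {..<Suc r} \<or> \<not> inj_on (f(r := j)) {..<Suc r}"
      using not_inj_on_fun_upd[of i f r] not_inj_on_fun_upd[of j f r] by blast
    then have "mat.minor (Suc r) (f(r := i)) (f(r := j)) = \<zero>\<^bsub>SX\<^esub>" by (rule mat.minor_noninj)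
    then show ?thesis using zero by (simp only:)
  next
    case False
    then consider "(i, j) \<in> outside f r" | "(j, i) \<in> outside f r" using ij linear[of i j] by (auto simp: outside_def)
    then show ?thesis
    proof cases
      case 1
      then show ?thesis by (rule gen)
    next
      case 2
      then show ?thesis unfolding mat.minor_commute[of "Suc r" "f(r := i)" "f(r := j)"] by (rule gen)
    qed
  qed
  show "(mat.minor r f f [^]\<^bsub>SX\<^esub> (2::nat)) [^]\<^bsub>SX\<^esub> Suc r \<otimes>\<^bsub>SX\<^esub> mat.minor (Suc r) a b \<in> J"
    by (rule mat.minor_mem_of_bordered[OF J lessI]) (rule border; use a b in \<open>auto simp: selections_def\<close>)
qed

lemma min_gens_le_corank_one:
  assumes "r < n"
  shows "min_gens (loc_at SX p) (ideal_at SX p (minor_idl (n - 1))) \<le> enat ((n - r + 1) choose 2)"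
proof (rule min_gens_le)
  fix i j assume "(i, j) \<in> outside f r"
  then have "i < n" "j < n" by (auto simp: outside_def)
  then show "mat.minor (n - 1) (insert_index i) (insert_index j) \<in> minor_idl (n - 1)"
    by (intro minor_mem_minor_idl) (auto simp: insert_index_def)
next
  show "mat.minor r f f [^]\<^bsub>SX\<^esub> (2::nat) \<in> carrier SX - p" by (rule rank_pow)
next
  fix a b J
  assume a: "a \<in> selections (n - 1) n" and b: "b \<in> selections (n - 1) n" and J: "ideal J SX"
    and gen: "\<And>i j. (i, j) \<in> outside f r \<Longrightarrow> mat.minor (n - 1) (insert_index i) (insert_index j) \<in> J"
  have n: "0 < n" using assms by simp
  obtain i where i: "i < n" "\<And>k. k < n - 1 \<Longrightarrow> a k = insert_index i k" using selections_corank_one[OF a n] by blast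
  obtain j where j: "j < n" "\<And>k. k < n - 1 \<Longrightarrow> b k = insert_index j k" using selections_corank_one[OF b n] by blast
  have "mat.minor (n - 1) a b = mat.minor (n - 1) (insert_index i) (insert_index j)"
    by (rule mat.minor_cong[OF i(2) j(2)])
  moreover have "mat.minor r f f [^]\<^bsub>SX\<^esub> (2::nat) \<otimes>\<^bsub>SX\<^esub> mat.minor (n - 1) (insert_index i) (insert_index j) \<in> J"
  proof (rule mat.maximal_minor_mem[OF J rank_inj rank_image assms _ i(1) j(1)])
    fix k l assume "k \<in> {..<n} - f ` {..<r}" "l \<in> {..<n} - f ` {..<r}"
    then consider "(k, l) \<in> outside f r" | "(l, k) \<in> outside f r" using linear[of k l] by (auto simp: outside_def)
    then show "mat.minor (n - 1) (insert_index k) (insert_index l) \<in> J"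
    proof cases
      case 1
      then show ?thesis by (rule gen)
    next
      case 2
      then show ?thesis unfolding mat.minor_commute[of "n - 1" "insert_index k" "insert_index l"] by (rule gen)
    qed
  qed
  ultimately show "mat.minor r f f [^]\<^bsub>SX\<^esub> (2::nat) \<otimes>\<^bsub>SX\<^esub> mat.minor (n - 1) a b \<in> J" by (simp only:)
qed

lemma min_gens_le_full: "min_gens (loc_at SX p) (ideal_at SX p (minor_idl n)) \<le> 1"
proof -
  let ?B = "{mat.minor n id id}"
  have Bc: "?B \<subseteq> carrier SX" using mat.minor_closed by blast
  have "mat.minor n a b = mat.minor n id id" if "a \<in> selections n n" "b \<in> selections n n" for a b
    by (rule mat.minor_cong) (use that selections_full in auto)
  then have "minors SX n n (generic_sym_matrix R) \<subseteq> ?B" unfolding minors_eq by blast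
  then have sub: "minor_idl n \<subseteq> Idl\<^bsub>SX\<^esub> ?B"
    unfolding minor_ideal_def using poly.genideal_self[OF Bc]
    by (intro poly.genideal_minimal[OF poly.genideal_ideal[OF Bc]]) blast
  have "min_gens (loc_at SX p) (ideal_at SX p (minor_idl n)) \<le> enat (card ?B)"
  proof (rule p.min_gens_loc_at_le[OF minor_idl_ideal])
    show "finite ?B" by simp
    show "?B \<subseteq> minor_idl n" using minor_mem_minor_idl[of id n id] by simp
    fix h assume "h \<in> minor_idl n"
    then have "h \<in> Idl\<^bsub>SX\<^esub> ?B" "h \<in> carrier SX" using sub ideal.Icarr[OF minor_idl_ideal] by blast+
    then have "\<one>\<^bsub>SX\<^esub> \<otimes>\<^bsub>SX\<^esub> h \<in> Idl\<^bsub>SX\<^esub> ?B" by simp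
    then show "\<exists>s\<in>carrier SX - p. s \<otimes>\<^bsub>SX\<^esub> h \<in> Idl\<^bsub>SX\<^esub> ?B" using p.M_one by blast
  qed
  then show ?thesis by (simp add: one_enat_def)
qed

lemma min_gens_le_krull_dim:
  assumes "r < t" "t \<le> n" "t = Suc r \<or> t = n \<or> t = n - 1"
  shows "min_gens (loc_at SX p) (ideal_at SX p (minor_idl t)) \<le> krull_dim (loc_at SX p)"
proof (cases "t = n")
  case True
  then have "2 \<le> n - r + 1" using assms by simp
  then have "0 < (n - r + 1) choose 2" by (rule zero_less_binomial)
  then have "1 \<le> (n - r + 1) choose 2" by linarith
  then have "1 \<le> enat ((n - r + 1) choose 2)" by (simp only: one_enat_def enat_ord_simps)
  then show ?thesis using min_gens_le_full krull_dim_ge unfolding True by (meson order_trans)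
next
  case False
  then have "t = Suc r \<or> t = n - 1" "r < n" using assms by auto
  then have "min_gens (loc_at SX p) (ideal_at SX p (minor_idl t)) \<le> enat ((n - r + 1) choose 2)"
    using min_gens_le_Suc min_gens_le_corank_one by blast
  then show ?thesis using krull_dim_ge by (rule order_trans)
qed

end

end

lemma (in cring) mat_det_identity: "mat_det R t (\<lambda>i j. if i = j then \<one> else \<zero>) = \<one>"
proof -
  let ?E = "\<lambda>i j. if i = j then 1 else 0 :: (nat \<Rightarrow>\<^sub>0 nat) \<Rightarrow>\<^sub>0 int"
  have one: "\<And>i::nat. (\<lambda>_. \<one>) i \<in> carrier R" by simp
  have "fdet t ?E = 1" unfolding fdet_def one_mat_def[symmetric] by (rule det_one)
  then have "int_eval (\<lambda>_. \<one>) 1 = mat_det R t (\<lambda>i j. int_eval (\<lambda>_. \<one>) (?E i j))"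
    using int_eval_fdet[where x = "\<lambda>_. \<one>", OF one, of t ?E] by (simp only:)
  moreover have "int_eval (\<lambda>_. \<one>) (?E i j) = (if i = j then \<one> else \<zero>)" for i j :: nat
    using int_eval_one[where x = "\<lambda>_. \<one>", OF one] int_eval_zero[where x = "\<lambda>_. \<one>", OF one] by simp
  ultimately show ?thesis using int_eval_one[where x = "\<lambda>_. \<one>", OF one] by simp
qed

lemma (in ring_hom_cring) hom_mat_det:
  assumes M: "\<And>i j. M i j \<in> carrier R"
  shows "h (mat_det R t M) = mat_det S t (\<lambda>i j. h (M i j))"
proof -
  have sgn: "h ([sign \<sigma>] \<cdot>\<^bsub>R\<^esub> x) = [sign \<sigma>] \<cdot>\<^bsub>S\<^esub> h x" if x: "x \<in> carrier R" for \<sigma> :: "nat \<Rightarrow> nat" and x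
  proof (cases "sign \<sigma> = 1")
    case True
    then show ?thesis using x by (simp add: R.add_pow_int_one S.add_pow_int_one)
  next
    case False
    then have "sign \<sigma> = - 1" by (auto simp: sign_def split: if_splits)
    then show ?thesis using x by (simp add: R.add_pow_int_neg_one S.add_pow_int_neg_one)
  qed
  have prod: "(\<Otimes>\<^bsub>R\<^esub>i\<in>{..<t}. M i (\<sigma> i)) \<in> carrier R" for \<sigma> by (rule R.finprod_closed) (use M in simp)
  have "h (mat_det R t M) = (\<Oplus>\<^bsub>S\<^esub>\<sigma>\<in>{\<sigma>. \<sigma> permutes {..<t}}. h ([sign \<sigma>] \<cdot>\<^bsub>R\<^esub> (\<Otimes>\<^bsub>R\<^esub>i\<in>{..<t}. M i (\<sigma> i))))"
    unfolding mat_det_def using prod R.add.int_pow_closed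
    by (subst hom_finsum) (simp_all add: o_def)
  also have "\<dots> = mat_det S t (\<lambda>i j. h (M i j))"
    unfolding mat_det_def
  proof (rule S.finsum_cong'[OF refl])
    show "(\<lambda>\<sigma>. [sign \<sigma>] \<cdot>\<^bsub>S\<^esub> (\<Otimes>\<^bsub>S\<^esub>i\<in>{..<t}. h (M i (\<sigma> i)))) \<in> {\<sigma>. \<sigma> permutes {..<t}} \<rightarrow> carrier S"
      by (intro funcsetI S.add.int_pow_closed S.finprod_closed) (use M in simp)
    fix \<sigma>
    have "h (\<Otimes>\<^bsub>R\<^esub>i\<in>{..<t}. M i (\<sigma> i)) = (\<Otimes>\<^bsub>S\<^esub>i\<in>{..<t}. h (M i (\<sigma> i)))"
      by (subst hom_finprod) (use M in \<open>simp_all add: o_def\<close>)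
    then show "h ([sign \<sigma>] \<cdot>\<^bsub>R\<^esub> (\<Otimes>\<^bsub>R\<^esub>i\<in>{..<t}. M i (\<sigma> i))) = [sign \<sigma>] \<cdot>\<^bsub>S\<^esub> (\<Otimes>\<^bsub>S\<^esub>i\<in>{..<t}. h (M i (\<sigma> i)))"
      by (simp only: sgn[OF prod])
  qed
  finally show ?thesis .
qed

context poly_over
begin

lemma pd_zero: "pd x \<zero>\<^bsub>Poly I\<^esub> = \<zero>\<^bsub>Poly I\<^esub>"
  by (rule ext) (simp add: pd_app zero_app)

definition critical :: "('c multiset \<Rightarrow> 'a) set \<Rightarrow> ('c multiset \<Rightarrow> 'a) set"
  where "critical p = {f \<in> p. \<forall>x. pd x f \<in> p}"

context
  fixes p
  assumes p: "primeideal p (Poly I)"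
begin

interpretation p: primeideal p "Poly I" by (rule p)

lemma pd_mult_mem:
  assumes "u \<in> carrier (Poly I)" "f \<in> p"
  shows "pd x (u \<otimes>\<^bsub>Poly I\<^esub> f) \<in> p \<longleftrightarrow> u \<otimes>\<^bsub>Poly I\<^esub> pd x f \<in> p"
proof -
  note fc = p.Icarr[OF assms(2)]
  have 1: "pd x u \<otimes>\<^bsub>Poly I\<^esub> f \<in> p" by (rule p.I_l_closed[OF assms(2) pd_closed[OF assms(1)]])
  note c = poly.m_closed[OF assms(1) pd_closed[OF fc, of x]]
  have eq: "pd x (u \<otimes>\<^bsub>Poly I\<^esub> f) = u \<otimes>\<^bsub>Poly I\<^esub> pd x f \<oplus>\<^bsub>Poly I\<^esub> pd x u \<otimes>\<^bsub>Poly I\<^esub> f"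
    unfolding pd_mult[OF assms(1) fc] by (rule poly.a_comm[OF p.Icarr[OF 1] c])
  show ?thesis
  proof
    assume "pd x (u \<otimes>\<^bsub>Poly I\<^esub> f) \<in> p"
    then show "u \<otimes>\<^bsub>Poly I\<^esub> pd x f \<in> p" unfolding eq by (rule p.add_mem_left[OF c 1])
  next
    assume "u \<otimes>\<^bsub>Poly I\<^esub> pd x f \<in> p"
    then show "pd x (u \<otimes>\<^bsub>Poly I\<^esub> f) \<in> p" unfolding eq by (rule p.a_closed[OF _ 1])
  qed
qed

lemma critical_scale:
  assumes "u \<in> carrier (Poly I)" "f \<in> critical p"
  shows "u \<otimes>\<^bsub>Poly I\<^esub> f \<in> critical p"
proof -
  have f: "f \<in> p" "\<And>x. pd x f \<in> p" using assms(2) by (auto simp: critical_def)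
  have "pd x (u \<otimes>\<^bsub>Poly I\<^esub> f) \<in> p" for x
    unfolding pd_mult_mem[OF assms(1) f(1)] by (rule p.I_l_closed[OF f(2) assms(1)])
  then show ?thesis using p.I_l_closed[OF f(1) assms(1)] by (simp add: critical_def)
qed

lemma critical_ideal: "ideal (critical p) (Poly I)"
proof (rule idealI[OF poly.ring_axioms])
  have sub: "critical p \<subseteq> carrier (Poly I)" using p.Icarr by (auto simp: critical_def)
  have zero: "\<zero>\<^bsub>Poly I\<^esub> \<in> critical p" using p.zero_closed by (simp add: critical_def pd_zero)
  show "subgroup (critical p) (add_monoid (Poly I))"
  proof (rule poly.add.subgroupI)
    show "critical p \<subseteq> carrier (Poly I)" by (rule sub)
    show "critical p \<noteq> {}" using zero by blast
    show "\<ominus>\<^bsub>Poly I\<^esub> f \<in> critical p" if "f \<in> critical p" for f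
    proof -
      have "f \<in> carrier (Poly I)" using that sub by blast
      then have "\<ominus>\<^bsub>Poly I\<^esub> f = \<ominus>\<^bsub>Poly I\<^esub> \<one>\<^bsub>Poly I\<^esub> \<otimes>\<^bsub>Poly I\<^esub> f" by (simp add: poly.l_minus)
      moreover have "\<ominus>\<^bsub>Poly I\<^esub> \<one>\<^bsub>Poly I\<^esub> \<otimes>\<^bsub>Poly I\<^esub> f \<in> critical p" by (rule critical_scale[OF _ that]) simp
      ultimately show ?thesis by simp
    qed
    show "f \<oplus>\<^bsub>Poly I\<^esub> g \<in> critical p" if f: "f \<in> critical p" and g: "g \<in> critical p" for f g
    proof -
      have "f \<in> p" "g \<in> p" "\<And>x. pd x f \<in> p" "\<And>x. pd x g \<in> p" using f g by (auto simp: critical_def)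
      moreover have "pd x (f \<oplus>\<^bsub>Poly I\<^esub> g) = pd x f \<oplus>\<^bsub>Poly I\<^esub> pd x g" for x
        using f g sub by (intro pd_add) blast+
      ultimately show ?thesis using p.a_closed by (simp add: critical_def)
    qed
  qed
  show "u \<otimes>\<^bsub>Poly I\<^esub> f \<in> critical p" if "f \<in> critical p" "u \<in> carrier (Poly I)" for f u
    by (rule critical_scale[OF that(2,1)])
  show "f \<otimes>\<^bsub>Poly I\<^esub> u \<in> critical p" if "f \<in> critical p" "u \<in> carrier (Poly I)" for f u
  proof -
    have "f \<in> carrier (Poly I)" using that(1) sub by blast
    then have "f \<otimes>\<^bsub>Poly I\<^esub> u = u \<otimes>\<^bsub>Poly I\<^esub> f" using that(2) by (rule poly.m_comm)
    then show ?thesis using critical_scale[OF that(2,1)] by (simp only:)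
  qed
qed

lemma mult_mem_critical:
  assumes "f \<in> p" "g \<in> p"
  shows "f \<otimes>\<^bsub>Poly I\<^esub> g \<in> critical p"
proof -
  have "pd x (f \<otimes>\<^bsub>Poly I\<^esub> g) \<in> p" for x
    unfolding pd_mult_mem[OF p.Icarr[OF assms(1)] assms(2)]
    by (rule p.I_r_closed[OF assms(1) pd_closed[OF p.Icarr[OF assms(2)]]])
  then show ?thesis using p.I_l_closed[OF assms(2) p.Icarr[OF assms(1)]] by (simp add: critical_def)
qed

lemma mem_critical_of_scale:
  assumes "u \<in> carrier (Poly I)" "u \<notin> p" "f \<in> carrier (Poly I)" "u \<otimes>\<^bsub>Poly I\<^esub> f \<in> critical p"
  shows "f \<in> critical p"
proof -
  have uf: "u \<otimes>\<^bsub>Poly I\<^esub> f \<in> p" "\<And>x. pd x (u \<otimes>\<^bsub>Poly I\<^esub> f) \<in> p" using assms(4) by (auto simp: critical_def)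
  have f: "f \<in> p" using uf(1) p.mult_mem_iff[OF assms(1,3)] assms(2) by blast
  have "pd x f \<in> p" for x
    using uf(2)[of x] p.mult_mem_iff[OF assms(1) pd_closed[OF assms(3), of x]] assms(2)
    unfolding pd_mult_mem[OF assms(1) f] by blast
  then show ?thesis using f by (simp add: critical_def)
qed

lemma pd_pd_scale:
  assumes u: "u \<in> carrier (Poly I)" and f: "f \<in> critical p"
  shows "\<exists>e\<in>p. pd x (pd y (u \<otimes>\<^bsub>Poly I\<^esub> f)) = u \<otimes>\<^bsub>Poly I\<^esub> pd x (pd y f) \<oplus>\<^bsub>Poly I\<^esub> e"
proof -
  have fp: "f \<in> p" "\<And>x. pd x f \<in> p" using f by (auto simp: critical_def)
  note fc = p.Icarr[OF fp(1)]
  note uc = pd_closed[OF u] and uuc = pd_closed[OF pd_closed[OF u]] and fyc = pd_closed[OF fc]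
  let ?e1 = "pd x (pd y u) \<otimes>\<^bsub>Poly I\<^esub> f \<oplus>\<^bsub>Poly I\<^esub> pd y u \<otimes>\<^bsub>Poly I\<^esub> pd x f" and ?e2 = "pd x u \<otimes>\<^bsub>Poly I\<^esub> pd y f"
  let ?h = "u \<otimes>\<^bsub>Poly I\<^esub> pd x (pd y f)"
  have e1: "?e1 \<in> p" by (rule p.a_closed[OF p.I_l_closed[OF fp(1) uuc] p.I_l_closed[OF fp(2) uc]])
  have e2: "?e2 \<in> p" by (rule p.I_l_closed[OF fp(2) uc])
  have h: "?h \<in> carrier (Poly I)" by (rule poly.m_closed[OF u pd_closed[OF fyc]])
  have "pd x (pd y (u \<otimes>\<^bsub>Poly I\<^esub> f)) = pd x (pd y u \<otimes>\<^bsub>Poly I\<^esub> f) \<oplus>\<^bsub>Poly I\<^esub> pd x (u \<otimes>\<^bsub>Poly I\<^esub> pd y f)"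
    unfolding pd_mult[OF u fc] by (rule pd_add[OF poly.m_closed[OF uc fc] poly.m_closed[OF u fyc]])
  also have "\<dots> = ?e1 \<oplus>\<^bsub>Poly I\<^esub> (?e2 \<oplus>\<^bsub>Poly I\<^esub> ?h)"
    by (simp only: pd_mult[OF uc fc] pd_mult[OF u fyc])
  also have "\<dots> = (?e1 \<oplus>\<^bsub>Poly I\<^esub> ?e2) \<oplus>\<^bsub>Poly I\<^esub> ?h"
    by (rule poly.a_assoc[OF p.Icarr[OF e1] p.Icarr[OF e2] h, symmetric])
  also have "\<dots> = ?h \<oplus>\<^bsub>Poly I\<^esub> (?e1 \<oplus>\<^bsub>Poly I\<^esub> ?e2)"
    by (rule poly.a_comm[OF p.Icarr[OF p.a_closed[OF e1 e2]] h])
  finally show ?thesis using p.a_closed[OF e1 e2] by blast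
qed

end

lemma pd_mem_sub:
  assumes "J \<subseteq> I" "f \<in> carrier (Poly J)"
  shows "pd x f \<in> carrier (Poly J)"
proof -
  interpret J: poly_over R J ..
  show ?thesis by (rule J.pd_closed[OF assms(2)])
qed

end

context generic_symmetric
begin

lemma minor_idl_critical:
  assumes p: "primeideal p SX" and rank: "principal_rank p r f"
  shows "minor_idl (Suc (Suc r)) \<subseteq> critical p"
proof (rule minor_idl_subset[OF critical_ideal[OF p]])
  fix a b assume ab: "a ` {..<Suc (Suc r)} \<subseteq> {..<n}" "b ` {..<Suc (Suc r)} \<subseteq> {..<n}"
  have *: "(mat.minor r f f [^]\<^bsub>SX\<^esub> (2::nat)) [^]\<^bsub>SX\<^esub> Suc (Suc r) \<otimes>\<^bsub>SX\<^esub> mat.minor (Suc (Suc r)) a b \<in> critical p"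
  proof (rule mat.minor_mem_of_bordered_square[OF critical_ideal[OF p] lessI])
    fix i j k l assume "i < Suc (Suc r)" "j < Suc (Suc r)" "k < Suc (Suc r)" "l < Suc (Suc r)"
    then have "a i < n" "b j < n" "a k < n" "b l < n" using ab by auto
    then show "mat.minor (Suc r) (f(r := a i)) (f(r := b j)) \<otimes>\<^bsub>SX\<^esub> mat.minor (Suc r) (f(r := a k)) (f(r := b l))
        \<in> critical p"
      using rank_bordered[OF p rank] by (intro mult_mem_critical[OF p])
  qed
  note pow = rank_pow_pow[OF p rank, of 2 "Suc (Suc r)"]
  show "mat.minor (Suc (Suc r)) a b \<in> critical p"
    by (rule mem_critical_of_scale[OF p DiffD1[OF pow] _ mat.minor_closed *]) (rule notI, erule DiffD2[OF pow])
qed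

lemma leading_minor_notin:
  assumes "r \<le> n" and q: "primeideal q R"
  shows "mat.minor r id id \<notin> coeff_ideal q"
proof -
  interpret q: primeideal q R by (rule q)
  obtain h where h: "h \<in> Ring.ring_hom SX R" "\<And>k. k \<in> carrier R \<Longrightarrow> h (indexed_const k) = id k"
    "\<And>c. c \<in> sym_indices n \<Longrightarrow> h (indexed_var c) = (if fst c = snd c then \<one> else \<zero>)"
  proof (rule eval_hom[of R id "\<lambda>c. if fst c = snd c then \<one> else \<zero>"])
    show "id \<in> Ring.ring_hom R R" by (rule ring_hom_memI) auto
  qed (auto simp: is_cring)
  interpret h: ring_hom_cring SX R h
    by (intro ring_hom_cring.intro ring_hom_cring_axioms.intro poly.is_cring is_cring h(1))
  have "coeff_ideal q \<subseteq> {f \<in> carrier SX. h f \<in> q}"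
    by (rule coeff_ideal_subset[OF q.is_ideal h.ideal_vimage[OF q.is_ideal]])
      (use h(2) const_mem q.Icarr in simp)
  moreover have "h (mat.minor r id id) = \<one>"
  proof -
    have entry: "h (gmat i j) = (if i = j then \<one> else \<zero>)" if "i < r" "j < r" for i j
      using that assms(1) h(3)[of "(min i j, max i j)"] by (auto simp: gmat_var sym_indices_def min_def max_def)
    have "h (gmat i (\<sigma> i)) = (if i = \<sigma> i then \<one> else \<zero>)" if "\<sigma> permutes {..<r}" "i < r" for \<sigma> i
      using permutes_in_image[OF that(1), of i] that(2) by (intro entry) simp_all
    then have "mat_det R r (\<lambda>i j. h (gmat i j)) = mat_det R r (\<lambda>i j. if i = j then \<one> else \<zero>)"
      unfolding mat_det_def
      by (intro finsum_cong' refl arg_cong[where f = "\<lambda>x. [_] \<cdot> x"] finprod_cong' funcsetI add.int_pow_closed finprod_closed)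
        auto
    then show ?thesis
      unfolding mat.minor_def using h.hom_mat_det[of gmat r] mat.A_closed mat_det_identity by simp
  qed
  ultimately show ?thesis using q.one_notin by auto
qed

end

lemma card_less_pairs:
  fixes U :: "'c :: linorder set"
  assumes "finite U"
  shows "card {(i, j). i \<in> U \<and> j \<in> U \<and> i < j} = card U choose 2"
proof -
  let ?L = "{(i, j). i \<in> U \<and> j \<in> U \<and> i < j}" and ?D = "(\<lambda>i. (i, i)) ` U"
  have eq: "{(i, j). i \<in> U \<and> j \<in> U \<and> i \<le> j} = ?L \<union> ?D" by auto
  have "finite ?L" by (rule finite_subset[of _ "U \<times> U"]) (use assms in auto)
  moreover have "?L \<inter> ?D = {}" by auto
  ultimately have "card (?L \<union> ?D) = card ?L + card ?D" using assms by (intro card_Un_disjoint) auto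
  moreover have "card ?D = card U" by (rule card_image) (simp add: inj_on_def)
  ultimately have "(card U + 1) choose 2 = card ?L + card U"
    unfolding card_le_pairs(2)[OF assms, symmetric] eq by (simp only:)
  then show ?thesis by (simp add: numeral_2_eq_2)
qed

lemma choose_two_times_gt:
  assumes "4 \<le> (m::nat)"
  shows "(m + 1) choose 2 < (m choose 2) * (m - 2)"
proof -
  have "m * 3 \<le> m * (m - 1)" using assms by (intro mult_le_mono) auto
  then have "m * 3 div 2 \<le> m choose 2" unfolding choose_two by (rule div_le_mono)
  then have "m < m choose 2" using assms by linarith
  moreover have "(m choose 2) * 2 \<le> (m choose 2) * (m - 2)" using assms by (intro mult_le_mono) auto
  moreover have "(m + 1) choose 2 = m + (m choose 2)" by (simp add: numeral_2_eq_2)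
  ultimately show ?thesis by linarith
qed

lemma choose_two_mono:
  assumes "a \<le> (b::nat)"
  shows "a choose 2 \<le> b choose 2"
  unfolding choose_two by (intro div_le_mono mult_le_mono diff_le_mono assms)

context generic_symmetric
begin

text \<open>The prime is the kernel of the map to the residue field of \<open>S[X]\<close> at \<open>q\<close> extended that makes
  the \<open>(r + 1)\<close>-minors bordering the leading \<open>r\<close>-minor vanish.\<close>

lemma special_prime:
  assumes "noetherian_ring R" "carrier R \<noteq> {\<zero>}" "r \<le> n"
  obtains p where "primeideal p SX" "principal_rank p r id"
    "krull_dim (loc_at SX p) \<le> enat ((n - r + 1) choose 2)"
proof -
  obtain q where q: "primeideal q R" "\<And>q'. primeideal q' R \<Longrightarrow> q' \<subseteq> q \<Longrightarrow> q' = q"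
    using exists_minimal_prime[OF assms(1,2)] by blast
  let ?C = "outside id r"
  have img: "id ` {..<r} \<subseteq> {..<n}" using assms(3) by auto
  note \<Delta> = principal_minor_free[OF img] leading_minor_notin[OF assms(3) q(1)]
  have "\<exists>g. g \<in> carrier (Poly (sym_indices n - ?C)) \<and> mat.minor (Suc r) (id(r := fst c)) (id(r := snd c))
      = mat.minor r id id \<otimes>\<^bsub>SX\<^esub> indexed_var c \<oplus>\<^bsub>SX\<^esub> g" if "c \<in> ?C" for c
  proof -
    have mem: "(fst c, snd c) \<in> ?C" using that by simp
    obtain g where "g \<in> carrier (Poly (sym_indices n - ?C))" "mat.minor (Suc r) (id(r := fst c)) (id(r := snd c))
      = mat.minor r id id \<otimes>\<^bsub>SX\<^esub> indexed_var (fst c, snd c) \<oplus>\<^bsub>SX\<^esub> g"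
      by (rule bordered_minor_eq[OF img mem])
    then show ?thesis by (intro exI[of _ g]) simp
  qed
  then obtain g where g: "\<And>c. c \<in> ?C \<Longrightarrow> g c \<in> carrier (Poly (sym_indices n - ?C))"
    "\<And>c. c \<in> ?C \<Longrightarrow> mat.minor (Suc r) (id(r := fst c)) (id(r := snd c))
      = mat.minor r id id \<otimes>\<^bsub>SX\<^esub> indexed_var c \<oplus>\<^bsub>SX\<^esub> g c" by metis
  obtain p where p: "primeideal p SX"
    "\<And>c. c \<in> ?C \<Longrightarrow> mat.minor r id id \<otimes>\<^bsub>SX\<^esub> indexed_var c \<oplus>\<^bsub>SX\<^esub> g c \<in> p"
    "\<And>f. f \<in> carrier (Poly (sym_indices n - ?C)) \<Longrightarrow> f \<in> p \<longleftrightarrow> f \<in> coeff_ideal q"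
    by (rule section_prime[OF finite_sym_indices outside_sub q(1) \<Delta>, of g]) (erule g(1), blast)
  have border: "mat.minor (Suc r) (id(r := i)) (id(r := j)) \<in> p" if c: "(i, j) \<in> ?C" for i j
    using g(2)[OF c] p(2)[OF c] by simp
  have "mat.minor (Suc r) (id(r := i)) (id(r := j)) \<in> p" if ij: "i < n" "j < n" for i j
  proof (cases "i \<in> id ` {..<r} \<or> j \<in> id ` {..<r}")
    case True
    then have "\<not> inj_on (id(r := i)) {..<Suc r} \<or> \<not> inj_on (id(r := j)) {..<Suc r}"
      using not_inj_on_fun_upd[of i id r] not_inj_on_fun_upd[of j id r] by blast
    then have "mat.minor (Suc r) (id(r := i)) (id(r := j)) = \<zero>\<^bsub>SX\<^esub>" by (rule mat.minor_noninj)
    then show ?thesis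
      using additive_subgroup.zero_closed[OF ideal.axioms(1)[OF primeideal.axioms(1)[OF p(1)]]] by (simp only:)
  next
    case False
    then consider "(i, j) \<in> ?C" | "(j, i) \<in> ?C" using ij linear[of i j] by (auto simp: outside_def)
    then show ?thesis
    proof cases
      case 1
      then show ?thesis by (rule border)
    next
      case 2
      then show ?thesis unfolding mat.minor_commute[of "Suc r" "id(r := i)" "id(r := j)"] by (rule border)
    qed
  qed
  then have rank: "principal_rank p r id" unfolding principal_rank_def p(3)[OF \<Delta>(1)] using img \<Delta>(2) by blast
  have "krull_dim (loc_at SX p) \<le> enat (card ?C)"
  proof (rule prime_localization.krull_dim_loc_at_le[OF prime_localization.intro[OF poly.is_cring p(1)]])
    fix P :: "nat \<Rightarrow> ((nat \<times> nat) multiset \<Rightarrow> 'a) set"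
    assume P: "\<And>i. i \<le> Suc (card ?C) \<Longrightarrow> primeideal (P i) SX \<and> P i \<subseteq> p"
      and strict: "\<And>i. i < Suc (card ?C) \<Longrightarrow> P i \<subset> P (Suc i)"
    show False
    proof (rule no_long_chain[OF finite_sym_indices outside_sub q(1)])
      show "f \<in> coeff_ideal q" if "f \<in> carrier (Poly (sym_indices n - ?C))" "f \<in> p" for f
        using p(3)[OF that(1)] that(2) by blast
    qed (fact q(2) P strict)+
  qed
  then have "krull_dim (loc_at SX p) \<le> enat ((n - r + 1) choose 2)"
    by (simp only: card_outside[OF inj_on_id img])
  with p(1) rank show thesis by (rule that)
qed

lemma double_bordered_free:
  assumes "r \<le> k" "k < l" "l < n" "r \<le> i" "i < n" "i \<noteq> k" "i \<noteq> l" and x: "r \<le> u" "u \<le> v"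
    and "(u, v) \<noteq> (k, l)" "(u, v) \<noteq> (i, i)" "(u, v) \<noteq> (min k i, max k i)" "(u, v) \<noteq> (min i l, max i l)"
  shows "mat.minor (Suc (Suc r)) (id(r := k, Suc r := i)) (id(r := l, Suc r := i))
    \<in> carrier (Poly (sym_indices n - {(u, v)}))"
proof (rule minor_free)
  let ?f = "id(r := k, Suc r := i)" and ?g = "id(r := l, Suc r := i)"
  show "?f ` {..<Suc (Suc r)} \<subseteq> {..<n}" "?g ` {..<Suc (Suc r)} \<subseteq> {..<n}"
    using assms by (auto simp: less_Suc_eq)
  fix a b assume ab: "a < Suc (Suc r)" "b < Suc (Suc r)"
  have "?f a < r \<or> ?f a = k \<or> ?f a = i" "?g b < r \<or> ?g b = l \<or> ?g b = i" using ab by (auto simp: less_Suc_eq)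
  then show "(min (?f a) (?g b), max (?f a) (?g b)) \<notin> {(u, v)}"
    using assms by (elim disjE) (auto simp: min_def max_def split: if_splits)
qed

lemma pd_pd_double_bordered:
  assumes "r \<le> k" "k < l" "l < n" "r \<le> i" "i < n" "i \<noteq> k" "i \<noteq> l"
  shows "pd (i, i) (pd (k, l) (mat.minor (Suc (Suc r)) (id(r := k, Suc r := i)) (id(r := l, Suc r := i))))
    = mat.minor r id id"
proof -
  let ?V = "sym_indices n" and ?\<Delta> = "mat.minor r id id" and ?M = "mat.minor (Suc r) (id(r := k)) (id(r := l))"
  have img: "id ` {..<r} \<subseteq> {..<n}" using assms by auto
  have kl: "(k, l) \<in> outside id r" using assms by (auto simp: outside_def)
  have V: "(k, l) \<in> ?V" "(i, i) \<in> ?V" using assms by (auto simp: sym_indices_def)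
  have sub: "carrier (Poly (?V - outside id r)) \<subseteq> carrier (Poly (?V - {(k, l)}))"
    by (rule poly_over.sub_carrier) (use kl in \<open>auto intro: poly_over.intro is_cring\<close>)
  obtain g where g: "g \<in> carrier (Poly (?V - outside id r))" "?M = ?\<Delta> \<otimes>\<^bsub>SX\<^esub> indexed_var (k, l) \<oplus>\<^bsub>SX\<^esub> g"
    by (rule bordered_minor_eq[OF img kl])
  have M: "pd (k, l) ?M = ?\<Delta>"
    unfolding g(2) by (rule pd_var_add_free[OF subsetD[OF sub principal_minor_free[OF img]] subsetD[OF sub g(1)] V(1)])
  have f: "(id(r := k)) a < n \<and> (id(r := k)) a \<noteq> i" if "a < Suc r" for a using that assms by (auto simp: less_Suc_eq)
  have h: "(id(r := l)) a < n \<and> (id(r := l)) a \<noteq> i" if "a < Suc r" for a using that assms by (auto simp: less_Suc_eq)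
  have free: "gmat a b \<in> carrier (Poly (?V - {(i, i)}))" if "a < n" "b < n" "a \<noteq> i \<or> b \<noteq> i" for a b
    by (rule gmat_free[OF that(1,2)]) (use that(3) in \<open>auto simp: min_def max_def split: if_splits\<close>)
  obtain c where c: "c \<in> carrier (Poly (?V - {(i, i)}))"
    "mat.minor (Suc (Suc r)) (id(r := k, Suc r := i)) (id(r := l, Suc r := i)) = ?M \<otimes>\<^bsub>SX\<^esub> gmat i i \<oplus>\<^bsub>SX\<^esub> c"
  proof (rule mat.minor_last_row[OF sub_subring, of "?V - {(i, i)}" "Suc r" "id(r := k)" "id(r := l)" i i])
    show "gmat ((id(r := k)) a) ((id(r := l)) b) \<in> carrier (Poly (?V - {(i, i)}))" if "a < Suc r" "b < Suc r" for a b
      using f[OF that(1)] h[OF that(2)] by (intro free) blast+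
    show "gmat ((id(r := k)) a) i \<in> carrier (Poly (?V - {(i, i)}))" if "a < Suc r" for a
      using f[OF that] assms(5) by (intro free) blast+
    show "gmat i ((id(r := l)) b) \<in> carrier (Poly (?V - {(i, i)}))" if "b < Suc r" for b
      using h[OF that] assms(5) by (intro free) blast+
  qed auto
  have Mfree: "?M \<in> carrier (Poly (?V - {(i, i)}))"
  proof (rule minor_free)
    show "(id(r := k)) ` {..<Suc r} \<subseteq> {..<n}" "(id(r := l)) ` {..<Suc r} \<subseteq> {..<n}" using f h by blast+
    fix a b assume "a < Suc r" "b < Suc r"
    then show "(min ((id(r := k)) a) ((id(r := l)) b), max ((id(r := k)) a) ((id(r := l)) b)) \<notin> {(i, i)}"
      using f[of a] by (simp add: min_def max_def del: fun_upd_apply)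
  qed
  have sub_i: "?V - {(i, i)} \<subseteq> ?V" by blast
  note pM = pd_mem_sub[OF sub_i Mfree, of "(k, l)"] and pc = pd_mem_sub[OF sub_i c(1), of "(k, l)"]
  have ne: "(k, l) \<noteq> (i, i)" using assms by simp
  have Mc: "?M \<in> carrier SX" by (rule mat.minor_closed)
  have cc: "c \<in> carrier SX" using c(1) sub_carrier[OF sub_i] by blast
  have "pd (k, l) (?M \<otimes>\<^bsub>SX\<^esub> indexed_var (i, i) \<oplus>\<^bsub>SX\<^esub> c) = pd (k, l) ?M \<otimes>\<^bsub>SX\<^esub> indexed_var (i, i) \<oplus>\<^bsub>SX\<^esub> pd (k, l) c"
    unfolding pd_add[OF poly.m_closed[OF Mc var_mem[OF V(2)]] cc] pd_mult_var[OF Mc V(2)]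
    by (simp only: ne if_False poly.r_zero[OF poly.m_closed[OF pd_closed[OF Mc] var_mem[OF V(2)]]])
  then have "pd (i, i) (pd (k, l) (?M \<otimes>\<^bsub>SX\<^esub> indexed_var (i, i) \<oplus>\<^bsub>SX\<^esub> c)) = pd (k, l) ?M"
    using pd_var_add_free[OF pM pc V(2)] by (simp only:)
  then show ?thesis unfolding c(2) gmat_var[OF assms(5,5)] M by simp
qed

text \<open>On the ideal, the second derivatives \<open>\<partial>\<^sub>i\<^sub>i \<partial>\<^sub>k\<^sub>l\<close> modulo \<open>p\<close> are linear over the polynomial
  ring, and the doubly bordered minors form a dual family.\<close>

lemma min_gens_ge:
  assumes p: "primeideal p SX" and rank: "principal_rank p r id" and "r \<le> n"
  shows "enat (((n - r) choose 2) * (n - r - 2))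
    \<le> min_gens (loc_at SX p) (ideal_at SX p (minor_idl (Suc (Suc r))))"
proof -
  interpret p: primeideal p SX by (rule p)
  let ?I = "minor_idl (Suc (Suc r))"
  define U where "U = {r..<n}"
  define K where "K = {(k, l). k \<in> U \<and> l \<in> U \<and> k < l}"
  define W where "W = Sigma K (\<lambda>(k, l). U - {k, l})"
  define \<phi> where "\<phi> = (\<lambda>w f. pd (snd w, snd w) (pd (fst w) f))"
  define h where "h = (\<lambda>w. mat.minor (Suc (Suc r)) (id(r := fst (fst w), Suc r := snd w)) (id(r := snd (fst w), Suc r := snd w)))"
  have finU: "finite U" "card U = n - r" by (simp_all add: U_def)
  have finK: "finite K" unfolding K_def by (rule finite_subset[of _ "U \<times> U"]) (use finU in auto)
  have finW: "finite W" unfolding W_def using finK finU by (intro finite_SigmaI) auto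
  have W: "r \<le> k \<and> k < l \<and> l < n \<and> r \<le> i \<and> i < n \<and> i \<noteq> k \<and> i \<noteq> l" if "((k, l), i) \<in> W" for k l i
    using that by (auto simp: W_def K_def U_def)
  have "card W = (\<Sum>w\<in>K. card ((\<lambda>(k, l). U - {k, l}) w))"
    unfolding W_def by (rule card_SigmaI) (use finK finU in auto)
  also have "\<dots> = (\<Sum>w\<in>K. n - r - 2)"
  proof (rule sum.cong[OF refl])
    fix w assume "w \<in> K"
    then obtain k l where w: "w = (k, l)" "k \<in> U" "l \<in> U" "k \<noteq> l" by (auto simp: K_def)
    have "card (U - {k, l}) = card U - card {k, l}" by (rule card_Diff_subset) (use w in auto)
    then show "card ((\<lambda>(k, l). U - {k, l}) w) = n - r - 2" using w finU by simp
  qed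
  also have "\<dots> = ((n - r) choose 2) * (n - r - 2)"
    using card_less_pairs[OF finU(1)] by (simp add: K_def finU(2))
  finally have cardW: "card W = ((n - r) choose 2) * (n - r - 2)" .
  have crit: "f \<in> critical p" if "f \<in> ?I" for f using minor_idl_critical[OF p rank] that by blast
  have Ic: "f \<in> carrier SX" if "f \<in> ?I" for f using ideal.Icarr[OF minor_idl_ideal that] .
  have "enat (card W) \<le> min_gens (loc_at SX p) (ideal_at SX p ?I)"
  proof (rule prime_localization.min_gens_loc_at_ge[OF prime_localization.intro[OF poly.is_cring p] minor_idl_ideal finW])
    show "\<phi> w f \<in> carrier SX" if "f \<in> ?I" for w f
      unfolding \<phi>_def by (rule pd_closed[OF pd_closed[OF Ic[OF that]]])
    show "\<phi> w (f \<oplus>\<^bsub>SX\<^esub> g) = \<phi> w f \<oplus>\<^bsub>SX\<^esub> \<phi> w g" if fg: "f \<in> ?I" "g \<in> ?I" for w f g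
      unfolding \<phi>_def pd_add[OF Ic[OF fg(1)] Ic[OF fg(2)]]
      by (rule pd_add[OF pd_closed[OF Ic[OF fg(1)]] pd_closed[OF Ic[OF fg(2)]]])
    show "\<exists>e\<in>p. \<phi> w (u \<otimes>\<^bsub>SX\<^esub> f) = u \<otimes>\<^bsub>SX\<^esub> \<phi> w f \<oplus>\<^bsub>SX\<^esub> e" if "u \<in> carrier SX" "f \<in> ?I" for w u f
      unfolding \<phi>_def by (rule pd_pd_scale[OF p that(1) crit[OF that(2)]])
  next
    fix w assume wW: "w \<in> W"
    obtain k l i where w: "w = ((k, l), i)" by (cases w) auto
    note wW = W[OF wW[unfolded w]]
    have "(id(r := k, Suc r := i)) ` {..<Suc (Suc r)} \<subseteq> {..<n}" "(id(r := l, Suc r := i)) ` {..<Suc (Suc r)} \<subseteq> {..<n}"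
      using wW by (auto simp: less_Suc_eq)
    then show "h w \<in> ?I" unfolding h_def w fst_conv snd_conv by (rule minor_mem_minor_idl)
    have "\<phi> w (h w) = mat.minor r id id"
      unfolding \<phi>_def h_def w fst_conv snd_conv by (rule pd_pd_double_bordered) (use wW in blast)+
    then show "\<phi> w (h w) \<notin> p" using rank_notin[OF p rank] by (simp only: not_False_eq_True)
  next
    fix w w' assume wW: "w \<in> W" "w' \<in> W" and ne: "w \<noteq> w'"
    obtain k l i where w: "w = ((k, l), i)" by (cases w) auto
    obtain k' l' i' where w': "w' = ((k', l'), i')" by (cases w') auto
    note wK = W[OF wW(1)[unfolded w]] and wK' = W[OF wW(2)[unfolded w']]
    have \<phi>: "\<phi> w (h w') = pd (i, i) (pd (k, l) (h w'))" by (simp only: \<phi>_def w fst_conv snd_conv)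
    have h: "h w' = mat.minor (Suc (Suc r)) (id(r := k', Suc r := i')) (id(r := l', Suc r := i'))"
      by (simp only: h_def w' fst_conv snd_conv)
    have "\<phi> w (h w') = \<zero>\<^bsub>SX\<^esub>"
    proof (cases "i = i'")
      case True
      then have kl: "(k, l) \<noteq> (k', l')" using ne w w' by simp
      have "h w' \<in> carrier (Poly (sym_indices n - {(k, l)}))"
        unfolding h by (rule double_bordered_free) (use wK wK' kl True in \<open>auto simp: min_def max_def split: if_splits\<close>)
      then show ?thesis unfolding \<phi> using pd_free[of "h w'" "(k, l)"] pd_zero by simp
    next
      case False
      have "h w' \<in> carrier (Poly (sym_indices n - {(i, i)}))"
        unfolding h by (rule double_bordered_free) (use wK wK' False in \<open>auto simp: min_def max_def split: if_splits\<close>)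
      then have "pd (k, l) (h w') \<in> carrier (Poly (sym_indices n - {(i, i)}))" by (intro pd_mem_sub) blast+
      then show ?thesis unfolding \<phi> by (rule pd_free)
    qed
    then show "\<phi> w (h w') \<in> p" using p.zero_closed by (simp only:)
  qed
  then show ?thesis by (simp only: cardW)
qed

lemma satisfies_G_of_rank:
  assumes "t \<le> n" and "t = 1 \<or> t = n \<or> t = n - 1"
  shows "satisfies_G SX (minor_idl t) s"
  unfolding satisfies_G_def
proof (intro allI impI, elim conjE)
  fix p assume p: "primeideal p SX" "minor_idl t \<subseteq> p"
  obtain r f where r: "r < t" "principal_rank p r f" by (rule principal_rank_exists[OF p])
  have "t = Suc r \<or> t = n \<or> t = n - 1" using assms(2) r(1) by auto
  then show "min_gens (loc_at SX p) (ideal_at SX p (minor_idl t)) \<le> krull_dim (loc_at SX p)"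
    by (rule min_gens_le_krull_dim[OF p(1) r(2,1) assms(1)])
qed

lemma satisfies_G_choose:
  assumes "t \<le> n"
  shows "satisfies_G SX (minor_idl t) ((n - t + 3) choose 2)"
  unfolding satisfies_G_def
proof (intro allI impI, elim conjE)
  fix p assume p: "primeideal p SX" "minor_idl t \<subseteq> p"
    and dim: "krull_dim (loc_at SX p) + 1 \<le> enat ((n - t + 3) choose 2)"
  obtain r f where r: "r < t" "principal_rank p r f" by (rule principal_rank_exists[OF p])
  have "enat ((n - r + 1) choose 2) + 1 \<le> enat ((n - t + 3) choose 2)"
    using krull_dim_ge[OF p(1) r(2)] dim by (meson add_right_mono order_trans)
  then have less: "(n - r + 1) choose 2 < (n - t + 3) choose 2" by (simp add: one_enat_def)
  have "t = Suc r"
  proof (rule ccontr)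
    assume "t \<noteq> Suc r"
    then have "n - t + 3 \<le> n - r + 1" using r(1) assms by simp
    from choose_two_mono[OF this] less show False by simp
  qed
  then show "min_gens (loc_at SX p) (ideal_at SX p (minor_idl t)) \<le> krull_dim (loc_at SX p)"
    by (intro min_gens_le_krull_dim[OF p(1) r(2,1) assms]) blast
qed

lemma satisfies_G_le:
  assumes "noetherian_ring R" "carrier R \<noteq> {\<zero>}" and t: "2 \<le> t" "t + 2 \<le> n"
    and G: "satisfies_G SX (minor_idl t) s"
  shows "s \<le> (n - t + 3) choose 2"
proof (rule ccontr)
  assume s: "\<not> s \<le> (n - t + 3) choose 2"
  define r where "r = t - 2"
  have r: "t = Suc (Suc r)" "r \<le> n" "n - t + 3 = n - r + 1" "4 \<le> n - r" using t by (auto simp: r_def)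
  obtain p where p: "primeideal p SX" "principal_rank p r id"
    "krull_dim (loc_at SX p) \<le> enat ((n - r + 1) choose 2)"
    by (rule special_prime[OF assms(1,2) r(2)])
  have "minor_idl t \<subseteq> p" using minor_idl_critical[OF p(1,2)] unfolding r(1) critical_def by blast
  moreover have "krull_dim (loc_at SX p) + 1 \<le> enat ((n - r + 1) choose 2) + 1" by (rule add_right_mono[OF p(3)])
  then have "krull_dim (loc_at SX p) + 1 \<le> enat s"
    by (rule order_trans) (use s in \<open>simp add: r(3) one_enat_def\<close>)
  ultimately have "min_gens (loc_at SX p) (ideal_at SX p (minor_idl t)) \<le> krull_dim (loc_at SX p)"
    using G p(1) unfolding satisfies_G_def by blast
  then have "enat (((n - r) choose 2) * (n - r - 2)) \<le> enat ((n - r + 1) choose 2)"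
    using min_gens_ge[OF p(1,2) r(2)] p(3) unfolding r(1) by (meson order_trans)
  then show False using choose_two_times_gt[OF r(4)] by simp
qed

end

theorem corollary3p4:
  fixes S :: "('a, 'b) ring_scheme" and n t :: nat
  assumes "cring S" and "noetherian_ring S" and "carrier S \<noteq> {\<zero>\<^bsub>S\<^esub>}"
    and "1 \<le> t" and "t \<le> n"
  shows "let R = sym_poly_ring S n;
             I = minor_ideal R n t (generic_sym_matrix S)
         in (satisfies_G_infinity R I \<longleftrightarrow> t = 1 \<or> t = n \<or> t = n - 1) \<and>
            (\<not> (t = 1 \<or> t = n \<or> t = n - 1) \<longrightarrow>
               satisfies_G R I ((n - t + 3) choose 2) \<and>
               (\<forall>s. satisfies_G R I s \<longrightarrow> s \<le> (n - t + 3) choose 2))"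
proof -
  interpret generic_symmetric S n by (rule generic_symmetric.intro[OF assms(1)])
  have le: "s \<le> (n - t + 3) choose 2"
    if "\<not> (t = 1 \<or> t = n \<or> t = n - 1)" "satisfies_G SX (minor_idl t) s" for s
    by (rule satisfies_G_le[OF assms(2,3) _ _ that(2)]) (use that(1) assms(4,5) in auto)
  have "satisfies_G_infinity SX (minor_idl t) \<longleftrightarrow> t = 1 \<or> t = n \<or> t = n - 1"
  proof
    assume "satisfies_G_infinity SX (minor_idl t)"
    then have "satisfies_G SX (minor_idl t) (Suc ((n - t + 3) choose 2))" unfolding satisfies_G_infinity_def by blast
    then show "t = 1 \<or> t = n \<or> t = n - 1" using le[of "Suc ((n - t + 3) choose 2)"] by linarith
  next
    assume "t = 1 \<or> t = n \<or> t = n - 1"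
    then show "satisfies_G_infinity SX (minor_idl t)"
      unfolding satisfies_G_infinity_def using satisfies_G_of_rank[OF assms(5)] by blast
  qed
  then show ?thesis
    unfolding Let_def sym_poly_ring_def using le satisfies_G_choose[OF assms(5)] by blast
qed

end
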